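(* Let $\Omega\subseteq\mathbb{C}$ be an open set with $0\in\Omega$. If $\phi:A\to B$ is a dense and completely relatively spectral morphism between good Fréchet algebras, then $\phi$ induces an isomorphism $K_\Omega(A)\simeq K_\Omega(B)$.
   Context: Algebras are complex and unital; morphisms are continuous unital algebra homomorphisms; subalgebras contain the unit. A Fréchet algebra is an algebra equipped with a countable family of submultiplicative seminorms (not required to be unital) making it a Fréchet space; it is good if its group of invertibles is open and inversion is continuous on it. If $A$ is a good Fréchet algebra then so is $M_n(A)$, with seminorms $\|(a_{ij})\|_k=\sum_{i,j}\|a_{ij}\|_k$. $\mathrm{sp}_A(a)$ denotes the spectrum of $a$ in $A$. A morphism $\phi:A\to B$ is dense if $\phi(A)$ is dense in $B$. It is relatively spectral if there is a dense subalgebra $X$ of $A$ with $\mathrm{sp}_B(\phi(x))=\mathrm{sp}_A(x)$ for all $x\in X$. It is completely relatively spectral if for every $n\ge 1$ the amplified (entrywise) morphism $M_n(\phi):M_n(A)\to M_n(B)$ is relatively spectral. Spectral K-functors: for a good Fréchet algebra $A$ put $A_\Omega=\{a\in A:\mathrm{sp}_A(a)\subseteq\Omega\}$, and similarly $M_n(A)_\Omega\subseteq M_n(A)$. Let $V_\Omega(A)=\big(\bigsqcup_{n\ge1}M_n(A)_\Omega\big)/\sim$, where $a\in M_p(A)_\Omega$ and $b\in M_q(A)_\Omega$ are equivalent if $\mathrm{diag}(a,0_{n-p})$ and $\mathrm{diag}(b,0_{n-q})$ are joined by a path in $M_n(A)_\Omega$ for some $n\ge p,q$. It is an abelian monoid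 under $[a]+[b]=[\mathrm{diag}(a,b)]$, and $K_\Omega(A)$ is its Grothendieck group. A morphism $\phi:A\to B$ induces $V_\Omega(A)\to V_\Omega(B)$, $[a]\mapsto[\phi(a)]$ ($\phi$ applied entrywise), and hence a group homomorphism $K_\Omega(A)\to K_\Omega(B)$. *)

theory Defs
  imports
    "HOL-Analysis.Analysis"
    "HOL-Algebra.Subrings"
    "Jordan_Normal_Form.Matrix"
begin

section \<open>Frechet algebras\<close>

definition complex_field :: "complex ring" where
  "complex_field = \<lparr>carrier = UNIV, mult = (*), one = 1, zero = 0, add = (+)\<rparr>"

text \<open>The seminorms are indexed by the naturals; a finite family is covered by repeating one of
  its members.\<close>

record 'a frechet_alg = "(complex, 'a) module" +
  seminorm :: "nat \<Rightarrow> 'a \<Rightarrow> real"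

text \<open>The locally convex topology on the carrier: the balls of the single seminorms form a
  subbase.\<close>

definition frechet_topology :: "'a frechet_alg \<Rightarrow> 'a topology" where
  "frechet_topology A = topology_generated_by
     {{y \<in> carrier A. seminorm A k (y \<ominus>\<^bsub>A\<^esub> x) < r} | k x r. x \<in> carrier A \<and> 0 < r}"

text \<open>Complex unital algebras, not assumed commutative (unlike the HOL-Algebra locale
  \<open>algebra\<close>) nor nonzero. Nothing is assumed about the seminorms of the unit. The topology being
  metrizable, completeness is expressed by Cauchy sequences.\<close>

locale frechet_algebra =
  Module.module complex_field A + Ring.ring A for A :: "'a frechet_alg" (structure) +
  assumes smult_mult_left:
      "\<lbrakk>x \<in> carrier A; y \<in> carrier A\<rbrakk> \<Longrightarrow> (c \<odot> x) \<otimes> y = c \<odot> (x \<otimes> y)"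
    and smult_mult_right:
      "\<lbrakk>x \<in> carrier A; y \<in> carrier A\<rbrakk> \<Longrightarrow> x \<otimes> (c \<odot> y) = c \<odot> (x \<otimes> y)"
    and seminorm_nonneg: "x \<in> carrier A \<Longrightarrow> 0 \<le> seminorm A k x"
    and seminorm_add:
      "\<lbrakk>x \<in> carrier A; y \<in> carrier A\<rbrakk> \<Longrightarrow> seminorm A k (x \<oplus> y) \<le> seminorm A k x + seminorm A k y"
    and seminorm_smult: "x \<in> carrier A \<Longrightarrow> seminorm A k (c \<odot> x) = cmod c * seminorm A k x"
    and seminorm_mult:
      "\<lbrakk>x \<in> carrier A; y \<in> carrier A\<rbrakk> \<Longrightarrow> seminorm A k (x \<otimes> y) \<le> seminorm A k x * seminorm A k y"
    and separated: "\<lbrakk>x \<in> carrier A; \<And>k. seminorm A k x = 0\<rbrakk> \<Longrightarrow> x = \<zero>"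
    and complete:
      "\<lbrakk>\<And>n. s n \<in> carrier A;
        \<And>k e. 0 < e \<Longrightarrow> \<exists>N. \<forall>m\<ge>N. \<forall>n\<ge>N. seminorm A k (s m \<ominus> s n) < e\<rbrakk>
       \<Longrightarrow> \<exists>l\<in>carrier A. limitin (frechet_topology A) s l sequentially"

locale good_frechet_algebra = frechet_algebra +
  assumes open_Units: "openin (frechet_topology A) (Units A)"
    and continuous_inverse:
      "continuous_map (subtopology (frechet_topology A) (Units A)) (frechet_topology A) (m_inv A)"

definition spectrum :: "'a frechet_alg \<Rightarrow> 'a \<Rightarrow> complex set" where
  "spectrum A a = {c. c \<odot>\<^bsub>A\<^esub> \<one>\<^bsub>A\<^esub> \<ominus>\<^bsub>A\<^esub> a \<notin> Units A}"


section \<open>Matrix algebras\<close>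

definition mat_algebra :: "nat \<Rightarrow> 'a frechet_alg \<Rightarrow> 'a mat frechet_alg" where
  "mat_algebra n A =
    \<lparr>carrier = {M \<in> carrier_mat n n. elements_mat M \<subseteq> carrier A},
     mult = (\<lambda>M N. mat n n (\<lambda>(i, j). \<Oplus>\<^bsub>A\<^esub>k\<in>{..<n}. M $$ (i, k) \<otimes>\<^bsub>A\<^esub> N $$ (k, j))),
     one = mat n n (\<lambda>(i, j). if i = j then \<one>\<^bsub>A\<^esub> else \<zero>\<^bsub>A\<^esub>),
     zero = mat n n (\<lambda>_. \<zero>\<^bsub>A\<^esub>),
     add = (\<lambda>M N. mat n n (\<lambda>(i, j). M $$ (i, j) \<oplus>\<^bsub>A\<^esub> N $$ (i, j))),
     smult = (\<lambda>c M. mat n n (\<lambda>(i, j). c \<odot>\<^bsub>A\<^esub> M $$ (i, j))),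
     seminorm = (\<lambda>k M. \<Sum>i<n. \<Sum>j<n. seminorm A k (M $$ (i, j)))\<rparr>"

definition diag_block :: "'a frechet_alg \<Rightarrow> 'a mat \<Rightarrow> 'a mat \<Rightarrow> 'a mat" where
  "diag_block A a b = four_block_mat
     a (mat (dim_row a) (dim_col b) (\<lambda>_. \<zero>\<^bsub>A\<^esub>))
     (mat (dim_row b) (dim_col a) (\<lambda>_. \<zero>\<^bsub>A\<^esub>)) b"

text \<open>\<open>pad_zero A n a\<close> is \<open>diag(a, 0)\<close> of size \<open>n\<close>, for \<open>a\<close> square of size at most \<open>n\<close>.\<close>

definition pad_zero :: "'a frechet_alg \<Rightarrow> nat \<Rightarrow> 'a mat \<Rightarrow> 'a mat" where
  "pad_zero A n a = diag_block A a (mat (n - dim_row a) (n - dim_row a) (\<lambda>_. \<zero>\<^bsub>A\<^esub>))"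


section \<open>Morphisms\<close>

definition frechet_morphism :: "'a frechet_alg \<Rightarrow> 'b frechet_alg \<Rightarrow> ('a \<Rightarrow> 'b) \<Rightarrow> bool" where
  "frechet_morphism A B \<phi> \<longleftrightarrow>
     \<phi> \<in> Ring.ring_hom A B \<and>
     (\<forall>c. \<forall>x\<in>carrier A. \<phi> (c \<odot>\<^bsub>A\<^esub> x) = c \<odot>\<^bsub>B\<^esub> \<phi> x) \<and>
     continuous_map (frechet_topology A) (frechet_topology B) \<phi>"

definition dense_in :: "'a frechet_alg \<Rightarrow> 'a set \<Rightarrow> bool" where
  "dense_in A X \<longleftrightarrow> frechet_topology A closure_of X = carrier A"

definition dense_morphism :: "'a frechet_alg \<Rightarrow> 'b frechet_alg \<Rightarrow> ('a \<Rightarrow> 'b) \<Rightarrow> bool" where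
  "dense_morphism A B \<phi> \<longleftrightarrow> dense_in B (\<phi> ` carrier A)"

text \<open>Here \<open>subring\<close> includes the unit.\<close>

definition unital_subalgebra :: "'a set \<Rightarrow> 'a frechet_alg \<Rightarrow> bool" where
  "unital_subalgebra X A \<longleftrightarrow> subring X A \<and> submodule X complex_field A"

definition relatively_spectral :: "'a frechet_alg \<Rightarrow> 'b frechet_alg \<Rightarrow> ('a \<Rightarrow> 'b) \<Rightarrow> bool" where
  "relatively_spectral A B \<phi> \<longleftrightarrow>
     (\<exists>X. unital_subalgebra X A \<and> dense_in A X \<and> (\<forall>x\<in>X. spectrum B (\<phi> x) = spectrum A x))"

definition completely_relatively_spectral ::
    "'a frechet_alg \<Rightarrow> 'b frechet_alg \<Rightarrow> ('a \<Rightarrow> 'b) \<Rightarrow> bool" where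
  "completely_relatively_spectral A B \<phi> \<longleftrightarrow>
     (\<forall>n\<ge>1. relatively_spectral (mat_algebra n A) (mat_algebra n B) (map_mat \<phi>))"


section \<open>Grothendieck groups\<close>

text \<open>Abelian monoids and groups are written multiplicatively, as in HOL-Algebra. The pair
  \<open>(x, y)\<close> stands for the formal difference of \<open>x\<close> and \<open>y\<close>.\<close>

definition groth_rel :: "'a monoid \<Rightarrow> (('a \<times> 'a) \<times> ('a \<times> 'a)) set" where
  "groth_rel M = {((x, y), (x', y')) | x y x' y'.
     x \<in> carrier M \<and> y \<in> carrier M \<and> x' \<in> carrier M \<and> y' \<in> carrier M \<and>
     (\<exists>z\<in>carrier M. x \<otimes>\<^bsub>M\<^esub> y' \<otimes>\<^bsub>M\<^esub> z = x' \<otimes>\<^bsub>M\<^esub> y \<otimes>\<^bsub>M\<^esub> z)}"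

definition grothendieck_group :: "'a monoid \<Rightarrow> ('a \<times> 'a) set monoid" where
  "grothendieck_group M =
    \<lparr>carrier = (carrier M \<times> carrier M) // groth_rel M,
     mult = (\<lambda>U V. \<Union>(x, y)\<in>U. \<Union>(x', y')\<in>V. groth_rel M `` {(x \<otimes>\<^bsub>M\<^esub> x', y \<otimes>\<^bsub>M\<^esub> y')}),
     one = groth_rel M `` {(\<one>\<^bsub>M\<^esub>, \<one>\<^bsub>M\<^esub>)}\<rparr>"

definition grothendieck_map :: "'b monoid \<Rightarrow> ('a \<Rightarrow> 'b) \<Rightarrow> ('a \<times> 'a) set \<Rightarrow> ('b \<times> 'b) set" where
  "grothendieck_map N f U = (\<Union>(x, y)\<in>U. groth_rel N `` {(f x, f y)})"


section \<open>Spectral K-functors\<close>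

definition spectral_part :: "complex set \<Rightarrow> 'a frechet_alg \<Rightarrow> 'a set" where
  "spectral_part \<Omega> A = {a \<in> carrier A. spectrum A a \<subseteq> \<Omega>}"

text \<open>The union is disjoint since the type \<open>mat\<close> records the dimensions.\<close>

definition V_set :: "complex set \<Rightarrow> 'a frechet_alg \<Rightarrow> 'a mat set" where
  "V_set \<Omega> A = (\<Union>n\<in>{1..}. spectral_part \<Omega> (mat_algebra n A))"

definition V_rel :: "complex set \<Rightarrow> 'a frechet_alg \<Rightarrow> ('a mat \<times> 'a mat) set" where
  "V_rel \<Omega> A = {(a, b). a \<in> V_set \<Omega> A \<and> b \<in> V_set \<Omega> A \<and>
     (\<exists>n g. dim_row a \<le> n \<and> dim_row b \<le> n \<and>
        pathin (subtopology (frechet_topology (mat_algebra n A))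
                            (spectral_part \<Omega> (mat_algebra n A))) g \<and>
        g 0 = pad_zero A n a \<and> g 1 = pad_zero A n b)}"

text \<open>The neutral element is the class of the zero matrix of size one.\<close>

definition V_monoid :: "complex set \<Rightarrow> 'a frechet_alg \<Rightarrow> 'a mat set monoid" where
  "V_monoid \<Omega> A =
    \<lparr>carrier = V_set \<Omega> A // V_rel \<Omega> A,
     mult = (\<lambda>U V. \<Union>a\<in>U. \<Union>b\<in>V. V_rel \<Omega> A `` {diag_block A a b}),
     one = V_rel \<Omega> A `` {mat 1 1 (\<lambda>_. \<zero>\<^bsub>A\<^esub>)}\<rparr>"

definition V_map :: "complex set \<Rightarrow> 'b frechet_alg \<Rightarrow> ('a \<Rightarrow> 'b) \<Rightarrow> 'a mat set \<Rightarrow> 'b mat set" where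
  "V_map \<Omega> B \<phi> U = (\<Union>a\<in>U. V_rel \<Omega> B `` {map_mat \<phi> a})"

definition K_group :: "complex set \<Rightarrow> 'a frechet_alg \<Rightarrow> ('a mat set \<times> 'a mat set) set monoid" where
  "K_group \<Omega> A = grothendieck_group (V_monoid \<Omega> A)"

definition K_map :: "complex set \<Rightarrow> 'b frechet_alg \<Rightarrow> ('a \<Rightarrow> 'b) \<Rightarrow>
    ('a mat set \<times> 'a mat set) set \<Rightarrow> ('b mat set \<times> 'b mat set) set" where
  "K_map \<Omega> B \<phi> = grothendieck_map (V_monoid \<Omega> B) (V_map \<Omega> B \<phi>)"

end

theory Submission
  imports Defs
begin

text \<open>The spectral part of each matrix algebra is open (by compactness of the complement of the domain
  on the Riemann sphere, once the units are known to be open, which follows from column elimination).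
  Both algebras being locally convex, a path in the spectral part of \<open>M\<^sub>n(B)\<close> can be
  replaced by a polygon with vertices in the image of the dense subalgebra \<open>X\<close> on which spectra agree.
  As \<open>X\<close> is a linear subspace, that polygon lifts to \<open>X\<close>, inside the spectral part of \<open>M\<^sub>n(A)\<close>.
  So the morphism induces a bijection on path components of the spectral parts, hence an isomorphism of
  the monoids \<open>V\<close> and of their Grothendieck groups. That \<open>V\<close> is a commutative monoid at all
  rests on conjugation by permutation matrices, which are joined to the identity by unitary scalar
  matrices.\<close>

section \<open>Seminormed algebras\<close>

text \<open>The dense subalgebras on which spectra agree are given for each matrix size separately,
  with no relation between different sizes: padding or adding blocks may leave them. Hence paths are
  compared at one fixed size at a time, and the comparison is extended from the subalgebra to the
  whole spectral part before padding and block sums enter. No estimate in the source controls a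
  lifted segment: its endpoints may lie far apart there, and what counts is that its image runs in a
  ball inside the spectral part of the target. Since the same topology, paths and spectra are needed
  for \<open>A\<close> and for each \<open>mat_algebra n A\<close>, they are treated in one locale
  that is interpreted for all of these algebras.\<close>

locale seminormed_algebra =
  Module.module complex_field A + Ring.ring A for A :: "'a frechet_alg" (structure) +
  assumes smult_mult_left:
      "\<lbrakk>x \<in> carrier A; y \<in> carrier A\<rbrakk> \<Longrightarrow> (c \<odot> x) \<otimes> y = c \<odot> (x \<otimes> y)"
    and smult_mult_right:
      "\<lbrakk>x \<in> carrier A; y \<in> carrier A\<rbrakk> \<Longrightarrow> x \<otimes> (c \<odot> y) = c \<odot> (x \<otimes> y)"
    and seminorm_nonneg: "x \<in> carrier A \<Longrightarrow> 0 \<le> seminorm A k x"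
    and seminorm_add:
      "\<lbrakk>x \<in> carrier A; y \<in> carrier A\<rbrakk> \<Longrightarrow> seminorm A k (x \<oplus> y) \<le> seminorm A k x + seminorm A k y"
    and seminorm_smult: "x \<in> carrier A \<Longrightarrow> seminorm A k (c \<odot> x) = cmod c * seminorm A k x"
    and seminorm_mult:
      "\<lbrakk>x \<in> carrier A; y \<in> carrier A\<rbrakk> \<Longrightarrow> seminorm A k (x \<otimes> y) \<le> seminorm A k x * seminorm A k y"

sublocale frechet_algebra \<subseteq> seminormed_algebra
  by unfold_locales
    (simp_all add: smult_mult_left smult_mult_right seminorm_nonneg seminorm_add seminorm_smult
      seminorm_mult)

context seminormed_algebra
begin

section \<open>Arithmetic of scalars, differences and seminorms\<close>

lemma scal_closed [simp, intro]: "x \<in> carrier A \<Longrightarrow> c \<odot> x \<in> carrier A"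
  using smult_closed by (simp add: complex_field_def)

lemma scal_add_left: "x \<in> carrier A \<Longrightarrow> (c + d) \<odot> x = c \<odot> x \<oplus> d \<odot> x"
  using smult_l_distr[of c d x] by (simp add: complex_field_def)

lemma scal_add_right:
  "\<lbrakk>x \<in> carrier A; y \<in> carrier A\<rbrakk> \<Longrightarrow> c \<odot> (x \<oplus> y) = c \<odot> x \<oplus> c \<odot> y"
  using smult_r_distr[of c x y] by (simp add: complex_field_def)

lemma scal_scal: "x \<in> carrier A \<Longrightarrow> c \<odot> (d \<odot> x) = (c * d) \<odot> x"
  using smult_assoc1[of c d x] by (simp add: complex_field_def)

lemma scal_one [simp]: "x \<in> carrier A \<Longrightarrow> 1 \<odot> x = x"
  using smult_one[of x] by (simp add: complex_field_def)

lemma scal_zero [simp]: "x \<in> carrier A \<Longrightarrow> 0 \<odot> x = \<zero>"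
  using smult_l_null[of x] by (simp add: complex_field_def)

lemma scal_zero_right [simp]: "c \<odot> \<zero> = \<zero>"
  using smult_r_null[of c] by (simp add: complex_field_def)

lemma scal_neg: "x \<in> carrier A \<Longrightarrow> (- c) \<odot> x = \<ominus> (c \<odot> x)"
  using scal_add_left[of x "- c" c] by (intro M.minus_equality[symmetric]) auto

lemma neg_eq_scal: "x \<in> carrier A \<Longrightarrow> \<ominus> x = (- 1) \<odot> x"
  by (simp add: scal_neg)

lemma diff_eq_scal: "\<lbrakk>x \<in> carrier A; y \<in> carrier A\<rbrakk> \<Longrightarrow> x \<ominus> y = x \<oplus> (- 1) \<odot> y"
  by (simp add: a_minus_def neg_eq_scal)

lemma seminorm_zero [simp]: "seminorm A k \<zero> = 0"
  using seminorm_smult[of \<zero> k 0] by simp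

lemma diff_split:
  "\<lbrakk>x \<in> carrier A; y \<in> carrier A; z \<in> carrier A\<rbrakk> \<Longrightarrow> x \<ominus> z = (x \<ominus> y) \<oplus> (y \<ominus> z)"
  by (simp add: a_minus_def M.a_assoc M.r_neg1)

lemma add_diff_cancel: "\<lbrakk>x \<in> carrier A; y \<in> carrier A\<rbrakk> \<Longrightarrow> x \<oplus> (y \<ominus> x) = y"
  by (simp add: a_minus_def M.a_comm[of x] M.a_assoc M.l_neg)

lemma seminorm_diff_triangle:
  assumes "x \<in> carrier A" "y \<in> carrier A" "z \<in> carrier A"
  shows "seminorm A k (x \<ominus> z) \<le> seminorm A k (x \<ominus> y) + seminorm A k (y \<ominus> z)"
  using assms by (simp add: diff_split[OF assms] seminorm_add)

lemma diff_self [simp]: "x \<in> carrier A \<Longrightarrow> x \<ominus> x = \<zero>"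
  by (simp add: a_minus_def M.r_neg)

lemma add_diff_cancel_left': "\<lbrakk>x \<in> carrier A; y \<in> carrier A\<rbrakk> \<Longrightarrow> (x \<oplus> y) \<ominus> x = y"
  by (simp add: a_minus_def M.a_comm[of x] M.a_assoc M.r_neg)

text \<open>The increment of a product splits into two linear terms and a quadratic one;
  submultiplicativity bounds each of them when continuity of multiplication is proved.\<close>

lemma mult_expand:
  assumes "a \<in> carrier A" "b \<in> carrier A" "d \<in> carrier A" "e \<in> carrier A"
  shows "(a \<oplus> d) \<otimes> (b \<oplus> e) \<ominus> a \<otimes> b = a \<otimes> e \<oplus> d \<otimes> b \<oplus> d \<otimes> e"
proof -
  have "(a \<oplus> d) \<otimes> (b \<oplus> e) = a \<otimes> b \<oplus> (a \<otimes> e \<oplus> d \<otimes> b \<oplus> d \<otimes> e)"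
    using assms by (simp add: l_distr r_distr M.a_ac)
  then show ?thesis
    using assms by (simp add: add_diff_cancel_left')
qed

section \<open>Basic neighbourhoods and the continuity criterion\<close>

lemma topspace_frechet [simp]: "topspace (frechet_topology A) = carrier A"
proof -
  have "x \<in> \<Union>{{y \<in> carrier A. seminorm A k (y \<ominus> x) < r} | k x r. x \<in> carrier A \<and> 0 < r}"
    if "x \<in> carrier A" for x
    using that by (auto intro!: exI[of _ "{y \<in> carrier A. seminorm A 0 (y \<ominus> x) < 1}"] exI[of _ 0]
        exI[of _ x] exI[of _ "1::real"])
  then show ?thesis
    by (auto simp: frechet_topology_def topology_generated_by_topspace)
qed

text \<open>The balls of single seminorms are only a subbase. Bounding all seminorms up to index
  \<open>K\<close> by one radius gives a base: two such balls with the same centre contain a third,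
  with the larger index and the smaller radius.\<close>

definition nball :: "nat \<Rightarrow> 'a \<Rightarrow> real \<Rightarrow> 'a set"
  where "nball K x r = {y \<in> carrier A. \<forall>k\<le>K. seminorm A k (y \<ominus> x) < r}"

lemma centre_in_nball: "\<lbrakk>x \<in> carrier A; 0 < r\<rbrakk> \<Longrightarrow> x \<in> nball K x r"
  by (simp add: nball_def)

lemma openin_ball:
  "\<lbrakk>x \<in> carrier A; 0 < r\<rbrakk> \<Longrightarrow> openin (frechet_topology A) {y \<in> carrier A. seminorm A k (y \<ominus> x) < r}"
  unfolding frechet_topology_def by (rule topology_generated_by_Basis) auto

lemma openin_nball:
  assumes "x \<in> carrier A" "0 < r"
  shows "openin (frechet_topology A) (nball K x r)"
proof -
  have "nball K x r = (\<Inter>k\<in>{..K}. {y \<in> carrier A. seminorm A k (y \<ominus> x) < r})"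
    by (auto simp: nball_def)
  then show ?thesis
    using assms by (auto intro!: openin_Inter openin_ball)
qed

lemma nball_mono: "\<lbrakk>K \<le> L; r \<le> s\<rbrakk> \<Longrightarrow> nball L x r \<subseteq> nball K x s"
  unfolding nball_def by (auto dest: le_trans intro!: less_le_trans[of _ r s])

text \<open>Induction on the generation of the topology from its subbase: by the triangle inequality
  a subbasic ball contains, around each of its points, the ball of the remaining radius.\<close>

lemma openin_frechet_iff:
  "openin (frechet_topology A) U \<longleftrightarrow>
     U \<subseteq> carrier A \<and> (\<forall>x\<in>U. \<exists>K r. 0 < r \<and> nball K x r \<subseteq> U)" (is "_ \<longleftrightarrow> ?R U")
proof
  assume "openin (frechet_topology A) U"
  then have "generate_topology_on
     {{y \<in> carrier A. seminorm A k (y \<ominus> x) < r} | k x r. x \<in> carrier A \<and> 0 < r} U"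
    unfolding frechet_topology_def by (rule openin_topology_generated_by)
  then show "?R U"
  proof (induction rule: generate_topology_on.induct)
    case (Int a b)
    have "\<exists>K r. 0 < r \<and> nball K x r \<subseteq> a \<inter> b" if x: "x \<in> a \<inter> b" for x
    proof -
      obtain K r L s where "0 < r" "nball K x r \<subseteq> a" "0 < s" "nball L x s \<subseteq> b"
        using Int x by (meson IntD1 IntD2)
      moreover have "nball (max K L) x (min r s) \<subseteq> nball K x r \<inter> nball L x s"
        by (intro Int_greatest nball_mono) auto
      ultimately show ?thesis
        by (intro exI[of _ "max K L"] exI[of _ "min r s"]) auto
    qed
    then show ?case
      using Int by auto
  next
    case (UN K)
    then show ?case
      by (meson Union_iff Union_least Union_upper order_trans)
  next
    case (Basis s)
    then obtain k x r where x: "x \<in> carrier A" "0 < r"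
      and s: "s = {y \<in> carrier A. seminorm A k (y \<ominus> x) < r}"
      by auto
    have "\<exists>K r. 0 < r \<and> nball K y r \<subseteq> s" if y: "y \<in> s" for y
    proof (intro exI conjI)
      show "0 < r - seminorm A k (y \<ominus> x)"
        using y s by auto
      show "nball k y (r - seminorm A k (y \<ominus> x)) \<subseteq> s"
      proof
        fix z assume z: "z \<in> nball k y (r - seminorm A k (y \<ominus> x))"
        then have "z \<in> carrier A" "seminorm A k (z \<ominus> y) < r - seminorm A k (y \<ominus> x)"
          by (auto simp: nball_def)
        then show "z \<in> s"
          using seminorm_diff_triangle[of z y x k] y x by (auto simp: s)
      qed
    qed
    then show ?case
      using s by auto
  qed auto
next
  assume R: "?R U"
  have "\<exists>T. openin (frechet_topology A) T \<and> x \<in> T \<and> T \<subseteq> U" if "x \<in> U" for x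
    using R that openin_nball centre_in_nball by (meson subsetD)
  then show "openin (frechet_topology A) U"
    using openin_subopen by metis
qed

text \<open>A basic neighbourhood constrains finitely many seminorms, so their eventual bounds
  combine and continuity becomes a family of scalar limits. The source is an arbitrary topology
  because intervals, products and subspaces all occur.\<close>

lemma continuous_map_frechet_iff:
  "continuous_map X (frechet_topology A) f \<longleftrightarrow>
     f \<in> topspace X \<rightarrow> carrier A \<and>
     (\<forall>x\<in>topspace X. \<forall>k. ((\<lambda>y. seminorm A k (f y \<ominus> f x)) \<longlongrightarrow> 0) (nhdsin X x))"
    (is "_ \<longleftrightarrow> ?F \<and> ?R")
proof
  assume f: "continuous_map X (frechet_topology A) f"
  then have F: ?F
    by (auto simp: continuous_map_def)
  have ?R
  proof (intro ballI allI tendstoI)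
    fix x k and e :: real assume x: "x \<in> topspace X" and e: "0 < e"
    let ?B = "{y \<in> carrier A. seminorm A k (y \<ominus> f x) < e}"
    have "openin X {y \<in> topspace X. f y \<in> ?B}"
      using F x e by (intro openin_continuous_map_preimage[OF f] openin_ball) auto
    moreover have "f x \<in> carrier A"
      using x F by auto
    ultimately show "\<forall>\<^sub>F y in nhdsin X x. dist (seminorm A k (f y \<ominus> f x)) 0 < e"
      using F x unfolding eventually_nhdsin
      by (intro disjI2 exI[of _ "{y \<in> topspace X. f y \<in> ?B}"]) (use e in \<open>auto simp: seminorm_nonneg Pi_iff\<close>)
  qed
  with F show "?F \<and> ?R" ..
next
  assume "?F \<and> ?R"
  then have F: ?F and R: ?R
    by blast+
  show "continuous_map X (frechet_topology A) f"
    unfolding continuous_map_def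
  proof (intro conjI allI impI)
    show "f \<in> topspace X \<rightarrow> topspace (frechet_topology A)"
      using F by simp
    fix U assume U: "openin (frechet_topology A) U"
    show "openin X {x \<in> topspace X. f x \<in> U}"
    proof (subst openin_subopen, clarify)
      fix x assume x: "x \<in> topspace X" "f x \<in> U"
      then obtain K r where r: "0 < r" "nball K (f x) r \<subseteq> U"
        using U by (auto simp: openin_frechet_iff)
      have "\<forall>k\<in>{..K}. \<forall>\<^sub>F y in nhdsin X x. seminorm A k (f y \<ominus> f x) < r"
        using R[rule_format, OF x(1)] r(1) by (intro ballI order_tendstoD(2))
      then have "\<forall>\<^sub>F y in nhdsin X x. \<forall>k\<in>{..K}. seminorm A k (f y \<ominus> f x) < r"
        by (intro eventually_ball_finite) auto
      then obtain S where S: "openin X S" "x \<in> S" "\<forall>y\<in>S. \<forall>k\<in>{..K}. seminorm A k (f y \<ominus> f x) < r"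
        using x by (auto simp: eventually_nhdsin)
      have "y \<in> topspace X \<and> f y \<in> U" if y: "y \<in> S" for y
      proof -
        have "y \<in> topspace X"
          using openin_subset[OF S(1)] y by blast
        moreover from this have "f y \<in> nball K (f x) r"
          using F S(3) y by (auto simp: nball_def)
        ultimately show ?thesis
          using r(2) by blast
      qed
      then show "\<exists>T. openin X T \<and> x \<in> T \<and> T \<subseteq> {x \<in> topspace X. f x \<in> U}"
        using S by blast
    qed
  qed
qed

lemma continuous_map_frechetD:
  assumes "continuous_map X (frechet_topology A) f" "x \<in> topspace X"
  shows "f x \<in> carrier A" "((\<lambda>y. seminorm A k (f y \<ominus> f x)) \<longlongrightarrow> 0) (nhdsin X x)"
  using assms by (auto simp: continuous_map_frechet_iff)

lemma eventually_nhdsin_topspace: "\<forall>\<^sub>F y in nhdsin X x. y \<in> topspace X"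
  by (cases "x \<in> topspace X") (auto simp: eventually_nhdsin intro!: exI[of _ "topspace X"])

text \<open>The working form of the criterion. A bound on \<open>topspace X\<close> is enough, since
  \<open>nhdsin X x\<close> is concentrated there.\<close>

lemma continuous_map_frechet_sandwich:
  assumes "\<And>x. x \<in> topspace X \<Longrightarrow> f x \<in> carrier A"
    and "\<And>x k. x \<in> topspace X \<Longrightarrow> (g x k \<longlongrightarrow> 0) (nhdsin X x)"
    and "\<And>x y k. \<lbrakk>x \<in> topspace X; y \<in> topspace X\<rbrakk> \<Longrightarrow> seminorm A k (f y \<ominus> f x) \<le> g x k y"
  shows "continuous_map X (frechet_topology A) f"
  unfolding continuous_map_frechet_iff
proof (intro conjI ballI allI)
  fix x k assume x: "x \<in> topspace X"
  show "((\<lambda>y. seminorm A k (f y \<ominus> f x)) \<longlongrightarrow> 0) (nhdsin X x)"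
  proof (rule tendsto_sandwich[OF _ _ tendsto_const assms(2)[OF x, of k]])
    show "\<forall>\<^sub>F y in nhdsin X x. 0 \<le> seminorm A k (f y \<ominus> f x)"
      using eventually_nhdsin_topspace by eventually_elim (simp add: seminorm_nonneg assms(1) x)
    show "\<forall>\<^sub>F y in nhdsin X x. seminorm A k (f y \<ominus> f x) \<le> g x k y"
      using eventually_nhdsin_topspace by eventually_elim (simp add: assms(3) x)
  qed
qed (use assms(1) in auto)

section \<open>Continuity of the algebra operations\<close>

lemma continuous_map_frechet_add:
  assumes f: "continuous_map X (frechet_topology A) f" and g: "continuous_map X (frechet_topology A) g"
  shows "continuous_map X (frechet_topology A) (\<lambda>x. f x \<oplus> g x)"
proof (rule continuous_map_frechet_sandwich[where g = "\<lambda>x k y. seminorm A k (f y \<ominus> f x) + seminorm A k (g y \<ominus> g x)"])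
  fix x y k assume x: "x \<in> topspace X" and y: "y \<in> topspace X"
  note C = continuous_map_frechetD(1)[OF f x] continuous_map_frechetD(1)[OF f y]
    continuous_map_frechetD(1)[OF g x] continuous_map_frechetD(1)[OF g y]
  have "(f y \<oplus> g y) \<ominus> (f x \<oplus> g x) = (f y \<ominus> f x) \<oplus> (g y \<ominus> g x)"
    using C by (simp add: a_minus_def M.minus_add M.a_ac)
  then show "seminorm A k ((f y \<oplus> g y) \<ominus> (f x \<oplus> g x))
      \<le> seminorm A k (f y \<ominus> f x) + seminorm A k (g y \<ominus> g x)"
    using C by (metis seminorm_add M.minus_closed)
next
  fix x k assume x: "x \<in> topspace X"
  show "((\<lambda>y. seminorm A k (f y \<ominus> f x) + seminorm A k (g y \<ominus> g x)) \<longlongrightarrow> 0) (nhdsin X x)"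
    by (rule tendsto_add_zero[OF continuous_map_frechetD(2)[OF f x] continuous_map_frechetD(2)[OF g x]])
qed (simp add: continuous_map_frechetD(1)[OF f] continuous_map_frechetD(1)[OF g])

lemma continuous_map_frechet_mult:
  assumes f: "continuous_map X (frechet_topology A) f" and g: "continuous_map X (frechet_topology A) g"
  shows "continuous_map X (frechet_topology A) (\<lambda>x. f x \<otimes> g x)"
proof (rule continuous_map_frechet_sandwich[where g = "\<lambda>x k y. seminorm A k (f x) * seminorm A k (g y \<ominus> g x) + seminorm A k (f y \<ominus> f x) * seminorm A k (g x)
      + seminorm A k (f y \<ominus> f x) * seminorm A k (g y \<ominus> g x)"])
  fix x y k assume x: "x \<in> topspace X" and y: "y \<in> topspace X"
  note C = continuous_map_frechetD(1)[OF f x] continuous_map_frechetD(1)[OF f y]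
    continuous_map_frechetD(1)[OF g x] continuous_map_frechetD(1)[OF g y]
  let ?d = "f y \<ominus> f x" and ?e = "g y \<ominus> g x"
  have "f y \<otimes> g y \<ominus> f x \<otimes> g x = (f x \<oplus> ?d) \<otimes> (g x \<oplus> ?e) \<ominus> f x \<otimes> g x"
    using C by (simp add: add_diff_cancel)
  also have "\<dots> = f x \<otimes> ?e \<oplus> ?d \<otimes> g x \<oplus> ?d \<otimes> ?e"
    using C by (intro mult_expand) auto
  finally have eq: "f y \<otimes> g y \<ominus> f x \<otimes> g x = f x \<otimes> ?e \<oplus> ?d \<otimes> g x \<oplus> ?d \<otimes> ?e" .
  have "seminorm A k (f y \<otimes> g y \<ominus> f x \<otimes> g x)
      \<le> seminorm A k (f x \<otimes> ?e \<oplus> ?d \<otimes> g x) + seminorm A k (?d \<otimes> ?e)"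
    unfolding eq using C by (intro seminorm_add) auto
  also have "\<dots> \<le> seminorm A k (f x \<otimes> ?e) + seminorm A k (?d \<otimes> g x) + seminorm A k (?d \<otimes> ?e)"
    using C by (intro add_right_mono seminorm_add) auto
  also have "\<dots> \<le> seminorm A k (f x) * seminorm A k ?e + seminorm A k ?d * seminorm A k (g x)
      + seminorm A k ?d * seminorm A k ?e"
    using C by (intro add_mono seminorm_mult) auto
  finally show "seminorm A k (f y \<otimes> g y \<ominus> f x \<otimes> g x) \<le> \<dots>" .
next
  fix x k assume x: "x \<in> topspace X"
  show "((\<lambda>y. seminorm A k (f x) * seminorm A k (g y \<ominus> g x) + seminorm A k (f y \<ominus> f x) * seminorm A k (g x)
      + seminorm A k (f y \<ominus> f x) * seminorm A k (g y \<ominus> g x)) \<longlongrightarrow> 0) (nhdsin X x)"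
    by (intro tendsto_add_zero tendsto_mult_right_zero tendsto_mult_left_zero tendsto_mult_zero
        continuous_map_frechetD(2)[OF f x] continuous_map_frechetD(2)[OF g x])
qed (simp add: continuous_map_frechetD(1)[OF f] continuous_map_frechetD(1)[OF g])

lemma continuous_map_frechet_const:
  "c \<in> carrier A \<Longrightarrow> continuous_map X (frechet_topology A) (\<lambda>x. c)"
  by simp

lemma continuous_map_frechet_scal_one:
  assumes c: "continuous_map X euclidean c"
  shows "continuous_map X (frechet_topology A) (\<lambda>x. c x \<odot> \<one>)"
proof (rule continuous_map_frechet_sandwich[where g = "\<lambda>x k y. dist (c y) (c x) * seminorm A k \<one>"])
  fix x y k
  have "c y \<odot> \<one> \<ominus> c x \<odot> \<one> = (c y - c x) \<odot> \<one>"
    using scal_add_left[of \<one> "c y" "- c x"] by (simp add: a_minus_def scal_neg)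
  then show "seminorm A k (c y \<odot> \<one> \<ominus> c x \<odot> \<one>) \<le> dist (c y) (c x) * seminorm A k \<one>"
    by (simp add: seminorm_smult dist_norm)
next
  fix x k assume x: "x \<in> topspace X"
  have "((\<lambda>y. dist (c y) (c x)) \<longlongrightarrow> 0) (nhdsin X x)"
  proof (rule tendstoI)
    fix e :: real assume "0 < e"
    then have "openin X {y \<in> topspace X. c y \<in> ball (c x) e}"
      by (intro openin_continuous_map_preimage[OF c]) auto
    then show "\<forall>\<^sub>F y in nhdsin X x. dist (dist (c y) (c x)) 0 < e"
      unfolding eventually_nhdsin using x \<open>0 < e\<close>
      by (intro disjI2 exI[of _ "{y \<in> topspace X. c y \<in> ball (c x) e}"]) (auto simp: dist_commute)
  qed
  then show "((\<lambda>y. dist (c y) (c x) * seminorm A k \<one>) \<longlongrightarrow> 0) (nhdsin X x)"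
    by (rule tendsto_mult_left_zero)
qed auto

text \<open>Joint continuity in scalar and vector is inherited from multiplication, because
  \<open>c \<odot> x = (c \<odot> \<one>) \<otimes> x\<close>.\<close>

lemma continuous_map_frechet_scal:
  assumes c: "continuous_map X euclidean c" and f: "continuous_map X (frechet_topology A) f"
  shows "continuous_map X (frechet_topology A) (\<lambda>x. c x \<odot> f x)"
proof (rule continuous_map_eq[OF continuous_map_frechet_mult[OF continuous_map_frechet_scal_one[OF c] f]])
  fix x assume "x \<in> topspace X"
  then show "c x \<odot> \<one> \<otimes> f x = c x \<odot> f x"
    using continuous_map_frechetD(1)[OF f] by (simp add: smult_mult_left)
qed

lemma continuous_map_frechet_diff:
  assumes f: "continuous_map X (frechet_topology A) f" and g: "continuous_map X (frechet_topology A) g"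
  shows "continuous_map X (frechet_topology A) (\<lambda>x. f x \<ominus> g x)"
proof -
  have "continuous_map X (frechet_topology A) (\<lambda>x. f x \<oplus> (- 1) \<odot> g x)"
    using g by (intro continuous_map_frechet_add continuous_map_frechet_scal f) auto
  then show ?thesis
    by (rule continuous_map_eq)
      (simp add: continuous_map_frechetD(1)[OF f] continuous_map_frechetD(1)[OF g] diff_eq_scal)
qed

end

section \<open>Spectral parts and paths\<close>

abbreviation spectral_path :: "complex set \<Rightarrow> 'a frechet_alg \<Rightarrow> 'a \<Rightarrow> 'a \<Rightarrow> bool"
  where "spectral_path \<Omega> A \<equiv>
    path_component_of (subtopology (frechet_topology A) (spectral_part \<Omega> A))"

definition segment :: "'a frechet_alg \<Rightarrow> 'a \<Rightarrow> 'a \<Rightarrow> real \<Rightarrow> 'a"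
  where "segment A x y t = of_real (1 - t) \<odot>\<^bsub>A\<^esub> x \<oplus>\<^bsub>A\<^esub> of_real t \<odot>\<^bsub>A\<^esub> y"

context seminormed_algebra
begin

lemma spectral_part_iff:
  "a \<in> spectral_part \<Omega> A \<longleftrightarrow> a \<in> carrier A \<and> (\<forall>c. c \<notin> \<Omega> \<longrightarrow> c \<odot> \<one> \<ominus> a \<in> Units A)"
  by (auto simp: spectral_part_def spectrum_def)

lemma spectral_part_subset: "spectral_part \<Omega> A \<subseteq> carrier A"
  by (auto simp: spectral_part_def)

lemma spectral_path_carrier:
  assumes "spectral_path \<Omega> A x y"
  shows "x \<in> spectral_part \<Omega> A" "y \<in> spectral_part \<Omega> A"
  using path_component_in_topspace[OF assms] by auto

lemma spectral_path_refl: "x \<in> spectral_part \<Omega> A \<Longrightarrow> spectral_path \<Omega> A x x"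
  using spectral_part_subset by (auto simp: path_component_of_refl)

lemma Units_scal:
  assumes "c \<noteq> 0" "u \<in> Units A"
  shows "c \<odot> u \<in> Units A"
proof -
  have "(inverse c \<odot> inv u) \<otimes> (c \<odot> u) = \<one>" "(c \<odot> u) \<otimes> (inverse c \<odot> inv u) = \<one>"
    using assms Units_closed[OF assms(2)] Units_inv_closed[OF assms(2)]
    by (simp_all add: smult_mult_left smult_mult_right scal_scal)
  moreover have "c \<odot> u \<in> carrier A" "inverse c \<odot> inv u \<in> carrier A"
    using Units_closed[OF assms(2)] Units_inv_closed[OF assms(2)] by auto
  ultimately show ?thesis
    unfolding Units_def by blast
qed

lemma scal_diff:
  "\<lbrakk>x \<in> carrier A; y \<in> carrier A\<rbrakk> \<Longrightarrow> c \<odot> (x \<ominus> y) = c \<odot> x \<ominus> c \<odot> y"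
  by (simp add: diff_eq_scal scal_add_right scal_scal)

text \<open>A compactness argument on the Riemann sphere: near infinity \<open>c \<odot> \<one> \<ominus> a\<close> is replaced by
  \<open>\<one> \<ominus> c\<inverse> \<odot> a\<close>, and on the remaining compact set the tube lemma applies.\<close>

lemma openin_spectral_part:
  assumes "open \<Omega>" and Units: "openin (frechet_topology A) (Units A)"
  shows "openin (frechet_topology A) (spectral_part \<Omega> A)"
proof (subst openin_subopen, intro ballI)
  fix a0 assume a0: "a0 \<in> spectral_part \<Omega> A"
  let ?T = "prod_topology (euclidean :: complex topology) (frechet_topology A)"
  have fst: "continuous_map ?T euclidean fst" and snd: "continuous_map ?T (frechet_topology A) snd"
    by (simp_all add: continuous_map_fst continuous_map_snd)
  define W1 where "W1 = {p \<in> topspace ?T. fst p \<odot> \<one> \<ominus> snd p \<in> Units A}"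
  define W2 where "W2 = {p \<in> topspace ?T. \<one> \<ominus> fst p \<odot> snd p \<in> Units A}"
  have W1: "openin ?T W1" unfolding W1_def
    by (rule openin_continuous_map_preimage[OF _ Units])
      (intro continuous_map_frechet_diff continuous_map_frechet_scal_one fst snd)
  have W2: "openin ?T W2" unfolding W2_def
    by (rule openin_continuous_map_preimage[OF _ Units])
      (intro continuous_map_frechet_diff continuous_map_frechet_scal fst snd
        continuous_map_frechet_const one_closed)
  have a0': "a0 \<in> carrier A"
    using a0 by (simp add: spectral_part_iff)
  \<comment> \<open>The parameter 0 stands for the point at infinity, where
    \<open>\<one> \<ominus> 0 \<odot> a0\<close> is the unit itself.\<close>
  then have "(0, a0) \<in> W2"
    by (simp add: W2_def a_minus_def)
  then obtain U0 V0 where U0: "open U0" "0 \<in> U0" and V0: "openin (frechet_topology A) V0" "a0 \<in> V0"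
    and UV0: "U0 \<times> V0 \<subseteq> W2"
    using W2 unfolding openin_prod_topology_alt by (metis open_openin)
  obtain \<delta> where \<delta>: "0 < \<delta>" "ball 0 \<delta> \<subseteq> U0"
    using U0 open_contains_ball by blast
  \<comment> \<open>For \<open>c\<close> outside this ball \<open>inverse c\<close> lies in
    \<open>ball 0 \<delta>\<close>, where \<open>V0\<close> serves all parameters at once; the
    factor 2 is slack.\<close>
  define K where "K = - \<Omega> \<inter> cball 0 (2 / \<delta>)"
  have "compact K"
    unfolding K_def by (intro closed_Int_compact closed_Compl assms compact_cball)
  moreover have "K \<times> {a0} \<subseteq> W1"
    using a0 a0' by (auto simp: K_def W1_def spectral_part_iff)
  ultimately obtain U1 V1 where V1: "openin (frechet_topology A) V1" "a0 \<in> V1"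
    and UV1: "K \<subseteq> U1" "U1 \<times> V1 \<subseteq> W1"
    using tube_lemma_left[OF W1, of K a0] a0' by auto
  have "V0 \<inter> V1 \<subseteq> spectral_part \<Omega> A"
  proof
    fix a assume a: "a \<in> V0 \<inter> V1"
    then have ac: "a \<in> carrier A"
      using openin_subset[OF V0(1)] by auto
    have "c \<odot> \<one> \<ominus> a \<in> Units A" if c: "c \<notin> \<Omega>" for c
    proof (cases "c \<in> K")
      case True
      then have "(c, a) \<in> W1"
        using UV1 a by blast
      then show ?thesis
        by (simp add: W1_def)
    next
      case False
      with c have nc: "2 / \<delta> < norm c"
        by (auto simp: K_def)
      moreover have "0 < 2 / \<delta>"
        using \<delta> by simp
      ultimately have c0: "0 < norm c"
        by linarith
      have "2 < norm c * \<delta>"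
        using nc \<delta> by (simp add: field_simps)
      then have "norm (inverse c) < \<delta>"
        using c0 by (simp add: norm_divide field_simps)
      then have "(inverse c, a) \<in> W2"
        using UV0 \<delta> a by (auto simp: subset_iff)
      then have "c \<odot> (\<one> \<ominus> inverse c \<odot> a) \<in> Units A"
        using c0 by (intro Units_scal) (auto simp: W2_def)
      then show ?thesis
        using c0 ac by (simp add: scal_diff scal_scal)
    qed
    with ac show "a \<in> spectral_part \<Omega> A"
      by (simp add: spectral_part_iff)
  qed
  then show "\<exists>T. openin (frechet_topology A) T \<and> a0 \<in> T \<and> T \<subseteq> spectral_part \<Omega> A"
    using V0 V1 by (intro exI[of _ "V0 \<inter> V1"]) auto
qed

section \<open>Segments and local convexity\<close>

lemma segment_closed [simp]:
  "\<lbrakk>x \<in> carrier A; y \<in> carrier A\<rbrakk> \<Longrightarrow> segment A x y t \<in> carrier A"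
  by (simp add: segment_def)

lemma path_component_of_segment:
  assumes "x \<in> carrier A" "y \<in> carrier A" "\<And>t. \<lbrakk>0 \<le> t; t \<le> 1\<rbrakk> \<Longrightarrow> segment A x y t \<in> S"
  shows "path_component_of (subtopology (frechet_topology A) S) x y"
  unfolding path_component_of_set pathin_def
proof (intro exI[of _ "segment A x y"] conjI)
  have "continuous_map (top_of_set {0..1}) euclidean (\<lambda>t. complex_of_real (1 - t))"
    "continuous_map (top_of_set {0..1}) euclidean complex_of_real"
    by (auto intro!: continuous_intros)
  then have "continuous_map (top_of_set {0..1}) (frechet_topology A) (segment A x y)"
    unfolding segment_def
    by (intro continuous_map_frechet_add continuous_map_frechet_scal continuous_map_frechet_const assms)
  then show "continuous_map (top_of_set {0..1}) (subtopology (frechet_topology A) S) (segment A x y)"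
    using assms(3) by (auto simp: continuous_map_in_subtopology)
qed (use assms in \<open>auto simp: segment_def\<close>)

lemma scal_convex:
  assumes "x \<in> carrier A"
  shows "of_real (1 - t) \<odot> x \<oplus> of_real t \<odot> x = x"
  using assms scal_add_left[of x "of_real (1 - t)" "of_real t"] by simp

text \<open>The weights sum to 1, so \<open>x\<close> is a convex combination of itself and
  subtracting it moves into the endpoints. This recentres the convexity estimate at the centre of a
  ball.\<close>

lemma segment_diff:
  assumes "u \<in> carrier A" "v \<in> carrier A" "x \<in> carrier A"
  shows "segment A u v t \<ominus> x = segment A (u \<ominus> x) (v \<ominus> x) t"
proof -
  have "segment A (u \<ominus> x) (v \<ominus> x) t
      = segment A u v t \<ominus> (of_real (1 - t) \<odot> x \<oplus> of_real t \<odot> x)"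
    using assms by (simp add: segment_def scal_diff) (simp add: a_minus_def M.minus_add M.a_ac)
  then show ?thesis
    using assms by (simp add: scal_convex del: of_real_diff)
qed

text \<open>Each seminorm of a convex combination is at most the convex combination of two numbers
  below \<open>r\<close>.\<close>

lemma nball_convex:
  assumes "x \<in> carrier A" "u \<in> nball K x r" "v \<in> nball K x r" and t: "0 \<le> t" "t \<le> 1"
  shows "segment A u v t \<in> nball K x r"
proof -
  have u: "u \<in> carrier A" and v: "v \<in> carrier A"
    using assms by (auto simp: nball_def)
  have "seminorm A k (segment A u v t \<ominus> x) < r" if k: "k \<le> K" for k
  proof -
    have "seminorm A k (segment A u v t \<ominus> x)
        \<le> seminorm A k (of_real (1 - t) \<odot> (u \<ominus> x)) + seminorm A k (of_real t \<odot> (v \<ominus> x))"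
      using u v assms(1) unfolding segment_diff[OF u v assms(1)] segment_def[of A "u \<ominus> x"]
      by (intro seminorm_add) auto
    also have "\<dots> = (1 - t) * seminorm A k (u \<ominus> x) + t * seminorm A k (v \<ominus> x)"
      using u v assms(1) t by (simp add: seminorm_smult del: of_real_diff)
    also have "\<dots> < r"
      using assms k by (intro convex_bound_lt) (auto simp: nball_def)
    finally show ?thesis .
  qed
  then show ?thesis
    using u v by (simp add: nball_def)
qed

lemma spectral_path_nball:
  assumes "x \<in> carrier A" "u \<in> nball K x r" "v \<in> nball K x r" "nball K x r \<subseteq> spectral_part \<Omega> A"
  shows "spectral_path \<Omega> A u v"
proof (rule path_component_of_segment)
  show "segment A u v t \<in> spectral_part \<Omega> A" if "0 \<le> t" "t \<le> 1" for t
    using nball_convex[OF assms(1-3) that] assms(4) by blast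
qed (use assms in \<open>auto simp: nball_def\<close>)

section \<open>Conjugation inside the spectral part\<close>

text \<open>Scalars commute with \<open>u\<close>, so
  \<open>c \<odot> \<one> \<ominus> u \<otimes> a \<otimes> v\<close> factors as
  \<open>u \<otimes> (c \<odot> \<one> \<ominus> a) \<otimes> v\<close>, a product of units. The
  inverse \<open>v\<close> is a separate variable because the path of conjugates constructed below
  presents it explicitly.\<close>

lemma spectral_part_conj:
  assumes a: "a \<in> spectral_part \<Omega> A" and u: "u \<in> carrier A" "v \<in> carrier A"
    and uv: "u \<otimes> v = \<one>" "v \<otimes> u = \<one>"
  shows "u \<otimes> a \<otimes> v \<in> spectral_part \<Omega> A"
proof -
  have U: "u \<in> Units A" "v \<in> Units A"
    using u uv by (auto simp: Units_def)
  have ac: "a \<in> carrier A"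
    using a by (simp add: spectral_part_iff)
  have "c \<odot> \<one> \<ominus> u \<otimes> a \<otimes> v = u \<otimes> (c \<odot> \<one> \<ominus> a) \<otimes> v" for c
    using u uv ac
    by (simp add: diff_eq_scal l_distr r_distr smult_mult_left smult_mult_right)
  moreover have "u \<otimes> (c \<odot> \<one> \<ominus> a) \<otimes> v \<in> Units A" if "c \<notin> \<Omega>" for c
    using a that U by (intro Units_m_closed) (auto simp: spectral_part_iff)
  ultimately show ?thesis
    using u ac by (simp add: spectral_part_iff)
qed

text \<open>An involution \<open>P\<close> is joined to \<open>\<one>\<close> by the units \<open>(1 + z)/2 \<odot> \<one> \<oplus> (1 - z)/2 \<odot> P\<close> for \<open>z\<close> on
  the unit circle, the unit for \<open>z\<close> being inverse to the one for \<open>1/z\<close>.\<close>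

lemma spectral_path_involution:
  assumes a: "a \<in> spectral_part \<Omega> A" and P: "P \<in> carrier A" "P \<otimes> P = \<one>"
  shows "spectral_path \<Omega> A a (P \<otimes> a \<otimes> P)"
proof -
  \<comment> \<open>\<open>U z\<close> acts as 1 where \<open>P\<close> acts as 1, and as
    \<open>z\<close> where \<open>P\<close> acts as -1. Hence \<open>U 1 = \<one>\<close> and
    \<open>U (- 1) = P\<close>, and half of the unit circle leads from one to the other.\<close>
  define U where "U z = ((1 + z) / 2) \<odot> \<one> \<oplus> ((1 - z) / 2) \<odot> P" for z
  have U: "U z \<in> carrier A" for z
    using P by (simp add: U_def)
  have ac: "a \<in> carrier A"
    using a by (simp add: spectral_part_iff)
  have inv: "U z \<otimes> U w = \<one>" if zw: "z * w = 1" for z w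
  proof -
    define p q p' q' where "p = (1 + z) / 2" "q = (1 - z) / 2" "p' = (1 + w) / 2" "q' = (1 - w) / 2"
    have "U z \<otimes> U w = (p' * p) \<odot> \<one> \<oplus> (p' * q) \<odot> P \<oplus> ((q' * p) \<odot> P \<oplus> (q' * q) \<odot> \<one>)"
      using P unfolding U_def p_q_p'_q'_def[symmetric]
      by (simp add: l_distr r_distr smult_mult_left smult_mult_right scal_add_right scal_scal
          mult.commute mult.left_commute)
    also have "\<dots> = ((p' * p) \<odot> \<one> \<oplus> (q' * q) \<odot> \<one>) \<oplus> ((p' * q) \<odot> P \<oplus> (q' * p) \<odot> P)"
      using P by (simp add: M.a_ac)
    also have "\<dots> = (p' * p + q' * q) \<odot> \<one> \<oplus> (p' * q + q' * p) \<odot> P"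
      using P by (simp add: scal_add_left)
    also have "p' * p + q' * q = (1 + z * w) / 2"
      by (simp add: p_q_p'_q'_def field_simps)
    also have "p' * q + q' * p = (1 - z * w) / 2"
      by (simp add: p_q_p'_q'_def field_simps)
    finally show ?thesis
      using P zw by simp
  qed
  \<comment> \<open>\<open>cis (- s)\<close> is inverse to \<open>cis s\<close>, so each
    \<open>g t\<close> is a conjugate of \<open>a\<close>. At \<open>t = 1\<close> both outer
    factors equal \<open>P\<close>, as \<open>cis pi\<close> and \<open>cis (- pi)\<close> are both
    -1.\<close>
  define g where "g t = U (cis (pi * t)) \<otimes> a \<otimes> U (cis (- (pi * t)))" for t
  have "continuous_map (top_of_set {0..1}) euclidean (\<lambda>t. (1 + cis (s * t)) / 2)"
    "continuous_map (top_of_set {0..1}) euclidean (\<lambda>t. (1 - cis (s * t)) / 2)" for s :: real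
    by (auto intro!: continuous_intros simp: cis_conv_exp)
  then have "continuous_map (top_of_set {0..1}) (frechet_topology A) (\<lambda>t. U (cis (s * t)))" for s :: real
    unfolding U_def
    by (intro continuous_map_frechet_add continuous_map_frechet_scal continuous_map_frechet_const
        one_closed P)
  from this[of pi] this[of "- pi"]
  have "continuous_map (top_of_set {0..1}) (frechet_topology A) g"
    unfolding g_def using ac
    by (intro continuous_map_frechet_mult continuous_map_frechet_const) auto
  moreover have "g t \<in> spectral_part \<Omega> A" for t
    unfolding g_def by (intro spectral_part_conj a U inv) (simp_all add: cis_mult)
  ultimately have "pathin (subtopology (frechet_topology A) (spectral_part \<Omega> A)) g"
    by (auto simp: pathin_def continuous_map_in_subtopology)
  moreover have "g 0 = a" "g 1 = P \<otimes> a \<otimes> P"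
    using ac P by (simp_all add: g_def U_def flip: cis_inverse)
  ultimately show ?thesis
    unfolding path_component_of_set by blast
qed

end

section \<open>Spectral parts under morphisms\<close>

lemma frechet_morphismD:
  assumes "frechet_morphism A B \<phi>"
  shows "x \<in> carrier A \<Longrightarrow> \<phi> x \<in> carrier B"
    and "\<lbrakk>x \<in> carrier A; y \<in> carrier A\<rbrakk> \<Longrightarrow> \<phi> (x \<otimes>\<^bsub>A\<^esub> y) = \<phi> x \<otimes>\<^bsub>B\<^esub> \<phi> y"
    and "\<lbrakk>x \<in> carrier A; y \<in> carrier A\<rbrakk> \<Longrightarrow> \<phi> (x \<oplus>\<^bsub>A\<^esub> y) = \<phi> x \<oplus>\<^bsub>B\<^esub> \<phi> y"
    and "\<phi> \<one>\<^bsub>A\<^esub> = \<one>\<^bsub>B\<^esub>"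
    and "x \<in> carrier A \<Longrightarrow> \<phi> (c \<odot>\<^bsub>A\<^esub> x) = c \<odot>\<^bsub>B\<^esub> \<phi> x"
    and "continuous_map (frechet_topology A) (frechet_topology B) \<phi>"
  using assms unfolding frechet_morphism_def
  by (auto dest: ring_hom_closed ring_hom_mult ring_hom_add ring_hom_one)

locale seminormed_morphism = A: seminormed_algebra A + B: seminormed_algebra B
  for A :: "'a frechet_alg" and B :: "'b frechet_alg" and \<phi> +
  assumes morphism: "frechet_morphism A B \<phi>"
begin

lemmas hom = frechet_morphismD[OF morphism]

lemma hom_zero: "\<phi> \<zero>\<^bsub>A\<^esub> = \<zero>\<^bsub>B\<^esub>"
  using hom(5)[of "\<zero>\<^bsub>A\<^esub>" 0] hom(1)[of "\<zero>\<^bsub>A\<^esub>"] by simp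

lemma hom_segment:
  "\<lbrakk>x \<in> carrier A; y \<in> carrier A\<rbrakk> \<Longrightarrow> \<phi> (segment A x y t) = segment B (\<phi> x) (\<phi> y) t"
  by (simp add: segment_def hom)

lemma hom_Units:
  assumes "u \<in> Units A"
  shows "\<phi> u \<in> Units B"
proof -
  obtain v where "u \<in> carrier A" "v \<in> carrier A" "v \<otimes>\<^bsub>A\<^esub> u = \<one>\<^bsub>A\<^esub>" "u \<otimes>\<^bsub>A\<^esub> v = \<one>\<^bsub>A\<^esub>"
    using assms by (auto simp: Units_def)
  then have "\<phi> u \<in> carrier B" "\<phi> v \<in> carrier B" "\<phi> v \<otimes>\<^bsub>B\<^esub> \<phi> u = \<one>\<^bsub>B\<^esub>" "\<phi> u \<otimes>\<^bsub>B\<^esub> \<phi> v = \<one>\<^bsub>B\<^esub>"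
    using hom(1,2,4) by metis+
  then show ?thesis
    unfolding Units_def by blast
qed

text \<open>A unital homomorphism sends units to units, so the spectrum can only shrink.\<close>

lemma hom_spectral_part:
  assumes "x \<in> spectral_part \<Omega> A"
  shows "\<phi> x \<in> spectral_part \<Omega> B"
proof -
  have x: "x \<in> carrier A"
    using assms by (simp add: A.spectral_part_iff)
  have "c \<odot>\<^bsub>B\<^esub> \<one>\<^bsub>B\<^esub> \<ominus>\<^bsub>B\<^esub> \<phi> x = \<phi> (c \<odot>\<^bsub>A\<^esub> \<one>\<^bsub>A\<^esub> \<ominus>\<^bsub>A\<^esub> x)" for c
    using x by (simp add: A.diff_eq_scal B.diff_eq_scal hom)
  then show ?thesis
    using assms hom_Units hom(1) by (simp add: A.spectral_part_iff B.spectral_part_iff)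
qed

lemma hom_spectral_path:
  assumes "spectral_path \<Omega> A x y"
  shows "spectral_path \<Omega> B (\<phi> x) (\<phi> y)"
proof -
  obtain g where g: "pathin (subtopology (frechet_topology A) (spectral_part \<Omega> A)) g" "g 0 = x" "g 1 = y"
    using assms unfolding path_component_of_set by blast
  have "continuous_map (subtopology (frechet_topology A) (spectral_part \<Omega> A))
      (subtopology (frechet_topology B) (spectral_part \<Omega> B)) \<phi>"
    using hom(6) hom_spectral_part
    by (auto simp: continuous_map_in_subtopology continuous_map_from_subtopology)
  then have "pathin (subtopology (frechet_topology B) (spectral_part \<Omega> B)) (\<phi> \<circ> g)"
    using g(1) by (rule pathin_compose[rotated])
  then show ?thesis
    using g unfolding path_component_of_set by force
qed

end

section \<open>Path components under dense relatively spectral morphisms\<close>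

text \<open>The locale is made for the amplifications \<open>map_mat \<phi>\<close>. Openness of the
  spectral parts is an axiom here, to be discharged at each matrix size from openness of the units
  of that matrix algebra.\<close>

locale dense_spectral_morphism = seminormed_morphism +
  fixes \<Omega> :: "complex set"
  assumes open_spectral_A: "openin (frechet_topology A) (spectral_part \<Omega> A)"
    and open_spectral_B: "openin (frechet_topology B) (spectral_part \<Omega> B)"
    and dense: "dense_morphism A B \<phi>"
    and spectral: "relatively_spectral A B \<phi>"
begin

text \<open>One witness is fixed by choice, so that all facts below speak of the same
  subalgebra.\<close>

definition core :: "'a set"
  where "core = (SOME X. unital_subalgebra X A \<and> dense_in A X \<and> (\<forall>x\<in>X. spectrum B (\<phi> x) = spectrum A x))"

lemma core:
  "unital_subalgebra core A" "dense_in A core"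
  "x \<in> core \<Longrightarrow> spectrum B (\<phi> x) = spectrum A x"
  using someI_ex[OF spectral[unfolded relatively_spectral_def]] unfolding core_def by blast+

lemma core_subset: "x \<in> core \<Longrightarrow> x \<in> carrier A"
  using core(1) subringE(1) unfolding unital_subalgebra_def by blast

lemma core_segment: "\<lbrakk>x \<in> core; y \<in> core\<rbrakk> \<Longrightarrow> segment A x y t \<in> core"
  using core(1) unfolding unital_subalgebra_def segment_def
  by (intro subringE(7)[of core A] submodule.smult_closed[of core complex_field A])
    (auto simp: complex_field_def)

text \<open>The converse of \<open>hom_spectral_part\<close>, valid on the core: this is where
  equality of spectra enters.\<close>

lemma core_spectral_part: "\<lbrakk>x \<in> core; \<phi> x \<in> spectral_part \<Omega> B\<rbrakk> \<Longrightarrow> x \<in> spectral_part \<Omega> A"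
  using core(3) core_subset by (simp add: spectral_part_def)

lemma core_meets_open:
  assumes "openin (frechet_topology A) U" "U \<noteq> {}"
  obtains x where "x \<in> core" "x \<in> U"
proof -
  have "core \<inter> U \<noteq> {}"
    using core(2) assms dense_intersects_open[of "frechet_topology A" core]
    by (simp add: dense_in_def)
  then show thesis
    using that by blast
qed

text \<open>Density of the image makes the preimage of \<open>U\<close> nonempty, continuity makes
  it open, and then density of the core in \<open>A\<close> applies.\<close>

lemma image_core_meets_open:
  assumes U: "openin (frechet_topology B) U" "U \<noteq> {}"
  obtains x where "x \<in> core" "\<phi> x \<in> U"
proof -
  have "\<phi> ` carrier A \<inter> U \<noteq> {}"
    using dense U dense_intersects_open[of "frechet_topology B" "\<phi> ` carrier A"]
    by (simp add: dense_morphism_def dense_in_def)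
  then have "{x \<in> carrier A. \<phi> x \<in> U} \<noteq> {}"
    by blast
  moreover have "openin (frechet_topology A) {x \<in> carrier A. \<phi> x \<in> U}"
    using openin_continuous_map_preimage[OF hom(6) U(1)] by simp
  ultimately show thesis
    using core_meets_open that by blast
qed

text \<open>The segment from \<open>x\<close> to \<open>y\<close> stays in the core and is mapped
  into a convex ball of \<open>B\<close>; each of its points is then pulled back by
  \<open>core_spectral_part\<close>. No closeness of \<open>x\<close> and \<open>y\<close> in
  \<open>A\<close> is required.\<close>

lemma core_spectral_path:
  assumes "x \<in> core" "y \<in> core" "b \<in> carrier B"
    and "\<phi> x \<in> B.nball K b r" "\<phi> y \<in> B.nball K b r" "B.nball K b r \<subseteq> spectral_part \<Omega> B"
  shows "spectral_path \<Omega> A x y"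
proof (rule A.path_component_of_segment)
  fix t :: real assume t: "0 \<le> t" "t \<le> 1"
  have "\<phi> (segment A x y t) \<in> spectral_part \<Omega> B"
    using B.nball_convex[OF assms(3-5) t] assms hom_segment core_subset by auto
  then show "segment A x y t \<in> spectral_part \<Omega> A"
    using assms by (intro core_spectral_part core_segment)
qed (use assms core_subset in auto)

text \<open>Within a convex ball around \<open>b\<close> in the spectral part, \<open>b\<close> is
  joined by a segment to the image of a point of the core.\<close>

lemma spectral_path_surj:
  assumes b: "b \<in> spectral_part \<Omega> B"
  obtains x where "x \<in> spectral_part \<Omega> A" "spectral_path \<Omega> B (\<phi> x) b"
proof -
  have bc: "b \<in> carrier B"
    using b by (simp add: B.spectral_part_iff)
  obtain K r where r: "0 < r" "B.nball K b r \<subseteq> spectral_part \<Omega> B"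
    using open_spectral_B b by (auto simp: B.openin_frechet_iff)
  have b': "b \<in> B.nball K b r"
    using bc r by (simp add: B.centre_in_nball)
  obtain x where x: "x \<in> core" "\<phi> x \<in> B.nball K b r"
    using image_core_meets_open[OF B.openin_nball[OF bc r(1)]] b' by blast
  show thesis
    using that[of x] core_spectral_part x r B.spectral_path_nball[OF bc x(2) b' r(2)] by blast
qed

text \<open>The analogous small move inside \<open>A\<close>, used to shift the endpoints of a path
  problem into the core.\<close>

lemma spectral_path_core:
  assumes a: "a \<in> spectral_part \<Omega> A"
  obtains x where "x \<in> core" "spectral_path \<Omega> A a x"
proof -
  have ac: "a \<in> carrier A"
    using a by (simp add: A.spectral_part_iff)
  obtain K r where r: "0 < r" "A.nball K a r \<subseteq> spectral_part \<Omega> A"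
    using open_spectral_A a by (auto simp: A.openin_frechet_iff)
  have a': "a \<in> A.nball K a r"
    using ac r by (simp add: A.centre_in_nball)
  obtain x where x: "x \<in> core" "x \<in> A.nball K a r"
    using core_meets_open[OF A.openin_nball[OF ac r(1)]] a' by blast
  show thesis
    using that[of x] x A.spectral_path_nball[OF ac a' x(2) r(2)] by blast
qed

text \<open>The points of \<open>B\<^sub>\<Omega>\<close> lying in a ball within \<open>B\<^sub>\<Omega>\<close> that contains the image of a point of
  the core reachable from \<open>x\<close> form an open and closed subset of \<open>B\<^sub>\<Omega>\<close>.\<close>

lemma core_spectral_path_inj:
  assumes x: "x \<in> core" "x \<in> spectral_part \<Omega> A" and y: "y \<in> core"
    and xy: "spectral_path \<Omega> B (\<phi> x) (\<phi> y)"
  shows "spectral_path \<Omega> A x y"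
proof -
  define good where "good V \<longleftrightarrow>
    (\<exists>K c r. c \<in> carrier B \<and> 0 < r \<and> V = B.nball K c r) \<and> V \<subseteq> spectral_part \<Omega> B" for V
  define reached where "reached V \<longleftrightarrow> (\<exists>d\<in>core. \<phi> d \<in> V \<and> spectral_path \<Omega> A x d)" for V
  define P where "P = {u. \<exists>V. good V \<and> reached V \<and> u \<in> V}"
  have good_open: "openin (frechet_topology B) V" if "good V" for V
    using that by (auto simp: good_def B.openin_nball)
  have good_ex: "\<exists>V. good V \<and> u \<in> V" if u: "u \<in> spectral_part \<Omega> B" for u
  proof -
    obtain K r where r: "0 < r" "B.nball K u r \<subseteq> spectral_part \<Omega> B"
      using open_spectral_B u by (auto simp: B.openin_frechet_iff)
    moreover have "u \<in> carrier B"
      using u by (simp add: B.spectral_part_iff)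
    ultimately show ?thesis
      unfolding good_def using B.centre_in_nball by blast
  qed
  have good_path: "spectral_path \<Omega> A d e"
    if "good V" "d \<in> core" "e \<in> core" "\<phi> d \<in> V" "\<phi> e \<in> V" for V d e
    using that core_spectral_path unfolding good_def by blast
  have P_open: "openin (frechet_topology B) P"
    by (subst openin_subopen) (use good_open in \<open>force simp: P_def\<close>)
  have Q_open: "openin (frechet_topology B) (spectral_part \<Omega> B - P)"
  proof (subst openin_subopen, intro ballI)
    fix u assume u: "u \<in> spectral_part \<Omega> B - P"
    then obtain V where V: "good V" "u \<in> V"
      using good_ex by blast
    have "V \<inter> P = {}"
    proof (rule ccontr)
      assume "V \<inter> P \<noteq> {}"
      then obtain v V' d where v: "v \<in> V" "v \<in> V'" and V': "good V'"
        and d: "d \<in> core" "\<phi> d \<in> V'" "spectral_path \<Omega> A x d"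
        by (auto simp: P_def reached_def)
      \<comment> \<open>Two overlapping balls share the image of a point of the core, through which
        reachability is handed from \<open>V'\<close> to \<open>V\<close>.\<close>
      obtain e where e: "e \<in> core" "\<phi> e \<in> V \<inter> V'"
        using image_core_meets_open[of "V \<inter> V'"] good_open V V' v by blast
      have "spectral_path \<Omega> A x e"
        using path_component_of_trans[OF d(3) good_path[OF V']] d e by blast
      then have "reached V"
        using e by (auto simp: reached_def)
      then show False
        using u V by (auto simp: P_def)
    qed
    then show "\<exists>T. openin (frechet_topology B) T \<and> u \<in> T \<and> T \<subseteq> spectral_part \<Omega> B - P"
      using V good_open by (intro exI[of _ V]) (auto simp: good_def)
  qed
  \<comment> \<open>The given path is traded for a connected set containing both endpoints; meeting
    the open set \<open>P\<close> at \<open>\<phi> x\<close>, it must avoid the open complement of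
    \<open>P\<close>.\<close>
  obtain T where T: "path_connectedin (subtopology (frechet_topology B) (spectral_part \<Omega> B)) T"
    "\<phi> x \<in> T" "\<phi> y \<in> T"
    using xy unfolding path_component_of by blast
  then have con: "connectedin (frechet_topology B) T" and TS: "T \<subseteq> spectral_part \<Omega> B"
    using path_connectedin_imp_connectedin path_connectedin_subtopology by blast+
  have "\<phi> x \<in> P"
  proof -
    obtain V where "good V" "\<phi> x \<in> V"
      using good_ex T(2) TS by blast
    then show ?thesis
      using x A.spectral_path_refl by (auto simp: P_def reached_def)
  qed
  then have "T \<inter> (spectral_part \<Omega> B - P) = {}"
    using con P_open Q_open T(2) TS unfolding connectedin by blast
  then have "\<phi> y \<in> P"
    using T(3) TS by blast
  then obtain V d where "good V" "d \<in> core" "\<phi> d \<in> V" "\<phi> y \<in> V" "spectral_path \<Omega> A x d"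
    by (auto simp: P_def reached_def)
  then show ?thesis
    using path_component_of_trans good_path y by metis
qed

text \<open>Both endpoints are moved into the core by paths in \<open>A\<close>. The images of these
  paths move the endpoints of the given path in \<open>B\<close> accordingly, so the case of core
  points suffices.\<close>

lemma spectral_path_inj:
  assumes x: "x \<in> spectral_part \<Omega> A" and y: "y \<in> spectral_part \<Omega> A"
    and xy: "spectral_path \<Omega> B (\<phi> x) (\<phi> y)"
  shows "spectral_path \<Omega> A x y"
proof -
  obtain x' where x': "x' \<in> core" "spectral_path \<Omega> A x x'"
    using spectral_path_core[OF x] .
  obtain y' where y': "y' \<in> core" "spectral_path \<Omega> A y y'"
    using spectral_path_core[OF y] .
  have "spectral_path \<Omega> B (\<phi> x') (\<phi> y')"
    using hom_spectral_path[OF x'(2)] hom_spectral_path[OF y'(2)] xy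
    by (meson path_component_of_sym path_component_of_trans)
  then have "spectral_path \<Omega> A x' y'"
    using x' y' A.spectral_path_carrier[OF x'(2)] by (intro core_spectral_path_inj)
  then show ?thesis
    using x' y' by (meson path_component_of_sym path_component_of_trans)
qed

end

section \<open>Openness of the units of matrix algebras\<close>

context seminormed_algebra
begin

section \<open>Finite sums in the algebra\<close>

text \<open>Serves associativity of matrix multiplication, where the two inner summations trade
  places.\<close>

lemma finsum_swap:
  assumes "finite S" "finite T" "\<And>x y. \<lbrakk>x \<in> S; y \<in> T\<rbrakk> \<Longrightarrow> f x y \<in> carrier A"
  shows "(\<Oplus>x\<in>S. \<Oplus>y\<in>T. f x y) = (\<Oplus>y\<in>T. \<Oplus>x\<in>S. f x y)"
  using assms(1,3)
proof (induction rule: finite_induct)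
  case empty
  then show ?case
    by (simp add: M.finsum_zero)
next
  case (insert x S)
  then have "(\<lambda>x. \<Oplus>y\<in>T. f x y) \<in> S \<rightarrow> carrier A" "(\<Oplus>y\<in>T. f x y) \<in> carrier A"
    by (auto intro!: M.finsum_closed)
  then have "(\<Oplus>x\<in>insert x S. \<Oplus>y\<in>T. f x y) = (\<Oplus>y\<in>T. f x y) \<oplus> (\<Oplus>x\<in>S. \<Oplus>y\<in>T. f x y)"
    using insert.hyps by (simp add: M.finsum_insert)
  also have "(\<Oplus>x\<in>S. \<Oplus>y\<in>T. f x y) = (\<Oplus>y\<in>T. \<Oplus>x\<in>S. f x y)"
    using insert by blast
  also have "(\<Oplus>y\<in>T. f x y) \<oplus> \<dots> = (\<Oplus>y\<in>T. f x y \<oplus> (\<Oplus>x\<in>S. f x y))"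
    using insert.prems by (intro M.finsum_addf[symmetric]) (auto intro!: M.finsum_closed)
  also have "\<dots> = (\<Oplus>y\<in>T. \<Oplus>x\<in>insert x S. f x y)"
  proof (rule M.finsum_cong')
    fix y assume y: "y \<in> T"
    have "(\<lambda>x. f x y) \<in> S \<rightarrow> carrier A" "f x y \<in> carrier A"
      using insert.prems y by auto
    then show "f x y \<oplus> (\<Oplus>x\<in>S. f x y) = (\<Oplus>x\<in>insert x S. f x y)"
      using insert.hyps by (simp add: M.finsum_insert)
  qed (use insert.prems in \<open>auto intro!: M.finsum_closed\<close>)
  finally show ?case .
qed

lemma finsum_delta:
  assumes "finite S" "i \<in> S" "f i \<in> carrier A" "\<And>k. \<lbrakk>k \<in> S; k \<noteq> i\<rbrakk> \<Longrightarrow> f k = \<zero>"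
  shows "(\<Oplus>k\<in>S. f k) = f i"
proof -
  have f: "f k \<in> carrier A" if "k \<in> S" for k
    using assms that by (cases "k = i") auto
  then have "(\<Oplus>k\<in>S. f k) = (\<Oplus>k\<in>S. if i = k then f k else \<zero>)"
    using assms by (intro M.finsum_cong') auto
  then show ?thesis
    using assms f M.finsum_singleton[of i S f] by simp
qed

text \<open>A row of an elimination matrix \<open>column_mat\<close> has at most two nonzero
  entries, on the diagonal and in the pivot column; this evaluates its products.\<close>

lemma finsum_delta2:
  assumes "finite S" "i \<in> S" "j \<in> S" "i \<noteq> j" "f i \<in> carrier A" "f j \<in> carrier A"
    and "\<And>k. \<lbrakk>k \<in> S; k \<noteq> i; k \<noteq> j\<rbrakk> \<Longrightarrow> f k = \<zero>"
  shows "(\<Oplus>k\<in>S. f k) = f i \<oplus> f j"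
proof -
  let ?g = "\<lambda>k. if k = i then f i else \<zero>" and ?h = "\<lambda>k. if k = j then f j else \<zero>"
  have "(\<Oplus>k\<in>S. f k) = (\<Oplus>k\<in>S. ?g k \<oplus> ?h k)"
    using assms by (intro M.finsum_cong') auto
  also have "\<dots> = (\<Oplus>k\<in>S. ?g k) \<oplus> (\<Oplus>k\<in>S. ?h k)"
    using assms by (intro M.finsum_addf) auto
  finally show ?thesis
    using assms finsum_delta[of S i ?g] finsum_delta[of S j ?h] by simp
qed

lemma seminorm_finsum:
  assumes "finite S" "\<And>k. k \<in> S \<Longrightarrow> f k \<in> carrier A"
  shows "seminorm A m (\<Oplus>k\<in>S. f k) \<le> (\<Sum>k\<in>S. seminorm A m (f k))"
  using assms
proof (induction rule: finite_induct)
  case (insert x S)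
  then have f: "f \<in> S \<rightarrow> carrier A" "f x \<in> carrier A"
    by auto
  then have "seminorm A m (f x \<oplus> (\<Oplus>k\<in>S. f k)) \<le> seminorm A m (f x) + seminorm A m (\<Oplus>k\<in>S. f k)"
    by (intro seminorm_add) auto
  then show ?case
    using insert f by (simp add: M.finsum_insert)
qed simp

section \<open>Matrix algebras as seminormed algebras\<close>

lemma carrier_mat_algebra:
  "M \<in> carrier (mat_algebra n A) \<longleftrightarrow>
     dim_row M = n \<and> dim_col M = n \<and> (\<forall>i<n. \<forall>j<n. M $$ (i, j) \<in> carrier A)"
  by (auto simp: mat_algebra_def)

lemma mat_carrierD:
  assumes "M \<in> carrier (mat_algebra n A)"
  shows "dim_row M = n" "dim_col M = n" "\<lbrakk>i < n; j < n\<rbrakk> \<Longrightarrow> M $$ (i, j) \<in> carrier A"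
  using assms by (auto simp: carrier_mat_algebra)

lemma mat_algebra_eqI:
  assumes "M \<in> carrier (mat_algebra n A)" "N \<in> carrier (mat_algebra n A)"
    and "\<And>i j. \<lbrakk>i < n; j < n\<rbrakk> \<Longrightarrow> M $$ (i, j) = N $$ (i, j)"
  shows "M = N"
  using assms by (intro eq_matI) (auto simp: carrier_mat_algebra)

lemma mat_algebra_index:
  assumes "i < n" "j < n"
  shows "(M \<otimes>\<^bsub>mat_algebra n A\<^esub> N) $$ (i, j) = (\<Oplus>k\<in>{..<n}. M $$ (i, k) \<otimes> N $$ (k, j))"
    and "(M \<oplus>\<^bsub>mat_algebra n A\<^esub> N) $$ (i, j) = M $$ (i, j) \<oplus> N $$ (i, j)"
    and "(c \<odot>\<^bsub>mat_algebra n A\<^esub> M) $$ (i, j) = c \<odot> M $$ (i, j)"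
    and "\<one>\<^bsub>mat_algebra n A\<^esub> $$ (i, j) = (if i = j then \<one> else \<zero>)"
    and "\<zero>\<^bsub>mat_algebra n A\<^esub> $$ (i, j) = \<zero>"
  using assms by (simp_all add: mat_algebra_def)

lemma mat_algebra_seminorm:
  "seminorm (mat_algebra n A) k M = (\<Sum>i<n. \<Sum>j<n. seminorm A k (M $$ (i, j)))"
  by (simp add: mat_algebra_def)

lemma mat_algebra_mult_closed:
  assumes "M \<in> carrier (mat_algebra n A)" "N \<in> carrier (mat_algebra n A)"
  shows "M \<otimes>\<^bsub>mat_algebra n A\<^esub> N \<in> carrier (mat_algebra n A)"
proof -
  have "M \<otimes>\<^bsub>mat_algebra n A\<^esub> N = mat n n (\<lambda>(i, j). \<Oplus>k\<in>{..<n}. M $$ (i, k) \<otimes> N $$ (k, j))"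
    by (simp add: mat_algebra_def)
  then show ?thesis
    using assms by (auto simp: carrier_mat_algebra intro!: M.finsum_closed)
qed

lemma mat_algebra_closed:
  "\<lbrakk>M \<in> carrier (mat_algebra n A); N \<in> carrier (mat_algebra n A)\<rbrakk>
    \<Longrightarrow> M \<oplus>\<^bsub>mat_algebra n A\<^esub> N \<in> carrier (mat_algebra n A)"
  "M \<in> carrier (mat_algebra n A) \<Longrightarrow> c \<odot>\<^bsub>mat_algebra n A\<^esub> M \<in> carrier (mat_algebra n A)"
  "\<one>\<^bsub>mat_algebra n A\<^esub> \<in> carrier (mat_algebra n A)"
  "\<zero>\<^bsub>mat_algebra n A\<^esub> \<in> carrier (mat_algebra n A)"
  unfolding carrier_mat_algebra by (auto simp: mat_algebra_def)

lemma mat_algebra_mult_one: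
  assumes M: "M \<in> carrier (mat_algebra n A)"
  shows "\<one>\<^bsub>mat_algebra n A\<^esub> \<otimes>\<^bsub>mat_algebra n A\<^esub> M = M" "M \<otimes>\<^bsub>mat_algebra n A\<^esub> \<one>\<^bsub>mat_algebra n A\<^esub> = M"
proof -
  have "(\<Oplus>k\<in>{..<n}. (if i = k then \<one> else \<zero>) \<otimes> M $$ (k, j)) = M $$ (i, j)"
    "(\<Oplus>k\<in>{..<n}. M $$ (i, k) \<otimes> (if k = j then \<one> else \<zero>)) = M $$ (i, j)" if "i < n" "j < n" for i j
    using that mat_carrierD[OF M] by (subst finsum_delta[of _ i] finsum_delta[of _ j]; simp)+
  moreover have "(\<Oplus>k\<in>{..<n}. \<one>\<^bsub>mat_algebra n A\<^esub> $$ (i, k) \<otimes> M $$ (k, j))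
        = (\<Oplus>k\<in>{..<n}. (if i = k then \<one> else \<zero>) \<otimes> M $$ (k, j))"
    "(\<Oplus>k\<in>{..<n}. M $$ (i, k) \<otimes> \<one>\<^bsub>mat_algebra n A\<^esub> $$ (k, j))
        = (\<Oplus>k\<in>{..<n}. M $$ (i, k) \<otimes> (if k = j then \<one> else \<zero>))" if "i < n" "j < n" for i j
    using that mat_carrierD[OF M] by (auto intro!: M.finsum_cong' simp: mat_algebra_index)
  ultimately show "\<one>\<^bsub>mat_algebra n A\<^esub> \<otimes>\<^bsub>mat_algebra n A\<^esub> M = M" "M \<otimes>\<^bsub>mat_algebra n A\<^esub> \<one>\<^bsub>mat_algebra n A\<^esub> = M"
    using M by (auto intro!: mat_algebra_eqI[of _ n] mat_algebra_mult_closed mat_algebra_closed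
        simp: mat_algebra_index(1))
qed

lemma mat_algebra_assoc:
  assumes M: "M \<in> carrier (mat_algebra n A)" and N: "N \<in> carrier (mat_algebra n A)"
    and L: "L \<in> carrier (mat_algebra n A)"
  shows "M \<otimes>\<^bsub>mat_algebra n A\<^esub> N \<otimes>\<^bsub>mat_algebra n A\<^esub> L = M \<otimes>\<^bsub>mat_algebra n A\<^esub> (N \<otimes>\<^bsub>mat_algebra n A\<^esub> L)"
proof (rule mat_algebra_eqI[of _ n])
  fix i j assume ij: "i < n" "j < n"
  note C = mat_carrierD(3)[OF M] mat_carrierD(3)[OF N] mat_carrierD(3)[OF L]
  have "(\<Oplus>k\<in>{..<n}. (\<Oplus>l\<in>{..<n}. M $$ (i, l) \<otimes> N $$ (l, k)) \<otimes> L $$ (k, j))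
      = (\<Oplus>k\<in>{..<n}. \<Oplus>l\<in>{..<n}. M $$ (i, l) \<otimes> N $$ (l, k) \<otimes> L $$ (k, j))"
    using C ij by (intro M.finsum_cong' finsum_ldistr) (auto intro!: M.finsum_closed)
  also have "\<dots> = (\<Oplus>l\<in>{..<n}. \<Oplus>k\<in>{..<n}. M $$ (i, l) \<otimes> N $$ (l, k) \<otimes> L $$ (k, j))"
    using C ij by (intro finsum_swap) auto
  also have "\<dots> = (\<Oplus>l\<in>{..<n}. \<Oplus>k\<in>{..<n}. M $$ (i, l) \<otimes> (N $$ (l, k) \<otimes> L $$ (k, j)))"
    using C ij by (intro M.finsum_cong') (auto intro!: M.finsum_closed m_assoc)
  also have "\<dots> = (\<Oplus>l\<in>{..<n}. M $$ (i, l) \<otimes> (\<Oplus>k\<in>{..<n}. N $$ (l, k) \<otimes> L $$ (k, j)))"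
    using C ij by (intro M.finsum_cong' finsum_rdistr[symmetric]) (auto intro!: M.finsum_closed)
  finally have eq: "(\<Oplus>k\<in>{..<n}. (\<Oplus>l\<in>{..<n}. M $$ (i, l) \<otimes> N $$ (l, k)) \<otimes> L $$ (k, j))
      = (\<Oplus>l\<in>{..<n}. M $$ (i, l) \<otimes> (\<Oplus>k\<in>{..<n}. N $$ (l, k) \<otimes> L $$ (k, j)))" .
  have "(M \<otimes>\<^bsub>mat_algebra n A\<^esub> N \<otimes>\<^bsub>mat_algebra n A\<^esub> L) $$ (i, j)
      = (\<Oplus>k\<in>{..<n}. (\<Oplus>l\<in>{..<n}. M $$ (i, l) \<otimes> N $$ (l, k)) \<otimes> L $$ (k, j))"
    unfolding mat_algebra_index(1)[OF ij] using C ij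
    by (intro M.finsum_cong') (auto simp: mat_algebra_index intro!: M.finsum_closed)
  moreover have "(M \<otimes>\<^bsub>mat_algebra n A\<^esub> (N \<otimes>\<^bsub>mat_algebra n A\<^esub> L)) $$ (i, j)
      = (\<Oplus>l\<in>{..<n}. M $$ (i, l) \<otimes> (\<Oplus>k\<in>{..<n}. N $$ (l, k) \<otimes> L $$ (k, j)))"
    unfolding mat_algebra_index(1)[OF ij] using C ij
    by (intro M.finsum_cong') (auto simp: mat_algebra_index intro!: M.finsum_closed)
  ultimately show "(M \<otimes>\<^bsub>mat_algebra n A\<^esub> N \<otimes>\<^bsub>mat_algebra n A\<^esub> L) $$ (i, j)
      = (M \<otimes>\<^bsub>mat_algebra n A\<^esub> (N \<otimes>\<^bsub>mat_algebra n A\<^esub> L)) $$ (i, j)"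
    using eq by simp
qed (intro mat_algebra_mult_closed M N L)+

lemma mat_algebra_distr:
  assumes M: "M \<in> carrier (mat_algebra n A)" and N: "N \<in> carrier (mat_algebra n A)"
    and L: "L \<in> carrier (mat_algebra n A)"
  shows "(M \<oplus>\<^bsub>mat_algebra n A\<^esub> N) \<otimes>\<^bsub>mat_algebra n A\<^esub> L
      = M \<otimes>\<^bsub>mat_algebra n A\<^esub> L \<oplus>\<^bsub>mat_algebra n A\<^esub> N \<otimes>\<^bsub>mat_algebra n A\<^esub> L"
    and "L \<otimes>\<^bsub>mat_algebra n A\<^esub> (M \<oplus>\<^bsub>mat_algebra n A\<^esub> N)
      = L \<otimes>\<^bsub>mat_algebra n A\<^esub> M \<oplus>\<^bsub>mat_algebra n A\<^esub> L \<otimes>\<^bsub>mat_algebra n A\<^esub> N"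
proof -
  note C = mat_carrierD(3)[OF M] mat_carrierD(3)[OF N] mat_carrierD(3)[OF L]
  show "(M \<oplus>\<^bsub>mat_algebra n A\<^esub> N) \<otimes>\<^bsub>mat_algebra n A\<^esub> L
      = M \<otimes>\<^bsub>mat_algebra n A\<^esub> L \<oplus>\<^bsub>mat_algebra n A\<^esub> N \<otimes>\<^bsub>mat_algebra n A\<^esub> L"
  proof (rule mat_algebra_eqI[of _ n])
    fix i j assume ij: "i < n" "j < n"
    have "(\<Oplus>k\<in>{..<n}. (M \<oplus>\<^bsub>mat_algebra n A\<^esub> N) $$ (i, k) \<otimes> L $$ (k, j))
        = (\<Oplus>k\<in>{..<n}. M $$ (i, k) \<otimes> L $$ (k, j) \<oplus> N $$ (i, k) \<otimes> L $$ (k, j))"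
      using C ij by (intro M.finsum_cong') (auto simp: mat_algebra_index l_distr)
    also have "\<dots> = (\<Oplus>k\<in>{..<n}. M $$ (i, k) \<otimes> L $$ (k, j)) \<oplus> (\<Oplus>k\<in>{..<n}. N $$ (i, k) \<otimes> L $$ (k, j))"
      using C ij by (intro M.finsum_addf) auto
    finally show "((M \<oplus>\<^bsub>mat_algebra n A\<^esub> N) \<otimes>\<^bsub>mat_algebra n A\<^esub> L) $$ (i, j)
        = (M \<otimes>\<^bsub>mat_algebra n A\<^esub> L \<oplus>\<^bsub>mat_algebra n A\<^esub> N \<otimes>\<^bsub>mat_algebra n A\<^esub> L) $$ (i, j)"
      using ij by (simp only: mat_algebra_index)
  qed (intro mat_algebra_mult_closed mat_algebra_closed M N L)+
  show "L \<otimes>\<^bsub>mat_algebra n A\<^esub> (M \<oplus>\<^bsub>mat_algebra n A\<^esub> N)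
      = L \<otimes>\<^bsub>mat_algebra n A\<^esub> M \<oplus>\<^bsub>mat_algebra n A\<^esub> L \<otimes>\<^bsub>mat_algebra n A\<^esub> N"
  proof (rule mat_algebra_eqI[of _ n])
    fix i j assume ij: "i < n" "j < n"
    have "(\<Oplus>k\<in>{..<n}. L $$ (i, k) \<otimes> (M \<oplus>\<^bsub>mat_algebra n A\<^esub> N) $$ (k, j))
        = (\<Oplus>k\<in>{..<n}. L $$ (i, k) \<otimes> M $$ (k, j) \<oplus> L $$ (i, k) \<otimes> N $$ (k, j))"
      using C ij by (intro M.finsum_cong') (auto simp: mat_algebra_index r_distr)
    also have "\<dots> = (\<Oplus>k\<in>{..<n}. L $$ (i, k) \<otimes> M $$ (k, j)) \<oplus> (\<Oplus>k\<in>{..<n}. L $$ (i, k) \<otimes> N $$ (k, j))"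
      using C ij by (intro M.finsum_addf) auto
    finally show "(L \<otimes>\<^bsub>mat_algebra n A\<^esub> (M \<oplus>\<^bsub>mat_algebra n A\<^esub> N)) $$ (i, j)
        = (L \<otimes>\<^bsub>mat_algebra n A\<^esub> M \<oplus>\<^bsub>mat_algebra n A\<^esub> L \<otimes>\<^bsub>mat_algebra n A\<^esub> N) $$ (i, j)"
      using ij by (simp only: mat_algebra_index)
  qed (intro mat_algebra_mult_closed mat_algebra_closed M N L)+
qed

lemma mat_algebra_abelian_group: "abelian_group (mat_algebra n A)"
proof (rule abelian_groupI)
  show "\<exists>N\<in>carrier (mat_algebra n A). N \<oplus>\<^bsub>mat_algebra n A\<^esub> M = \<zero>\<^bsub>mat_algebra n A\<^esub>"
    if M: "M \<in> carrier (mat_algebra n A)" for M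
    using M mat_carrierD[OF M]
    by (intro bexI[of _ "(- 1) \<odot>\<^bsub>mat_algebra n A\<^esub> M"] mat_algebra_eqI[of _ n])
      (auto simp: mat_algebra_closed mat_algebra_index scal_neg M.l_neg)
qed (auto intro!: mat_algebra_closed mat_algebra_eqI[of _ n]
      simp: mat_algebra_index M.a_ac mat_carrierD)

lemma mat_algebra_ring: "Ring.ring (mat_algebra n A)"
proof (rule Ring.ringI)
  show "Group.monoid (mat_algebra n A)"
    by (rule monoidI) (auto intro!: mat_algebra_closed mat_algebra_mult_closed
        simp: mat_algebra_assoc mat_algebra_mult_one)
qed (auto intro!: mat_algebra_abelian_group mat_algebra_distr)

lemma mat_algebra_module: "Module.module complex_field (mat_algebra n A)"
  by (rule Module.moduleI[OF R.is_cring])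
    (auto intro!: mat_algebra_abelian_group mat_algebra_closed mat_algebra_eqI[of _ n]
      simp: mat_algebra_index complex_field_def scal_add_left scal_add_right scal_scal mat_carrierD)

text \<open>Enlarging each row sum of \<open>N\<close> to the sum over all its entries decouples the
  two factors.\<close>

lemma mat_algebra_seminorm_mult:
  assumes M: "M \<in> carrier (mat_algebra n A)" and N: "N \<in> carrier (mat_algebra n A)"
  shows "seminorm (mat_algebra n A) k (M \<otimes>\<^bsub>mat_algebra n A\<^esub> N)
    \<le> seminorm (mat_algebra n A) k M * seminorm (mat_algebra n A) k N"
proof -
  let ?a = "\<lambda>i l. seminorm A k (M $$ (i, l))" and ?b = "\<lambda>l j. seminorm A k (N $$ (l, j))"
  note C = mat_carrierD(3)[OF M] mat_carrierD(3)[OF N]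
  have "seminorm A k ((M \<otimes>\<^bsub>mat_algebra n A\<^esub> N) $$ (i, j)) \<le> (\<Sum>l<n. ?a i l * ?b l j)"
    if ij: "i < n" "j < n" for i j
  proof -
    have "seminorm A k (\<Oplus>l\<in>{..<n}. M $$ (i, l) \<otimes> N $$ (l, j))
        \<le> (\<Sum>l<n. seminorm A k (M $$ (i, l) \<otimes> N $$ (l, j)))"
      using C ij by (intro seminorm_finsum) auto
    also have "\<dots> \<le> (\<Sum>l<n. ?a i l * ?b l j)"
      using C ij by (intro sum_mono seminorm_mult) auto
    finally show ?thesis
      using ij by (simp add: mat_algebra_index)
  qed
  then have "seminorm (mat_algebra n A) k (M \<otimes>\<^bsub>mat_algebra n A\<^esub> N)
      \<le> (\<Sum>i<n. \<Sum>j<n. \<Sum>l<n. ?a i l * ?b l j)"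
    unfolding mat_algebra_seminorm by (intro sum_mono) auto
  also have "\<dots> = (\<Sum>i<n. \<Sum>l<n. ?a i l * (\<Sum>j<n. ?b l j))"
    by (simp add: sum_distrib_left) (rule sum.cong[OF refl], rule sum.swap)
  also have "\<dots> \<le> (\<Sum>i<n. \<Sum>l<n. ?a i l * (\<Sum>l<n. \<Sum>j<n. ?b l j))"
    using C by (intro sum_mono mult_left_mono member_le_sum sum_nonneg seminorm_nonneg) auto
  also have "\<dots> = seminorm (mat_algebra n A) k M * seminorm (mat_algebra n A) k N"
    by (simp add: mat_algebra_seminorm sum_distrib_right)
  finally show ?thesis .
qed

text \<open>Through this interpretation the results on topology, spectral parts and paths become
  available at every matrix size.\<close>

lemma mat_algebra_seminormed: "seminormed_algebra (mat_algebra n A)"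
proof (intro seminormed_algebra.intro seminormed_algebra_axioms.intro
    mat_algebra_module mat_algebra_ring mat_algebra_seminorm_mult)
  fix M N c k assume M: "M \<in> carrier (mat_algebra n A)"
  note CM = mat_carrierD(3)[OF M]
  show "0 \<le> seminorm (mat_algebra n A) k M"
    using CM by (auto simp: mat_algebra_seminorm intro!: sum_nonneg seminorm_nonneg)
  show "seminorm (mat_algebra n A) k (c \<odot>\<^bsub>mat_algebra n A\<^esub> M) = cmod c * seminorm (mat_algebra n A) k M"
    using CM by (simp add: mat_algebra_seminorm mat_algebra_index seminorm_smult sum_distrib_left)
  assume N: "N \<in> carrier (mat_algebra n A)"
  note CN = mat_carrierD(3)[OF N]
  show "seminorm (mat_algebra n A) k (M \<oplus>\<^bsub>mat_algebra n A\<^esub> N)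
      \<le> seminorm (mat_algebra n A) k M + seminorm (mat_algebra n A) k N"
    using CM CN by (auto simp: mat_algebra_seminorm mat_algebra_index simp flip: sum.distrib
        intro!: sum_mono seminorm_add)
  have "(\<Oplus>l\<in>{..<n}. (c \<odot> M $$ (i, l)) \<otimes> N $$ (l, j)) = c \<odot> (\<Oplus>l\<in>{..<n}. M $$ (i, l) \<otimes> N $$ (l, j))"
    "(\<Oplus>l\<in>{..<n}. M $$ (i, l) \<otimes> (c \<odot> N $$ (l, j))) = c \<odot> (\<Oplus>l\<in>{..<n}. M $$ (i, l) \<otimes> N $$ (l, j))"
    if ij: "i < n" "j < n" for i j
    using CM CN ij
    by (subst finsum_smult_ldistr; auto intro!: M.finsum_cong' simp: complex_field_def
        smult_mult_left smult_mult_right)+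
  note S = this
  have "((c \<odot>\<^bsub>mat_algebra n A\<^esub> M) \<otimes>\<^bsub>mat_algebra n A\<^esub> N) $$ (i, j) = (c \<odot>\<^bsub>mat_algebra n A\<^esub> (M \<otimes>\<^bsub>mat_algebra n A\<^esub> N)) $$ (i, j)"
    "(M \<otimes>\<^bsub>mat_algebra n A\<^esub> (c \<odot>\<^bsub>mat_algebra n A\<^esub> N)) $$ (i, j) = (c \<odot>\<^bsub>mat_algebra n A\<^esub> (M \<otimes>\<^bsub>mat_algebra n A\<^esub> N)) $$ (i, j)"
    if ij: "i < n" "j < n" for i j
  proof -
    have "(\<Oplus>l\<in>{..<n}. (c \<odot>\<^bsub>mat_algebra n A\<^esub> M) $$ (i, l) \<otimes> N $$ (l, j)) = (\<Oplus>l\<in>{..<n}. (c \<odot> M $$ (i, l)) \<otimes> N $$ (l, j))"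
      "(\<Oplus>l\<in>{..<n}. M $$ (i, l) \<otimes> (c \<odot>\<^bsub>mat_algebra n A\<^esub> N) $$ (l, j)) = (\<Oplus>l\<in>{..<n}. M $$ (i, l) \<otimes> (c \<odot> N $$ (l, j)))"
      using CM CN ij by (auto intro!: M.finsum_cong' simp: mat_algebra_index)
    then show "((c \<odot>\<^bsub>mat_algebra n A\<^esub> M) \<otimes>\<^bsub>mat_algebra n A\<^esub> N) $$ (i, j) = (c \<odot>\<^bsub>mat_algebra n A\<^esub> (M \<otimes>\<^bsub>mat_algebra n A\<^esub> N)) $$ (i, j)"
      "(M \<otimes>\<^bsub>mat_algebra n A\<^esub> (c \<odot>\<^bsub>mat_algebra n A\<^esub> N)) $$ (i, j) = (c \<odot>\<^bsub>mat_algebra n A\<^esub> (M \<otimes>\<^bsub>mat_algebra n A\<^esub> N)) $$ (i, j)"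
      using S[OF ij] ij by (simp_all only: mat_algebra_index)
  qed
  note E = this
  show "(c \<odot>\<^bsub>mat_algebra n A\<^esub> M) \<otimes>\<^bsub>mat_algebra n A\<^esub> N = c \<odot>\<^bsub>mat_algebra n A\<^esub> (M \<otimes>\<^bsub>mat_algebra n A\<^esub> N)"
    "M \<otimes>\<^bsub>mat_algebra n A\<^esub> (c \<odot>\<^bsub>mat_algebra n A\<^esub> N) = c \<odot>\<^bsub>mat_algebra n A\<^esub> (M \<otimes>\<^bsub>mat_algebra n A\<^esub> N)"
    by (intro mat_algebra_eqI[of _ n] E mat_algebra_mult_closed mat_algebra_closed M N; assumption)+
qed

section \<open>Continuity is entrywise\<close>

lemma mat_algebra_diff_index:
  assumes M: "M \<in> carrier (mat_algebra n A)" and N: "N \<in> carrier (mat_algebra n A)"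
    and ij: "i < n" "j < n"
  shows "(M \<ominus>\<^bsub>mat_algebra n A\<^esub> N) $$ (i, j) = M $$ (i, j) \<ominus> N $$ (i, j)"
proof -
  interpret Mn: seminormed_algebra "mat_algebra n A"
    by (rule mat_algebra_seminormed)
  show ?thesis
    using M N ij mat_carrierD(3)[OF M] mat_carrierD(3)[OF N]
    by (simp add: Mn.diff_eq_scal diff_eq_scal mat_algebra_index)
qed

text \<open>Each entry is dominated by the matrix seminorm, and conversely that seminorm is a finite
  sum of entry seminorms.\<close>

lemma continuous_map_mat_iff:
  "continuous_map X (frechet_topology (mat_algebra n A)) f \<longleftrightarrow>
     f \<in> topspace X \<rightarrow> carrier (mat_algebra n A) \<and>
     (\<forall>i<n. \<forall>j<n. continuous_map X (frechet_topology A) (\<lambda>x. f x $$ (i, j)))"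
  (is "?L \<longleftrightarrow> ?F \<and> ?R")
proof -
  interpret Mn: seminormed_algebra "mat_algebra n A"
    by (rule mat_algebra_seminormed)
  have sn: "seminorm (mat_algebra n A) k (f y \<ominus>\<^bsub>mat_algebra n A\<^esub> f x)
      = (\<Sum>i<n. \<Sum>j<n. seminorm A k (f y $$ (i, j) \<ominus> f x $$ (i, j)))"
    if F: ?F and "x \<in> topspace X" "y \<in> topspace X" for x y k
    unfolding mat_algebra_seminorm
    by (intro sum.cong refl) (use that in \<open>auto simp: Pi_iff mat_algebra_diff_index\<close>)
  show ?thesis
  proof (intro iffI conjI allI impI)
    fix i j assume L: ?L and ij: "i < n" "j < n"
    have F: ?F
      using continuous_map_funspace[OF L] by simp
    show "continuous_map X (frechet_topology A) (\<lambda>x. f x $$ (i, j))"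
    proof (rule continuous_map_frechet_sandwich[where
          g = "\<lambda>x k y. seminorm (mat_algebra n A) k (f y \<ominus>\<^bsub>mat_algebra n A\<^esub> f x)"])
      show "f x $$ (i, j) \<in> carrier A" if "x \<in> topspace X" for x
        using F that ij mat_carrierD(3) by blast
      show "((\<lambda>y. seminorm (mat_algebra n A) k (f y \<ominus>\<^bsub>mat_algebra n A\<^esub> f x)) \<longlongrightarrow> 0) (nhdsin X x)"
        if "x \<in> topspace X" for x k
        by (rule Mn.continuous_map_frechetD(2)[OF L that])
      show "seminorm A k (f y $$ (i, j) \<ominus> f x $$ (i, j))
          \<le> seminorm (mat_algebra n A) k (f y \<ominus>\<^bsub>mat_algebra n A\<^esub> f x)"
        if xy: "x \<in> topspace X" "y \<in> topspace X" for x y k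
      proof -
        have nonneg: "0 \<le> seminorm A k (f y $$ (i, j) \<ominus> f x $$ (i, j))" if "i < n" "j < n" for i j
          using F xy that mat_carrierD(3) by (intro seminorm_nonneg M.minus_closed) blast+
        have "seminorm A k (f y $$ (i, j) \<ominus> f x $$ (i, j))
            \<le> (\<Sum>j<n. seminorm A k (f y $$ (i, j) \<ominus> f x $$ (i, j)))"
          using nonneg ij by (intro member_le_sum) auto
        also have "\<dots> \<le> (\<Sum>i<n. \<Sum>j<n. seminorm A k (f y $$ (i, j) \<ominus> f x $$ (i, j)))"
          by (rule member_le_sum) (use nonneg ij in \<open>auto intro!: sum_nonneg\<close>)
        finally show ?thesis
          using sn[OF F xy] by simp
      qed
    qed
  next
    assume FR: "?F \<and> ?R"
    then have F: ?F and R: "\<And>i j. \<lbrakk>i < n; j < n\<rbrakk> \<Longrightarrow> continuous_map X (frechet_topology A) (\<lambda>x. f x $$ (i, j))"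
      by blast+
    show ?L
    proof (rule Mn.continuous_map_frechet_sandwich[where
          g = "\<lambda>x k y. \<Sum>i<n. \<Sum>j<n. seminorm A k (f y $$ (i, j) \<ominus> f x $$ (i, j))"])
      show "f x \<in> carrier (mat_algebra n A)" if "x \<in> topspace X" for x
        using F that by blast
      show "((\<lambda>y. \<Sum>i<n. \<Sum>j<n. seminorm A k (f y $$ (i, j) \<ominus> f x $$ (i, j))) \<longlongrightarrow> 0) (nhdsin X x)"
        if "x \<in> topspace X" for x k
        by (intro tendsto_null_sum continuous_map_frechetD(2)[OF R that]) auto
      show "seminorm (mat_algebra n A) k (f y \<ominus>\<^bsub>mat_algebra n A\<^esub> f x)
          \<le> (\<Sum>i<n. \<Sum>j<n. seminorm A k (f y $$ (i, j) \<ominus> f x $$ (i, j)))"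
        if xy: "x \<in> topspace X" "y \<in> topspace X" for x y k
        using sn[OF F xy] by simp
    qed
  qed (use continuous_map_funspace in force)
qed

lemma continuous_map_mat_index:
  assumes "i < n" "j < n"
  shows "continuous_map (frechet_topology (mat_algebra n A)) (frechet_topology A) (\<lambda>M. M $$ (i, j))"
  using continuous_map_mat_iff[of "frechet_topology (mat_algebra n A)" n "\<lambda>M. M"] assms by simp

section \<open>Units and column elimination\<close>

text \<open>Left multiplication by \<open>inv u\<close> is continuous and carries \<open>u\<close>
  to \<open>\<one>\<close>, so a neighbourhood of the unit is transported to every
  \<open>u\<close>.\<close>

lemma openin_Units_if_nhd_one:
  assumes U: "openin (frechet_topology A) U" "\<one> \<in> U" "U \<subseteq> Units A"
  shows "openin (frechet_topology A) (Units A)"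
proof (subst openin_subopen, intro ballI)
  fix u assume u: "u \<in> Units A"
  have uc: "u \<in> carrier A" "inv u \<in> carrier A"
    using u by auto
  let ?V = "{x \<in> topspace (frechet_topology A). inv u \<otimes> x \<in> U}"
  have "continuous_map (frechet_topology A) (frechet_topology A) (\<lambda>x. inv u \<otimes> x)"
    using uc by (intro continuous_map_frechet_mult continuous_map_frechet_const) auto
  then have "openin (frechet_topology A) ?V"
    using U(1) by (rule openin_continuous_map_preimage)
  moreover have "u \<in> ?V"
    using u uc U(2) by simp
  moreover have "?V \<subseteq> Units A"
  proof
    fix x assume "x \<in> ?V"
    then have x: "x \<in> carrier A" "inv u \<otimes> x \<in> Units A"
      using U(3) by auto
    then have "u \<otimes> (inv u \<otimes> x) \<in> Units A"
      using u by blast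
    moreover have "u \<otimes> (inv u \<otimes> x) = x"
      using u uc x by (simp flip: m_assoc)
    ultimately show "x \<in> Units A"
      by simp
  qed
  ultimately show "\<exists>T. openin (frechet_topology A) T \<and> u \<in> T \<and> T \<subseteq> Units A"
    by blast
qed

text \<open>The elementary factor of Gauss-Jordan elimination, sometimes called an eta
  matrix.\<close>

definition column_mat :: "nat \<Rightarrow> nat \<Rightarrow> (nat \<Rightarrow> 'a) \<Rightarrow> 'a mat"
  where "column_mat n k v = mat n n (\<lambda>(i, j). if j = k then v i else if i = j then \<one> else \<zero>)"

lemma column_mat_closed:
  "(\<And>i. i < n \<Longrightarrow> v i \<in> carrier A) \<Longrightarrow> column_mat n k v \<in> carrier (mat_algebra n A)"
  by (simp add: column_mat_def carrier_mat_algebra)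

lemma column_mat_mult:
  assumes v: "\<And>i. i < n \<Longrightarrow> v i \<in> carrier A" and M: "M \<in> carrier (mat_algebra n A)"
    and ij: "i < n" "j < n" "k < n"
  shows "(column_mat n k v \<otimes>\<^bsub>mat_algebra n A\<^esub> M) $$ (i, j)
    = (if i = k then v k \<otimes> M $$ (k, j) else M $$ (i, j) \<oplus> v i \<otimes> M $$ (k, j))"
proof -
  note C = v mat_carrierD(3)[OF M]
  let ?f = "\<lambda>l. column_mat n k v $$ (i, l) \<otimes> M $$ (l, j)"
  show ?thesis
  proof (cases "i = k")
    case True
    then have "(\<Oplus>l\<in>{..<n}. ?f l) = ?f k"
      using C ij by (intro finsum_delta) (auto simp: column_mat_def)
    then show ?thesis
      using True ij by (simp add: mat_algebra_index(1)) (simp add: column_mat_def)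
  next
    case False
    then have "(\<Oplus>l\<in>{..<n}. ?f l) = ?f i \<oplus> ?f k"
      using C ij by (intro finsum_delta2) (auto simp: column_mat_def)
    then show ?thesis
      using False C ij by (simp add: mat_algebra_index(1)) (simp add: column_mat_def)
  qed
qed

lemma column_mat_Units:
  assumes v: "\<And>i. i < n \<Longrightarrow> v i \<in> carrier A" and k: "k < n" "v k \<in> Units A"
  shows "column_mat n k v \<in> Units (mat_algebra n A)"
proof -
  \<comment> \<open>The inverse has the same shape. Solving for its column gives the inverse pivot
    in row \<open>k\<close> and, in the other rows, \<open>v i\<close> cancelled by the pivot from
    the right; the order matters since \<open>A\<close> need not be commutative.\<close>
  define w where "w i = (if i = k then inv (v k) else \<ominus> (v i \<otimes> inv (v k)))" for i
  have iv: "inv (v k) \<in> carrier A"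
    using k by blast
  have w: "w i \<in> carrier A" if "i < n" for i
    using v that iv by (simp add: w_def)
  note Cv = column_mat_closed[of n v k, OF v] and Cw = column_mat_closed[of n w k, OF w]
  have "column_mat n k v \<otimes>\<^bsub>mat_algebra n A\<^esub> column_mat n k w = \<one>\<^bsub>mat_algebra n A\<^esub>"
  proof (rule mat_algebra_eqI[of _ n])
    fix i j assume ij: "i < n" "j < n"
    have "(if i = k then v k \<otimes> column_mat n k w $$ (k, j)
        else column_mat n k w $$ (i, j) \<oplus> v i \<otimes> column_mat n k w $$ (k, j)) = (if i = j then \<one> else \<zero>)"
      using ij k v iv by (auto simp: column_mat_def w_def M.l_neg)
    then show "(column_mat n k v \<otimes>\<^bsub>mat_algebra n A\<^esub> column_mat n k w) $$ (i, j) = \<one>\<^bsub>mat_algebra n A\<^esub> $$ (i, j)"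
      using ij k v by (simp add: column_mat_mult Cw mat_algebra_index(4))
  qed (auto intro!: Cv Cw mat_algebra_mult_closed mat_algebra_closed)
  moreover have "column_mat n k w \<otimes>\<^bsub>mat_algebra n A\<^esub> column_mat n k v = \<one>\<^bsub>mat_algebra n A\<^esub>"
  proof (rule mat_algebra_eqI[of _ n])
    fix i j assume ij: "i < n" "j < n"
    have "v i \<oplus> \<ominus> (v i \<otimes> inv (v k)) \<otimes> v k = \<zero>"
      using ij k v iv by (simp add: l_minus m_assoc M.r_neg)
    then have "(if i = k then w k \<otimes> column_mat n k v $$ (k, j)
        else column_mat n k v $$ (i, j) \<oplus> w i \<otimes> column_mat n k v $$ (k, j)) = (if i = j then \<one> else \<zero>)"
      using ij k v iv by (auto simp: column_mat_def w_def)
    then show "(column_mat n k w \<otimes>\<^bsub>mat_algebra n A\<^esub> column_mat n k v) $$ (i, j) = \<one>\<^bsub>mat_algebra n A\<^esub> $$ (i, j)"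
      using ij k w by (simp add: column_mat_mult Cv mat_algebra_index(4))
  qed (auto intro!: Cv Cw mat_algebra_mult_closed mat_algebra_closed)
  ultimately show ?thesis
    unfolding Units_def using Cv Cw by blast
qed

text \<open>This is the inverse of the column matrix built from column \<open>k\<close> of
  \<open>M\<close>, multiplied by \<open>M\<close>. It is written out in entries so that its
  continuity reduces to that of products, differences and the inverse of the pivot.\<close>

definition eliminate :: "nat \<Rightarrow> nat \<Rightarrow> 'a mat \<Rightarrow> 'a mat"
  where "eliminate n k M = mat n n (\<lambda>(i, j). if i = k then inv (M $$ (k, k)) \<otimes> M $$ (k, j)
     else M $$ (i, j) \<ominus> M $$ (i, k) \<otimes> (inv (M $$ (k, k)) \<otimes> M $$ (k, j)))"

lemma eliminate_closed:
  assumes M: "M \<in> carrier (mat_algebra n A)" and k: "k < n" "M $$ (k, k) \<in> Units A"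
  shows "eliminate n k M \<in> carrier (mat_algebra n A)"
  using mat_carrierD(3)[OF M] k Units_inv_closed[OF k(2)]
  by (auto simp: eliminate_def carrier_mat_algebra)

lemma eliminate_factor:
  assumes M: "M \<in> carrier (mat_algebra n A)" and k: "k < n" "M $$ (k, k) \<in> Units A"
  shows "M = column_mat n k (\<lambda>i. M $$ (i, k)) \<otimes>\<^bsub>mat_algebra n A\<^esub> eliminate n k M"
proof (rule mat_algebra_eqI[of _ n])
  fix i j assume ij: "i < n" "j < n"
  note C = mat_carrierD(3)[OF M] Units_inv_closed[OF k(2)]
  have "M $$ (k, k) \<otimes> (inv (M $$ (k, k)) \<otimes> M $$ (k, j)) = M $$ (k, j)"
    using C ij k by (simp flip: m_assoc)
  moreover have "(M $$ (i, j) \<ominus> x) \<oplus> x = M $$ (i, j)" if "x \<in> carrier A" for x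
    using C ij that by (simp add: a_minus_def M.a_assoc M.l_neg)
  ultimately show "M $$ (i, j)
      = (column_mat n k (\<lambda>i. M $$ (i, k)) \<otimes>\<^bsub>mat_algebra n A\<^esub> eliminate n k M) $$ (i, j)"
    using ij k C by (subst column_mat_mult[OF _ eliminate_closed[OF M k]]) (auto simp: eliminate_def)
qed (use M k in \<open>auto intro!: mat_algebra_mult_closed column_mat_closed eliminate_closed mat_carrierD(3)[OF M]\<close>)

end

context good_frechet_algebra
begin

text \<open>No determinant is available over a noncommutative algebra. Instead, induction on
  \<open>k\<close> finds a neighbourhood of the unit matrix in which every matrix whose columns from
  \<open>k\<close> on are those of the unit matrix is invertible. Eliminating column
  \<open>k\<close> passes from \<open>Suc k\<close> to \<open>k\<close>, and the neighbourhood is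
  pulled back along the elimination.\<close>

lemma openin_Units_mat:
  "openin (frechet_topology (mat_algebra n A)) (Units (mat_algebra n A))"
proof -
  interpret Mn: seminormed_algebra "mat_algebra n A"
    by (rule mat_algebra_seminormed)
  let ?T = "frechet_topology (mat_algebra n A)" and ?I = "\<one>\<^bsub>mat_algebra n A\<^esub>"
  define standard where "standard k M \<longleftrightarrow>
    (\<forall>j i. k \<le> j \<and> j < n \<and> i < n \<longrightarrow> M $$ (i, j) = (if i = j then \<one> else \<zero>))" for k M
  have "\<exists>U. openin ?T U \<and> ?I \<in> U \<and> (\<forall>M\<in>U. standard k M \<longrightarrow> M \<in> Units (mat_algebra n A))"
    if "k \<le> n" for k
    using that
  proof (induction k)
    case 0
    have "M = ?I" if "M \<in> carrier (mat_algebra n A)" "standard 0 M" for M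
      using that by (intro mat_algebra_eqI[of _ n])
        (auto simp: standard_def mat_algebra_index(4) mat_algebra_closed)
    then show ?case
      by (intro exI[of _ "carrier (mat_algebra n A)"])
        (metis Mn.Units_one_closed Mn.one_closed Mn.topspace_frechet openin_topspace)
  next
    case (Suc k)
    then obtain U where U: "openin ?T U" "?I \<in> U"
      and stdU: "\<And>M. \<lbrakk>M \<in> U; standard k M\<rbrakk> \<Longrightarrow> M \<in> Units (mat_algebra n A)"
      by auto
    have k: "k < n"
      using Suc by simp
    \<comment> \<open>Elimination of column \<open>k\<close> is possible on \<open>D\<close>.
      Openness of the units of \<open>A\<close> makes \<open>D\<close> open, and continuity of
      inversion in \<open>A\<close> makes \<open>eliminate n k\<close> continuous on it.\<close>
    define D where "D = {M \<in> topspace ?T. M $$ (k, k) \<in> Units A}"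
    have D: "openin ?T D"
      unfolding D_def by (rule openin_continuous_map_preimage[OF continuous_map_mat_index[OF k k] open_Units])
    have idx: "continuous_map (subtopology ?T D) (frechet_topology A) (\<lambda>M. M $$ (i, j))"
      if "i < n" "j < n" for i j
      using that by (intro continuous_map_from_subtopology continuous_map_mat_index)
    have "continuous_map (subtopology ?T D) (subtopology (frechet_topology A) (Units A)) (\<lambda>M. M $$ (k, k))"
      using idx k by (auto simp: continuous_map_in_subtopology D_def)
    then have "continuous_map (subtopology ?T D) (frechet_topology A) (m_inv A \<circ> (\<lambda>M. M $$ (k, k)))"
      using continuous_inverse by (rule continuous_map_compose)
    then have inv: "continuous_map (subtopology ?T D) (frechet_topology A) (\<lambda>M. inv (M $$ (k, k)))"
      by (simp add: o_def)
    have E: "continuous_map (subtopology ?T D) ?T (eliminate n k)"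
      unfolding continuous_map_mat_iff
    proof (intro conjI allI impI)
      show "eliminate n k \<in> topspace (subtopology ?T D) \<rightarrow> carrier (mat_algebra n A)"
        using k eliminate_closed by (auto simp: D_def)
      fix i j assume ij: "i < n" "j < n"
      show "continuous_map (subtopology ?T D) (frechet_topology A) (\<lambda>M. eliminate n k M $$ (i, j))"
        using ij k unfolding eliminate_def
        by (cases "i = k") (auto intro!: continuous_map_frechet_mult continuous_map_frechet_diff inv idx)
    qed
    let ?U = "{M \<in> topspace (subtopology ?T D). eliminate n k M \<in> U}"
    have "openin (subtopology ?T D) ?U"
      using E U(1) by (rule openin_continuous_map_preimage)
    then have "openin ?T ?U"
      using D openin_trans_full by blast
    \<comment> \<open>Elimination fixes the unit matrix, so the preimage of a neighbourhood of it is
      again one.\<close>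
    moreover have "eliminate n k ?I = ?I"
      using k by (intro mat_algebra_eqI[of _ n] eliminate_closed)
        (auto simp: eliminate_def mat_algebra_index(4) mat_algebra_closed a_minus_def)
    then have "?I \<in> ?U"
      using U(2) k by (auto simp: D_def mat_algebra_index(4))
    moreover have "M \<in> Units (mat_algebra n A)" if M: "M \<in> ?U" and std: "standard (Suc k) M" for M
    proof -
      have Mc: "M \<in> carrier (mat_algebra n A)" and Mk: "M $$ (k, k) \<in> Units A"
        using M by (auto simp: D_def)
      note C = mat_carrierD(3)[OF Mc] Units_inv_closed[OF Mk]
      have "eliminate n k M $$ (i, j) = (if i = j then \<one> else \<zero>)" if "k \<le> j" "j < n" "i < n" for i j
      proof (cases "j = k")
        case True
        then show ?thesis
          using that k C Mk by (auto simp: eliminate_def)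
      next
        case False
        \<comment> \<open>A column to the right of \<open>k\<close> is already standard and has zero
          in row \<open>k\<close>, so elimination leaves it as it is.\<close>
        then have "M $$ (l, j) = (if l = j then \<one> else \<zero>)" if "l < n" for l
          using std that \<open>k \<le> j\<close> \<open>j < n\<close> by (auto simp: standard_def)
        then show ?thesis
          using that k C False by (auto simp: eliminate_def a_minus_def)
      qed
      then have "standard k (eliminate n k M)"
        by (auto simp: standard_def)
      then have "eliminate n k M \<in> Units (mat_algebra n A)"
        using M stdU by blast
      moreover have "column_mat n k (\<lambda>i. M $$ (i, k)) \<in> Units (mat_algebra n A)"
        using C k Mk by (intro column_mat_Units) auto
      ultimately show ?thesis
        using eliminate_factor[OF Mc k Mk] Mn.Units_m_closed by metis
    qed
    ultimately show ?case
      by blast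
  qed
  \<comment> \<open>At \<open>k = n\<close> no column is constrained, so the induction has reached
    all matrices near the unit.\<close>
  moreover have "standard n M" for M
    by (auto simp: standard_def)
  ultimately obtain U where "openin ?T U" "?I \<in> U" "U \<subseteq> Units (mat_algebra n A)"
    by (metis order_refl subsetI)
  then show ?thesis
    by (rule Mn.openin_Units_if_nhd_one)
qed

end

section \<open>Block sums and permutations\<close>

text \<open>The complements of \<open>{..<p}\<close> and of its image in \<open>{..<q}\<close> have
  equal size, so any bijection between them completes \<open>f\<close>. This turns embeddings of
  blocks into permutations of indices.\<close>

lemma extend_injection_to_permutation:
  assumes f: "inj_on f {..<p}" "f ` {..<p} \<subseteq> {..<q}"
  obtains \<sigma> where "\<sigma> permutes {..<q::nat}" "\<And>i. i < p \<Longrightarrow> \<sigma> i = f i"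
proof -
  have "card {..<p} \<le> card {..<q}"
    by (rule card_inj_on_le[OF f]) simp
  then have "p \<le> q"
    by simp
  have "card ({..<q} - f ` {..<p}) = card {..<q} - card (f ` {..<p})"
    by (rule card_Diff_subset[OF _ f(2)]) simp
  then have "card {p..<q} = card ({..<q} - f ` {..<p})"
    by (simp add: card_image[OF f(1)])
  then obtain h where h: "bij_betw h {p..<q} ({..<q} - f ` {..<p})"
    using finite_same_card_bij[OF finite_atLeastLessThan finite_Diff[OF finite_lessThan]] by metis
  define \<sigma> where "\<sigma> i = (if i < p then f i else if i < q then h i else i)" for i
  have "bij_betw \<sigma> {..<p} (f ` {..<p}) \<longleftrightarrow> bij_betw f {..<p} (f ` {..<p})"
    by (rule bij_betw_cong) (simp add: \<sigma>_def)
  then have "bij_betw \<sigma> {..<p} (f ` {..<p})"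
    using inj_on_imp_bij_betw[OF f(1)] by (rule iffD2)
  moreover have "bij_betw \<sigma> {p..<q} ({..<q} - f ` {..<p}) \<longleftrightarrow> bij_betw h {p..<q} ({..<q} - f ` {..<p})"
    by (rule bij_betw_cong) (simp add: \<sigma>_def)
  then have "bij_betw \<sigma> {p..<q} ({..<q} - f ` {..<p})"
    using h by (rule iffD2)
  ultimately have "bij_betw \<sigma> ({..<p} \<union> {p..<q}) (f ` {..<p} \<union> ({..<q} - f ` {..<p}))"
    by (rule bij_betw_combine) auto
  moreover have "{..<p} \<union> {p..<q} = {..<q}"
    using \<open>p \<le> q\<close> by auto
  moreover have "f ` {..<p} \<union> ({..<q} - f ` {..<p}) = {..<q}"
    using f(2) by blast
  ultimately have "bij_betw \<sigma> {..<q} {..<q}"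
    by (simp only:)
  then have "\<sigma> permutes {..<q}"
    by (rule bij_imp_permutes) (use \<open>p \<le> q\<close> in \<open>simp add: \<sigma>_def\<close>)
  then show thesis
    by (rule that) (simp add: \<sigma>_def)
qed

context seminormed_algebra
begin

lemma finsum_split:
  fixes p q :: nat
  assumes "\<And>k. k < p + q \<Longrightarrow> f k \<in> carrier A"
  shows "(\<Oplus>k\<in>{..<p + q}. f k) = (\<Oplus>k\<in>{..<p}. f k) \<oplus> (\<Oplus>k\<in>{..<q}. f (p + k))"
  using assms
proof (induction q)
  case 0
  then show ?case
    by (simp add: M.finsum_closed)
next
  case (Suc q)
  have C: "f \<in> {..<p} \<rightarrow> carrier A" "f \<in> {..<p + q} \<rightarrow> carrier A"
    "(\<lambda>k. f (p + k)) \<in> {..<q} \<rightarrow> carrier A" "f (p + q) \<in> carrier A"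
    using Suc.prems by auto
  have "(\<Oplus>k\<in>{..<p + Suc q}. f k) = f (p + q) \<oplus> (\<Oplus>k\<in>{..<p + q}. f k)"
    using C by (simp add: lessThan_Suc M.finsum_insert)
  also have "\<dots> = (\<Oplus>k\<in>{..<p}. f k) \<oplus> (f (p + q) \<oplus> (\<Oplus>k\<in>{..<q}. f (p + k)))"
    using C Suc by (simp add: M.a_ac M.finsum_closed)
  also have "f (p + q) \<oplus> (\<Oplus>k\<in>{..<q}. f (p + k)) = (\<Oplus>k\<in>{..<Suc q}. f (p + k))"
    using C by (simp add: lessThan_Suc M.finsum_insert)
  finally show ?case .
qed

lemma finsum_neutral: "(\<And>k. k \<in> S \<Longrightarrow> f k = \<zero>) \<Longrightarrow> (\<Oplus>k\<in>S. f k) = \<zero>"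
  by (rule M.add.finprod_one_eqI)

text \<open>A scalar outside \<Omega> is nonzero, so \<open>c \<odot> \<one>\<close> is a unit. This
  is what allows padding by zero blocks.\<close>

lemma zero_spectral_part: "0 \<in> \<Omega> \<Longrightarrow> \<zero> \<in> spectral_part \<Omega> A"
  by (auto simp: spectral_part_iff a_minus_def intro!: Units_scal)

section \<open>Block sums\<close>

lemma diag_block_dims:
  "dim_row (diag_block A a b) = dim_row a + dim_row b"
  "dim_col (diag_block A a b) = dim_col a + dim_col b"
  by (simp_all add: diag_block_def)

lemma diag_block_index:
  assumes "a \<in> carrier (mat_algebra p A)" "b \<in> carrier (mat_algebra q A)" "i < p + q" "j < p + q"
  shows "diag_block A a b $$ (i, j) =
    (if i < p \<and> j < p then a $$ (i, j) else if p \<le> i \<and> p \<le> j then b $$ (i - p, j - p) else \<zero>)"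
  using assms by (auto simp: diag_block_def carrier_mat_algebra)

lemma diag_block_closed:
  assumes "a \<in> carrier (mat_algebra p A)" "b \<in> carrier (mat_algebra q A)"
  shows "diag_block A a b \<in> carrier (mat_algebra (p + q) A)"
  using assms by (auto simp: carrier_mat_algebra diag_block_dims diag_block_index[OF assms])

lemma diag_block_mult:
  assumes a: "a \<in> carrier (mat_algebra p A)" "a' \<in> carrier (mat_algebra p A)"
    and b: "b \<in> carrier (mat_algebra q A)" "b' \<in> carrier (mat_algebra q A)"
  shows "diag_block A a b \<otimes>\<^bsub>mat_algebra (p + q) A\<^esub> diag_block A a' b'
    = diag_block A (a \<otimes>\<^bsub>mat_algebra p A\<^esub> a') (b \<otimes>\<^bsub>mat_algebra q A\<^esub> b')"
proof (rule mat_algebra_eqI[of _ "p + q"])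
  fix i j assume ij: "i < p + q" "j < p + q"
  note C = mat_carrierD(3)[OF a(1)] mat_carrierD(3)[OF a(2)] mat_carrierD(3)[OF b(1)] mat_carrierD(3)[OF b(2)]
  note D = diag_block_closed[OF a(1) b(1)] diag_block_closed[OF a(2) b(2)]
  let ?f = "\<lambda>k. diag_block A a b $$ (i, k) \<otimes> diag_block A a' b' $$ (k, j)"
  have "(\<Oplus>k\<in>{..<p + q}. ?f k) = (\<Oplus>k\<in>{..<p}. ?f k) \<oplus> (\<Oplus>k\<in>{..<q}. ?f (p + k))"
    using ij mat_carrierD(3)[OF D(1)] mat_carrierD(3)[OF D(2)] by (intro finsum_split) auto
  moreover have "(\<Oplus>k\<in>{..<p}. ?f k)
      = (if i < p \<and> j < p then \<Oplus>k\<in>{..<p}. a $$ (i, k) \<otimes> a' $$ (k, j) else \<zero>)"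
  proof (cases "i < p \<and> j < p")
    case True
    then show ?thesis
      using C ij by (auto intro!: M.finsum_cong' simp: diag_block_index[OF a(1) b(1)] diag_block_index[OF a(2) b(2)])
  next
    case False
    then have "(\<Oplus>k\<in>{..<p}. ?f k) = \<zero>"
      using C ij by (intro finsum_neutral)
        (auto simp: diag_block_index[OF a(1) b(1)] diag_block_index[OF a(2) b(2)])
    then show ?thesis
      using False by auto
  qed
  moreover have "(\<Oplus>k\<in>{..<q}. ?f (p + k))
      = (if p \<le> i \<and> p \<le> j then \<Oplus>k\<in>{..<q}. b $$ (i - p, k) \<otimes> b' $$ (k, j - p) else \<zero>)"
  proof (cases "p \<le> i \<and> p \<le> j")
    case True
    moreover from this have "i - p < q" "j - p < q"
      using ij by auto
    ultimately show ?thesis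
      using C ij by (auto intro!: M.finsum_cong' simp: diag_block_index[OF a(1) b(1)] diag_block_index[OF a(2) b(2)])
  next
    case False
    then have "(\<Oplus>k\<in>{..<q}. ?f (p + k)) = \<zero>"
      using C ij by (intro finsum_neutral)
        (auto simp: diag_block_index[OF a(1) b(1)] diag_block_index[OF a(2) b(2)])
    then show ?thesis
      using False by auto
  qed
  moreover have "(\<Oplus>k\<in>{..<p}. a $$ (i, k) \<otimes> a' $$ (k, j)) \<in> carrier A" if "i < p" "j < p"
    using C that by (auto intro!: M.finsum_closed)
  moreover have "(\<Oplus>k\<in>{..<q}. b $$ (i - p, k) \<otimes> b' $$ (k, j - p)) \<in> carrier A" if "p \<le> i" "p \<le> j"
    using C that ij by (auto intro!: M.finsum_closed)
  ultimately show "(diag_block A a b \<otimes>\<^bsub>mat_algebra (p + q) A\<^esub> diag_block A a' b') $$ (i, j)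
      = diag_block A (a \<otimes>\<^bsub>mat_algebra p A\<^esub> a') (b \<otimes>\<^bsub>mat_algebra q A\<^esub> b') $$ (i, j)"
    using ij
    by (cases "p \<le> i"; cases "p \<le> j")
      (simp_all add: mat_algebra_index(1) diag_block_index[OF mat_algebra_mult_closed[OF a] mat_algebra_mult_closed[OF b]]
        less_diff_conv2)
qed (intro mat_algebra_mult_closed diag_block_closed a b)+

lemma diag_block_one:
  "diag_block A \<one>\<^bsub>mat_algebra p A\<^esub> \<one>\<^bsub>mat_algebra q A\<^esub> = \<one>\<^bsub>mat_algebra (p + q) A\<^esub>"
  by (rule mat_algebra_eqI[of _ "p + q"])
    (auto intro!: diag_block_closed mat_algebra_closed simp: mat_algebra_index
      diag_block_index[OF mat_algebra_closed(3) mat_algebra_closed(3)])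

lemma diag_block_Units:
  assumes a: "a \<in> Units (mat_algebra p A)" and b: "b \<in> Units (mat_algebra q A)"
  shows "diag_block A a b \<in> Units (mat_algebra (p + q) A)"
proof -
  obtain a' where a': "a \<in> carrier (mat_algebra p A)" "a' \<in> carrier (mat_algebra p A)"
    "a' \<otimes>\<^bsub>mat_algebra p A\<^esub> a = \<one>\<^bsub>mat_algebra p A\<^esub>" "a \<otimes>\<^bsub>mat_algebra p A\<^esub> a' = \<one>\<^bsub>mat_algebra p A\<^esub>"
    using a unfolding Units_def by blast
  obtain b' where b': "b \<in> carrier (mat_algebra q A)" "b' \<in> carrier (mat_algebra q A)"
    "b' \<otimes>\<^bsub>mat_algebra q A\<^esub> b = \<one>\<^bsub>mat_algebra q A\<^esub>" "b \<otimes>\<^bsub>mat_algebra q A\<^esub> b' = \<one>\<^bsub>mat_algebra q A\<^esub>"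
    using b unfolding Units_def by blast
  have "diag_block A a' b' \<otimes>\<^bsub>mat_algebra (p + q) A\<^esub> diag_block A a b = \<one>\<^bsub>mat_algebra (p + q) A\<^esub>"
    "diag_block A a b \<otimes>\<^bsub>mat_algebra (p + q) A\<^esub> diag_block A a' b' = \<one>\<^bsub>mat_algebra (p + q) A\<^esub>"
    using a' b' by (simp_all only: diag_block_mult diag_block_one)
  then show ?thesis
    unfolding Units_def using diag_block_closed[OF a'(1) b'(1)] diag_block_closed[OF a'(2) b'(2)] by blast
qed

text \<open>Subtracting a block sum from a scalar matrix gives the block sum of the differences, and
  block sums of units are units.\<close>

lemma diag_block_spectral_part:
  assumes a: "a \<in> spectral_part \<Omega> (mat_algebra p A)" and b: "b \<in> spectral_part \<Omega> (mat_algebra q A)"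
  shows "diag_block A a b \<in> spectral_part \<Omega> (mat_algebra (p + q) A)"
proof -
  interpret Mp: seminormed_algebra "mat_algebra p A" by (rule mat_algebra_seminormed)
  interpret Mq: seminormed_algebra "mat_algebra q A" by (rule mat_algebra_seminormed)
  interpret Mpq: seminormed_algebra "mat_algebra (p + q) A" by (rule mat_algebra_seminormed)
  have ac: "a \<in> carrier (mat_algebra p A)" and bc: "b \<in> carrier (mat_algebra q A)"
    using a b by (auto simp: Mp.spectral_part_iff Mq.spectral_part_iff)
  note D = diag_block_closed[OF ac bc]
  have "c \<odot>\<^bsub>mat_algebra (p + q) A\<^esub> \<one>\<^bsub>mat_algebra (p + q) A\<^esub> \<ominus>\<^bsub>mat_algebra (p + q) A\<^esub> diag_block A a b
      = diag_block A (c \<odot>\<^bsub>mat_algebra p A\<^esub> \<one>\<^bsub>mat_algebra p A\<^esub> \<ominus>\<^bsub>mat_algebra p A\<^esub> a)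
          (c \<odot>\<^bsub>mat_algebra q A\<^esub> \<one>\<^bsub>mat_algebra q A\<^esub> \<ominus>\<^bsub>mat_algebra q A\<^esub> b)" for c
  proof (rule mat_algebra_eqI[of _ "p + q"])
    have ca: "c \<odot>\<^bsub>mat_algebra p A\<^esub> \<one>\<^bsub>mat_algebra p A\<^esub> \<ominus>\<^bsub>mat_algebra p A\<^esub> a \<in> carrier (mat_algebra p A)"
      and cb: "c \<odot>\<^bsub>mat_algebra q A\<^esub> \<one>\<^bsub>mat_algebra q A\<^esub> \<ominus>\<^bsub>mat_algebra q A\<^esub> b \<in> carrier (mat_algebra q A)"
      using ac bc by auto
    then show "diag_block A (c \<odot>\<^bsub>mat_algebra p A\<^esub> \<one>\<^bsub>mat_algebra p A\<^esub> \<ominus>\<^bsub>mat_algebra p A\<^esub> a)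
          (c \<odot>\<^bsub>mat_algebra q A\<^esub> \<one>\<^bsub>mat_algebra q A\<^esub> \<ominus>\<^bsub>mat_algebra q A\<^esub> b) \<in> carrier (mat_algebra (p + q) A)"
      by (rule diag_block_closed)
    fix i j assume ij: "i < p + q" "j < p + q"
    show "(c \<odot>\<^bsub>mat_algebra (p + q) A\<^esub> \<one>\<^bsub>mat_algebra (p + q) A\<^esub> \<ominus>\<^bsub>mat_algebra (p + q) A\<^esub> diag_block A a b) $$ (i, j)
      = diag_block A (c \<odot>\<^bsub>mat_algebra p A\<^esub> \<one>\<^bsub>mat_algebra p A\<^esub> \<ominus>\<^bsub>mat_algebra p A\<^esub> a)
          (c \<odot>\<^bsub>mat_algebra q A\<^esub> \<one>\<^bsub>mat_algebra q A\<^esub> \<ominus>\<^bsub>mat_algebra q A\<^esub> b) $$ (i, j)"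
      using ij ac bc D
      by (auto simp: mat_algebra_diff_index mat_algebra_closed diag_block_index[OF ca cb]
          diag_block_index[OF ac bc] mat_algebra_index)
  qed (use D in auto)
  then show ?thesis
    using D a b by (auto simp: Mp.spectral_part_iff Mq.spectral_part_iff Mpq.spectral_part_iff
        intro!: diag_block_Units)
qed

text \<open>Both paths run simultaneously; each entry of the result is an entry of \<open>g\<close>,
  an entry of \<open>h\<close> or constantly zero.\<close>

lemma diag_block_spectral_path:
  assumes a: "spectral_path \<Omega> (mat_algebra p A) a a'" and b: "spectral_path \<Omega> (mat_algebra q A) b b'"
  shows "spectral_path \<Omega> (mat_algebra (p + q) A) (diag_block A a b) (diag_block A a' b')"
proof -
  interpret Mp: seminormed_algebra "mat_algebra p A" by (rule mat_algebra_seminormed)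
  interpret Mq: seminormed_algebra "mat_algebra q A" by (rule mat_algebra_seminormed)
  let ?X = "top_of_set {0..1::real}"
  obtain g h where g: "continuous_map ?X (frechet_topology (mat_algebra p A)) g"
      "g \<in> {0..1} \<rightarrow> spectral_part \<Omega> (mat_algebra p A)" "g 0 = a" "g 1 = a'"
    and h: "continuous_map ?X (frechet_topology (mat_algebra q A)) h"
      "h \<in> {0..1} \<rightarrow> spectral_part \<Omega> (mat_algebra q A)" "h 0 = b" "h 1 = b'"
    using a b unfolding path_component_of_set pathin_def continuous_map_in_subtopology
    by (auto simp: image_subset_iff_funcset)
  have gc: "g t \<in> carrier (mat_algebra p A)" and hc: "h t \<in> carrier (mat_algebra q A)"
    if "t \<in> topspace ?X" for t
  proof -
    have t: "t \<in> {0..1}"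
      using that by simp
    show "g t \<in> carrier (mat_algebra p A)"
      using funcset_mem[OF g(2) t] Mp.spectral_part_subset by blast
    show "h t \<in> carrier (mat_algebra q A)"
      using funcset_mem[OF h(2) t] Mq.spectral_part_subset by blast
  qed
  have "continuous_map ?X (frechet_topology (mat_algebra (p + q) A)) (\<lambda>t. diag_block A (g t) (h t))"
    unfolding continuous_map_mat_iff
  proof (intro conjI allI impI)
    show "(\<lambda>t. diag_block A (g t) (h t)) \<in> topspace ?X \<rightarrow> carrier (mat_algebra (p + q) A)"
      using gc hc diag_block_closed by blast
    fix i j assume ij: "i < p + q" "j < p + q"
    have "continuous_map ?X (frechet_topology A) (\<lambda>t.
        if i < p \<and> j < p then g t $$ (i, j) else if p \<le> i \<and> p \<le> j then h t $$ (i - p, j - p) else \<zero>)"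
      using g(1) h(1) ij unfolding continuous_map_mat_iff by auto
    then show "continuous_map ?X (frechet_topology A) (\<lambda>t. diag_block A (g t) (h t) $$ (i, j))"
      by (rule continuous_map_eq) (simp add: diag_block_index[OF gc hc ij])
  qed
  moreover have "(\<lambda>t. diag_block A (g t) (h t)) \<in> {0..1} \<rightarrow> spectral_part \<Omega> (mat_algebra (p + q) A)"
    using g(2) h(2) diag_block_spectral_part by blast
  ultimately have "pathin (subtopology (frechet_topology (mat_algebra (p + q) A))
      (spectral_part \<Omega> (mat_algebra (p + q) A))) (\<lambda>t. diag_block A (g t) (h t))"
    by (auto simp: pathin_def continuous_map_in_subtopology)
  then show ?thesis
    unfolding path_component_of_set using g(3,4) h(3,4)
    by (intro exI[of _ "\<lambda>t. diag_block A (g t) (h t)"]) simp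
qed

section \<open>Padding by zeros\<close>

lemma pad_zero_eq: "dim_row a = p \<Longrightarrow> pad_zero A n a = diag_block A a \<zero>\<^bsub>mat_algebra (n - p) A\<^esub>"
  by (simp add: pad_zero_def mat_algebra_def)

lemma pad_zero_closed:
  assumes "a \<in> carrier (mat_algebra p A)" "p \<le> n"
  shows "pad_zero A n a \<in> carrier (mat_algebra n A)"
  using diag_block_closed[OF assms(1) mat_algebra_closed(4)[of "n - p"]] assms
  by (simp add: pad_zero_eq carrier_mat_algebra)

lemma pad_zero_index:
  assumes "a \<in> carrier (mat_algebra p A)" "p \<le> n" "i < n" "j < n"
  shows "pad_zero A n a $$ (i, j) = (if i < p \<and> j < p then a $$ (i, j) else \<zero>)"
  using assms diag_block_index[OF assms(1) mat_algebra_closed(4)[of "n - p"], of i j]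
  by (auto simp: pad_zero_eq mat_carrierD mat_algebra_index)

lemma pad_zero_self: "a \<in> carrier (mat_algebra n A) \<Longrightarrow> pad_zero A n a = a"
  by (rule mat_algebra_eqI[of _ n]) (auto simp: pad_zero_index pad_zero_closed)

lemma pad_zero_pad_zero:
  assumes a: "a \<in> carrier (mat_algebra p A)" and "p \<le> n" "n \<le> m"
  shows "pad_zero A m (pad_zero A n a) = pad_zero A m a"
  using assms pad_zero_closed[OF a, of n]
  by (intro mat_algebra_eqI[of _ m]) (auto simp: pad_zero_index[where p = n] pad_zero_index[OF a]
      intro: pad_zero_closed)

lemma zero_mat_spectral_part: "0 \<in> \<Omega> \<Longrightarrow> \<zero>\<^bsub>mat_algebra n A\<^esub> \<in> spectral_part \<Omega> (mat_algebra n A)"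
  by (rule seminormed_algebra.zero_spectral_part[OF mat_algebra_seminormed])

text \<open>Padding is the block sum with the constant path at zero, which stays in the spectral
  part since \<open>0 \<in> \<Omega>\<close>.\<close>

lemma pad_zero_spectral_path:
  assumes "0 \<in> \<Omega>" "p \<le> n" and ab: "spectral_path \<Omega> (mat_algebra p A) a b"
  shows "spectral_path \<Omega> (mat_algebra n A) (pad_zero A n a) (pad_zero A n b)"
proof -
  interpret Mp: seminormed_algebra "mat_algebra p A" by (rule mat_algebra_seminormed)
  interpret Mq: seminormed_algebra "mat_algebra (n - p) A" by (rule mat_algebra_seminormed)
  have "dim_row a = p" "dim_row b = p"
    using Mp.spectral_path_carrier[OF ab] Mp.spectral_part_subset mat_carrierD(1) by blast+
  moreover have "p + (n - p) = n"
    using assms by simp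
  ultimately show ?thesis
    using diag_block_spectral_path[OF ab Mq.spectral_path_refl[OF zero_mat_spectral_part], of ] assms
    by (simp add: pad_zero_eq)
qed

lemma pad_zero_spectral_part:
  assumes "0 \<in> \<Omega>" "p \<le> n" and a: "a \<in> spectral_part \<Omega> (mat_algebra p A)"
  shows "pad_zero A n a \<in> spectral_part \<Omega> (mat_algebra n A)"
proof -
  interpret Mp: seminormed_algebra "mat_algebra p A" by (rule mat_algebra_seminormed)
  interpret Mn: seminormed_algebra "mat_algebra n A" by (rule mat_algebra_seminormed)
  show ?thesis
    using Mn.spectral_path_carrier(1)[OF pad_zero_spectral_path[OF assms(1,2) Mp.spectral_path_refl[OF a]]] .
qed

section \<open>Permuting rows and columns\<close>

text \<open>For a permutation \<sigma> of the indices this is conjugation by its permutation matrix,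
  in a form free of products.\<close>

definition reindex_mat :: "nat \<Rightarrow> (nat \<Rightarrow> nat) \<Rightarrow> 'a mat \<Rightarrow> 'a mat"
  where "reindex_mat n \<sigma> M = mat n n (\<lambda>(i, j). M $$ (\<sigma> i, \<sigma> j))"

lemma spectral_path_reindex_involution:
  assumes M: "M \<in> spectral_part \<Omega> (mat_algebra n A)"
    and \<sigma>: "\<And>i. i < n \<Longrightarrow> \<sigma> i < n" "\<And>i. i < n \<Longrightarrow> \<sigma> (\<sigma> i) = i"
  shows "spectral_path \<Omega> (mat_algebra n A) M (reindex_mat n \<sigma> M)"
proof -
  interpret Mn: seminormed_algebra "mat_algebra n A" by (rule mat_algebra_seminormed)
  \<comment> \<open>The permutation matrix of \<sigma>. As \<sigma> is an involution,
    \<open>P\<close> is its own inverse, and the same \<sigma> acts on rows from the left and on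
    columns from the right.\<close>
  define P where "P = mat n n (\<lambda>(i, j). if j = \<sigma> i then \<one> else \<zero>)"
  have P: "P \<in> carrier (mat_algebra n A)"
    by (simp add: P_def carrier_mat_algebra)
  have Mc: "M \<in> carrier (mat_algebra n A)"
    using M Mn.spectral_part_subset by blast
  have left: "(P \<otimes>\<^bsub>mat_algebra n A\<^esub> N) $$ (i, j) = N $$ (\<sigma> i, j)"
    if N: "N \<in> carrier (mat_algebra n A)" and ij: "i < n" "j < n" for N i j
  proof -
    have "(\<Oplus>k\<in>{..<n}. P $$ (i, k) \<otimes> N $$ (k, j)) = P $$ (i, \<sigma> i) \<otimes> N $$ (\<sigma> i, j)"
      using ij \<sigma> mat_carrierD(3)[OF N] mat_carrierD(3)[OF P] by (intro finsum_delta) (auto simp: P_def)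
    then show ?thesis
      using ij \<sigma> mat_carrierD(3)[OF N] by (simp add: mat_algebra_index(1)) (simp add: P_def)
  qed
  have right: "(N \<otimes>\<^bsub>mat_algebra n A\<^esub> P) $$ (i, j) = N $$ (i, \<sigma> j)"
    if N: "N \<in> carrier (mat_algebra n A)" and ij: "i < n" "j < n" for N i j
  proof -
    have "(\<Oplus>k\<in>{..<n}. N $$ (i, k) \<otimes> P $$ (k, j)) = N $$ (i, \<sigma> j) \<otimes> P $$ (\<sigma> j, j)"
      using ij \<sigma> mat_carrierD(3)[OF N] mat_carrierD(3)[OF P] by (intro finsum_delta) (auto simp: P_def)
    then show ?thesis
      using ij \<sigma> mat_carrierD(3)[OF N] by (simp add: mat_algebra_index(1)) (simp add: P_def)
  qed
  have "P \<otimes>\<^bsub>mat_algebra n A\<^esub> P = \<one>\<^bsub>mat_algebra n A\<^esub>"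
  proof (rule mat_algebra_eqI[of _ n])
    fix i j assume ij: "i < n" "j < n"
    then have "P $$ (\<sigma> i, j) = (if i = j then \<one> else \<zero>)"
      using \<sigma> by (auto simp: P_def)
    then show "(P \<otimes>\<^bsub>mat_algebra n A\<^esub> P) $$ (i, j) = \<one>\<^bsub>mat_algebra n A\<^esub> $$ (i, j)"
      using ij by (simp add: left[OF P] mat_algebra_index(4))
  qed (use P in \<open>auto simp: mat_algebra_closed\<close>)
  moreover have "P \<otimes>\<^bsub>mat_algebra n A\<^esub> M \<otimes>\<^bsub>mat_algebra n A\<^esub> P = reindex_mat n \<sigma> M"
    using P Mc \<sigma> mat_carrierD(3)[OF Mc]
    by (intro mat_algebra_eqI[of _ n]) (auto simp: left right reindex_mat_def carrier_mat_algebra[of "mat n n _"])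
  ultimately show ?thesis
    using Mn.spectral_path_involution[OF M P] by simp
qed

text \<open>A general permutation matrix is not an involution, but permutations are products of
  transpositions, and these are; the paths are concatenated along the induction.\<close>

lemma spectral_path_reindex:
  assumes "\<sigma> permutes {..<n}" and "M \<in> spectral_part \<Omega> (mat_algebra n A)"
  shows "spectral_path \<Omega> (mat_algebra n A) M (reindex_mat n \<sigma> M)"
  using assms(1) finite_lessThan[of n] assms(2)
proof (induction \<sigma> arbitrary: M rule: permutes_induct)
  case id
  interpret Mn: seminormed_algebra "mat_algebra n A" by (rule mat_algebra_seminormed)
  have eq: "reindex_mat n id M = M"
    using id Mn.spectral_part_subset[of \<Omega>]
    by (intro mat_algebra_eqI[of _ n]) (auto simp: reindex_mat_def carrier_mat_algebra)
  show ?case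
    unfolding eq using id by (rule Mn.spectral_path_refl)
next
  case (swap a b p)
  interpret Mn: seminormed_algebra "mat_algebra n A" by (rule mat_algebra_seminormed)
  let ?t = "Transposition.transpose a b"
  have t: "spectral_path \<Omega> (mat_algebra n A) M (reindex_mat n ?t M)"
    using swap by (intro spectral_path_reindex_involution) (auto simp: Transposition.transpose_def)
  have "spectral_path \<Omega> (mat_algebra n A) (reindex_mat n ?t M) (reindex_mat n p (reindex_mat n ?t M))"
    using swap Mn.spectral_path_carrier[OF t] by blast
  \<comment> \<open>Reindexing reverses composition: reading the entry at \<open>p i\<close> of the
    matrix reindexed by \<open>?t\<close> gives the original entry at
    \<open>?t (p i)\<close>.\<close>
  moreover have "reindex_mat n p (reindex_mat n ?t M) = reindex_mat n (?t \<circ> p) M"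
  proof (rule eq_matI)
    fix i j assume "i < dim_row (reindex_mat n (?t \<circ> p) M)" "j < dim_col (reindex_mat n (?t \<circ> p) M)"
    then have "i < n" "j < n"
      by (simp_all add: reindex_mat_def)
    moreover from this have "p i < n" "p j < n"
      using permutes_in_image[OF \<open>p permutes {..<n}\<close>] by blast+
    ultimately show "reindex_mat n p (reindex_mat n ?t M) $$ (i, j) = reindex_mat n (?t \<circ> p) M $$ (i, j)"
      by (simp add: reindex_mat_def)
  qed (simp_all add: reindex_mat_def)
  ultimately show ?case
    using path_component_of_trans[OF t] by (simp only:)
qed

end

section \<open>The equivalence relation on spectral matrices\<close>

locale spectral_algebra = seminormed_algebra +
  fixes \<Omega> :: "complex set"
  assumes zero_in_domain: "0 \<in> \<Omega>"
begin

lemma V_set_iff: "a \<in> V_set \<Omega> A \<longleftrightarrow> 1 \<le> dim_row a \<and> a \<in> spectral_part \<Omega> (mat_algebra (dim_row a) A)"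
  by (auto simp: V_set_def spectral_part_def carrier_mat_algebra)

lemma V_setE:
  assumes "a \<in> V_set \<Omega> A"
  obtains p where "1 \<le> p" "dim_row a = p" "a \<in> spectral_part \<Omega> (mat_algebra p A)"
    "a \<in> carrier (mat_algebra p A)"
  using assms by (auto simp: V_set_iff spectral_part_def)

lemma V_setI: "\<lbrakk>1 \<le> p; a \<in> spectral_part \<Omega> (mat_algebra p A)\<rbrakk> \<Longrightarrow> a \<in> V_set \<Omega> A"
  by (auto simp: V_set_def)

text \<open>Explicit paths become path components, whose symmetry and transitivity are
  known.\<close>

lemma V_rel_iff:
  "(a, b) \<in> V_rel \<Omega> A \<longleftrightarrow> a \<in> V_set \<Omega> A \<and> b \<in> V_set \<Omega> A \<and>
     (\<exists>n. dim_row a \<le> n \<and> dim_row b \<le> n \<and>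
        spectral_path \<Omega> (mat_algebra n A) (pad_zero A n a) (pad_zero A n b))"
  by (auto simp: V_rel_def path_component_of_set)

lemma spectral_path_V_rel:
  assumes "1 \<le> n" and ab: "spectral_path \<Omega> (mat_algebra n A) a b"
  shows "(a, b) \<in> V_rel \<Omega> A"
proof -
  interpret Mn: seminormed_algebra "mat_algebra n A" by (rule mat_algebra_seminormed)
  have a: "a \<in> spectral_part \<Omega> (mat_algebra n A)" "b \<in> spectral_part \<Omega> (mat_algebra n A)"
    using Mn.spectral_path_carrier[OF ab] by auto
  moreover have "a \<in> carrier (mat_algebra n A)" "b \<in> carrier (mat_algebra n A)"
    using a Mn.spectral_part_subset by auto
  ultimately show ?thesis
    using V_setI[OF assms(1)] ab mat_carrierD(1) unfolding V_rel_iff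
    by (auto simp: pad_zero_self intro!: exI[of _ n])
qed

text \<open>Once joined, two matrices stay joined at all larger sizes. Transitivity needs this, as
  its two paths may live at different sizes.\<close>

lemma V_rel_path_mono:
  assumes a: "a \<in> V_set \<Omega> A" "b \<in> V_set \<Omega> A" and n: "dim_row a \<le> n" "dim_row b \<le> n" "n \<le> m"
    and ab: "spectral_path \<Omega> (mat_algebra n A) (pad_zero A n a) (pad_zero A n b)"
  shows "spectral_path \<Omega> (mat_algebra m A) (pad_zero A m a) (pad_zero A m b)"
proof -
  have "a \<in> carrier (mat_algebra (dim_row a) A)" "b \<in> carrier (mat_algebra (dim_row b) A)"
    using a V_setE by metis+
  then show ?thesis
    using pad_zero_spectral_path[OF zero_in_domain n(3) ab] pad_zero_pad_zero n by simp
qed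

lemma equiv_V_rel: "equiv (V_set \<Omega> A) (V_rel \<Omega> A)"
proof (rule equivI)
  show "V_rel \<Omega> A \<subseteq> V_set \<Omega> A \<times> V_set \<Omega> A"
    by (auto simp: V_rel_iff)
  show "refl_on (V_set \<Omega> A) (V_rel \<Omega> A)"
  proof (rule refl_onI)
    fix a assume "a \<in> V_set \<Omega> A"
    then obtain p where p: "1 \<le> p" "a \<in> spectral_part \<Omega> (mat_algebra p A)"
      by (rule V_setE)
    interpret Mp: seminormed_algebra "mat_algebra p A" by (rule mat_algebra_seminormed)
    show "(a, a) \<in> V_rel \<Omega> A"
      using p by (intro spectral_path_V_rel[of p] Mp.spectral_path_refl)
  qed
  show "sym (V_rel \<Omega> A)"
  proof (rule symI)
    fix a b assume ab: "(a, b) \<in> V_rel \<Omega> A"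
    then obtain n where n: "dim_row a \<le> n" "dim_row b \<le> n"
      "spectral_path \<Omega> (mat_algebra n A) (pad_zero A n a) (pad_zero A n b)"
      unfolding V_rel_iff by blast
    then show "(b, a) \<in> V_rel \<Omega> A"
      using ab path_component_of_sym[OF n(3)] unfolding V_rel_iff by blast
  qed
  show "trans (V_rel \<Omega> A)"
  proof (rule transI)
    fix a b c assume ab: "(a, b) \<in> V_rel \<Omega> A" and bc: "(b, c) \<in> V_rel \<Omega> A"
    obtain n m where n: "dim_row a \<le> n" "dim_row b \<le> n" "spectral_path \<Omega> (mat_algebra n A) (pad_zero A n a) (pad_zero A n b)"
      and m: "dim_row b \<le> m" "dim_row c \<le> m" "spectral_path \<Omega> (mat_algebra m A) (pad_zero A m b) (pad_zero A m c)"
      using ab bc unfolding V_rel_iff by blast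
    have V: "a \<in> V_set \<Omega> A" "b \<in> V_set \<Omega> A" "c \<in> V_set \<Omega> A"
      using ab bc by (auto simp: V_rel_iff)
    have "spectral_path \<Omega> (mat_algebra (max n m) A) (pad_zero A (max n m) a) (pad_zero A (max n m) c)"
      using path_component_of_trans[OF V_rel_path_mono[OF V(1,2) n(1,2) _ n(3)] V_rel_path_mono[OF V(2,3) m(1,2) _ m(3)]]
      by simp
    moreover have "dim_row a \<le> max n m" "dim_row c \<le> max n m"
      using n(1) m(2) by auto
    ultimately show "(a, c) \<in> V_rel \<Omega> A"
      using V(1,3) unfolding V_rel_iff by blast
  qed
qed

lemma V_rel_sym: "(a, b) \<in> V_rel \<Omega> A \<Longrightarrow> (b, a) \<in> V_rel \<Omega> A"
  using equiv_V_rel by (meson equivE symD)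

lemma V_rel_trans: "\<lbrakk>(a, b) \<in> V_rel \<Omega> A; (b, c) \<in> V_rel \<Omega> A\<rbrakk> \<Longrightarrow> (a, c) \<in> V_rel \<Omega> A"
  using equiv_V_rel by (meson equivE transD)

text \<open>Completing \<open>f\<close> to a permutation carries the padded \<open>M\<close> to
  \<open>N\<close>, and permuting indices is realised by a path. Exchanging blocks, opening gaps of
  zeros and adding a leading zero are all instances. That \<open>N\<close> lies in the spectral part
  is part of the conclusion.\<close>

lemma V_rel_reindex:
  assumes "1 \<le> p" and M: "M \<in> spectral_part \<Omega> (mat_algebra p A)" and N: "N \<in> carrier (mat_algebra q A)"
    and f: "inj_on f {..<p}" "f ` {..<p} \<subseteq> {..<q}"
    and MN: "\<And>i j. \<lbrakk>i < p; j < p\<rbrakk> \<Longrightarrow> N $$ (f i, f j) = M $$ (i, j)"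
    and N0: "\<And>k l. \<lbrakk>k < q; l < q; k \<notin> f ` {..<p} \<or> l \<notin> f ` {..<p}\<rbrakk> \<Longrightarrow> N $$ (k, l) = \<zero>"
  shows "(M, N) \<in> V_rel \<Omega> A"
proof -
  interpret Mp: seminormed_algebra "mat_algebra p A" by (rule mat_algebra_seminormed)
  interpret Mq: seminormed_algebra "mat_algebra q A" by (rule mat_algebra_seminormed)
  have Mc: "M \<in> carrier (mat_algebra p A)"
    using M Mp.spectral_part_subset by blast
  have "card {..<p} \<le> card {..<q}"
    using f by (intro card_inj_on_le[of f]) auto
  then have pq: "p \<le> q"
    by simp
  obtain \<tau> where \<tau>: "\<tau> permutes {..<q}" "\<And>i. i < p \<Longrightarrow> \<tau> i = f i"
    using extend_injection_to_permutation[OF f] by blast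
  \<comment> \<open>\<open>reindex_mat\<close> looks entries up backwards: the entry at
    \<open>f i\<close> has to come from \<open>i\<close>, hence the inverse of the completed
    permutation.\<close>
  define \<sigma> where "\<sigma> = inv_into UNIV \<tau>"
  have \<sigma>: "\<sigma> permutes {..<q}"
    using \<tau> by (simp add: \<sigma>_def permutes_inv)
  have \<tau>\<sigma>: "\<tau> (\<sigma> k) = k" for k
    using \<tau>(1) by (simp add: \<sigma>_def permutes_inverses)
  have \<sigma>\<tau>: "\<sigma> (\<tau> k) = k" for k
    using \<tau>(1) by (simp add: \<sigma>_def permutes_inverses)
  have \<sigma>f: "\<sigma> (f i) = i" if "i < p" for i
    using \<sigma>\<tau>[of i] \<tau>(2)[OF that] by simp
  have \<sigma>_less: "k \<in> f ` {..<p}" if "\<sigma> k < p" for k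
    using \<tau>\<sigma>[of k] \<tau>(2)[OF that] that by force
  have "reindex_mat q \<sigma> (pad_zero A q M) = N"
  proof (rule mat_algebra_eqI[of _ q])
    fix k l assume kl: "k < q" "l < q"
    have s: "\<sigma> k < q" "\<sigma> l < q"
      using \<sigma> kl permutes_in_image by fastforce+
    show "reindex_mat q \<sigma> (pad_zero A q M) $$ (k, l) = N $$ (k, l)"
    proof (cases "k \<in> f ` {..<p} \<and> l \<in> f ` {..<p}")
      case True
      then obtain i j where "i < p" "j < p" "k = f i" "l = f j"
        by auto
      then show ?thesis
        using kl MN \<sigma>f pq by (simp add: reindex_mat_def pad_zero_index[OF Mc pq])
    next
      case False
      then have "\<not> (\<sigma> k < p \<and> \<sigma> l < p)"
        using \<sigma>_less by blast
      then show ?thesis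
        using kl s N0[OF kl] False by (auto simp: reindex_mat_def pad_zero_index[OF Mc pq])
    qed
  next
    show "reindex_mat q \<sigma> (pad_zero A q M) \<in> carrier (mat_algebra q A)"
      using pad_zero_closed[OF Mc pq] permutes_in_image[OF \<sigma>]
      by (auto simp: reindex_mat_def carrier_mat_algebra)
  qed (rule N)
  moreover have "spectral_path \<Omega> (mat_algebra q A) (pad_zero A q M) (reindex_mat q \<sigma> (pad_zero A q M))"
    using pad_zero_spectral_part[OF zero_in_domain pq M] by (intro spectral_path_reindex \<sigma>)
  ultimately have path: "spectral_path \<Omega> (mat_algebra q A) (pad_zero A q M) N"
    by simp
  then have "N \<in> spectral_part \<Omega> (mat_algebra q A)"
    using Mq.spectral_path_carrier by blast
  then have "N \<in> V_set \<Omega> A"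
    using assms(1) pq by (intro V_setI[of q]) auto
  moreover have "dim_row M \<le> q" "dim_row N \<le> q"
    using mat_carrierD(1)[OF Mc] mat_carrierD(1)[OF N] pq by auto
  moreover have "spectral_path \<Omega> (mat_algebra q A) (pad_zero A q M) (pad_zero A q N)"
    using path by (simp only: pad_zero_self[OF N])
  ultimately show ?thesis
    using V_setI[OF assms(1) M] unfolding V_rel_iff by blast
qed

end

section \<open>The monoids and their Grothendieck groups\<close>

context spectral_algebra
begin

section \<open>Block sum up to equivalence\<close>

lemma diag_block_V_set:
  assumes "a \<in> V_set \<Omega> A" "b \<in> V_set \<Omega> A"
  shows "diag_block A a b \<in> V_set \<Omega> A"
proof -
  obtain p q where "1 \<le> p" "a \<in> spectral_part \<Omega> (mat_algebra p A)" "b \<in> spectral_part \<Omega> (mat_algebra q A)"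
    using assms V_setE by metis
  then show ?thesis
    by (intro V_setI[of "p + q"] diag_block_spectral_part) auto
qed

lemma diag_block_commute:
  assumes "a \<in> V_set \<Omega> A" "b \<in> V_set \<Omega> A"
  shows "(diag_block A a b, diag_block A b a) \<in> V_rel \<Omega> A"
proof -
  obtain p where p: "1 \<le> p" "a \<in> spectral_part \<Omega> (mat_algebra p A)" "a \<in> carrier (mat_algebra p A)"
    using assms V_setE by metis
  obtain q where q: "1 \<le> q" "b \<in> spectral_part \<Omega> (mat_algebra q A)" "b \<in> carrier (mat_algebra q A)"
    using assms V_setE by metis
  \<comment> \<open>The indices of \<open>a\<close> move behind the \<open>q\<close> indices of
    \<open>b\<close>, which move to the front. The map is onto, so no further entries have to
    vanish.\<close>
  define f where "f i = (if i < p then i + q else i - p)" for i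
  have f: "inj_on f {..<p + q}" "f ` {..<p + q} \<subseteq> {..<q + p}"
    by (auto simp: inj_on_def f_def split: if_splits)
  have surj: "k \<in> f ` {..<p + q}" if "k < q + p" for k
    using that by (intro image_eqI[of _ _ "if k < q then k + p else k - q"]) (auto simp: f_def)
  show ?thesis
  proof (rule V_rel_reindex[OF _ diag_block_spectral_part[OF p(2) q(2)] diag_block_closed[OF q(3) p(3)] f])
    show "1 \<le> p + q"
      using p by simp
    fix i j assume ij: "i < p + q" "j < p + q"
    then have fij: "f i < q + p" "f j < q + p"
      using f(2) by auto
    show "diag_block A b a $$ (f i, f j) = diag_block A a b $$ (i, j)"
      unfolding diag_block_index[OF q(3) p(3) fij] diag_block_index[OF p(3) q(3) ij]
      using ij by (auto simp: f_def)
  next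
    fix k l assume "k < q + p" "l < q + p" "k \<notin> f ` {..<p + q} \<or> l \<notin> f ` {..<p + q}"
    then show "diag_block A b a $$ (k, l) = \<zero>"
      using surj by blast
  qed
qed

text \<open>Padding each summand opens a gap of zeros between the blocks, which is a reindexing. It
  lets a block sum be compared at sizes where paths between the summands exist.\<close>

lemma diag_block_pad_zero:
  assumes a: "a \<in> V_set \<Omega> A" and b: "b \<in> V_set \<Omega> A" and n: "dim_row a \<le> n" "dim_row b \<le> m"
  shows "(diag_block A a b, diag_block A (pad_zero A n a) (pad_zero A m b)) \<in> V_rel \<Omega> A"
proof -
  obtain p where p: "1 \<le> p" "dim_row a = p" "a \<in> spectral_part \<Omega> (mat_algebra p A)" "a \<in> carrier (mat_algebra p A)"
    using a by (rule V_setE)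
  obtain q where q: "1 \<le> q" "dim_row b = q" "b \<in> spectral_part \<Omega> (mat_algebra q A)" "b \<in> carrier (mat_algebra q A)"
    using b by (rule V_setE)
  have pn: "p \<le> n" and qm: "q \<le> m"
    using n p q by auto
  note pc = pad_zero_closed[OF p(4) pn] and qc = pad_zero_closed[OF q(4) qm]
  \<comment> \<open>The indices of \<open>a\<close> stay, those of \<open>b\<close> start at
    \<open>n\<close>, behind the padded first summand; the zeros from \<open>p\<close> to
    \<open>n\<close> and from \<open>n + q\<close> on are skipped.\<close>
  define f where "f i = (if i < p then i else i - p + n)" for i
  have f: "inj_on f {..<p + q}" "f ` {..<p + q} \<subseteq> {..<n + m}"
    using pn qm by (auto simp: inj_on_def f_def split: if_splits)
  have range: "k \<in> f ` {..<p + q}" if "k < p \<or> n \<le> k \<and> k < n + q" for k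
    using that pn by (intro image_eqI[of _ _ "if k < p then k else k - n + p"]) (auto simp: f_def)
  show ?thesis
  proof (rule V_rel_reindex[OF _ diag_block_spectral_part[OF p(3) q(3)] diag_block_closed[OF pc qc] f])
    show "1 \<le> p + q"
      using p by simp
    fix i j assume ij: "i < p + q" "j < p + q"
    then have fij: "f i < n + m" "f j < n + m"
      using f(2) by auto
    show "diag_block A (pad_zero A n a) (pad_zero A m b) $$ (f i, f j) = diag_block A a b $$ (i, j)"
      unfolding diag_block_index[OF pc qc fij] diag_block_index[OF p(4) q(4) ij]
      using ij pn qm by (auto simp: f_def pad_zero_index[OF p(4) pn] pad_zero_index[OF q(4) qm])
  next
    fix k l assume kl: "k < n + m" "l < n + m" "k \<notin> f ` {..<p + q} \<or> l \<notin> f ` {..<p + q}"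
    then have "\<not> ((k < p \<or> n \<le> k \<and> k < n + q) \<and> (l < p \<or> n \<le> l \<and> l < n + q))"
      using range by blast
    then show "diag_block A (pad_zero A n a) (pad_zero A m b) $$ (k, l) = \<zero>"
      unfolding diag_block_index[OF pc qc kl(1,2)]
      using kl(1,2) pn qm by (auto simp: pad_zero_index[OF p(4) pn] pad_zero_index[OF q(4) qm])
  qed
qed

text \<open>Each pair is padded to its own size at which a path exists, and the block sum of the two
  paths joins the padded sums; the padding is then removed at both ends.\<close>

lemma diag_block_cong:
  assumes a: "(a, a') \<in> V_rel \<Omega> A" and b: "(b, b') \<in> V_rel \<Omega> A"
  shows "(diag_block A a b, diag_block A a' b') \<in> V_rel \<Omega> A"
proof -
  obtain n where n: "dim_row a \<le> n" "dim_row a' \<le> n"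
    "spectral_path \<Omega> (mat_algebra n A) (pad_zero A n a) (pad_zero A n a')"
    using a unfolding V_rel_iff by blast
  obtain m where m: "dim_row b \<le> m" "dim_row b' \<le> m"
    "spectral_path \<Omega> (mat_algebra m A) (pad_zero A m b) (pad_zero A m b')"
    using b unfolding V_rel_iff by blast
  have V: "a \<in> V_set \<Omega> A" "a' \<in> V_set \<Omega> A" "b \<in> V_set \<Omega> A" "b' \<in> V_set \<Omega> A"
    using a b by (simp_all add: V_rel_iff)
  have "1 \<le> dim_row a"
    using V(1) by (simp add: V_set_iff)
  then have "1 \<le> n + m"
    using n(1) by simp
  then have "(diag_block A (pad_zero A n a) (pad_zero A m b), diag_block A (pad_zero A n a') (pad_zero A m b')) \<in> V_rel \<Omega> A"
    by (rule spectral_path_V_rel) (rule diag_block_spectral_path[OF n(3) m(3)])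
  then show ?thesis
    using diag_block_pad_zero[OF V(1,3) n(1) m(1)] diag_block_pad_zero[OF V(2,4) n(2) m(2)]
    by (meson V_rel_sym V_rel_trans)
qed

lemma zero_V_set: "mat 1 1 (\<lambda>_. \<zero>) \<in> V_set \<Omega> A"
  using zero_mat_spectral_part[OF zero_in_domain, of 1] by (intro V_setI[of 1]) (auto simp: mat_algebra_def)

text \<open>\<open>Suc\<close> embeds the indices of \<open>a\<close> behind the leading zero. The
  relation is obtained from the smaller matrix to the larger and then reversed.\<close>

lemma diag_block_zero:
  assumes a: "a \<in> V_set \<Omega> A"
  shows "(diag_block A (mat 1 1 (\<lambda>_. \<zero>)) a, a) \<in> V_rel \<Omega> A"
proof -
  obtain p where p: "1 \<le> p" "dim_row a = p" "a \<in> spectral_part \<Omega> (mat_algebra p A)" "a \<in> carrier (mat_algebra p A)"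
    using a by (rule V_setE)
  have z: "mat 1 1 (\<lambda>_. \<zero>) \<in> carrier (mat_algebra 1 A)"
    by (simp add: carrier_mat_algebra)
  have r: "k \<in> Suc ` {..<p}" if "k < 1 + p" "1 \<le> k" for k
    using that by (intro image_eqI[of _ _ "k - 1"]) auto
  have "(a, diag_block A (mat 1 1 (\<lambda>_. \<zero>)) a) \<in> V_rel \<Omega> A"
  proof (rule V_rel_reindex[OF p(1,3) diag_block_closed[OF z p(4)], of Suc])
    show "inj_on Suc {..<p}" "Suc ` {..<p} \<subseteq> {..<1 + p}"
      by auto
    show "diag_block A (mat 1 1 (\<lambda>_. \<zero>)) a $$ (Suc i, Suc j) = a $$ (i, j)" if "i < p" "j < p" for i j
      using that diag_block_index[OF z p(4), of "Suc i" "Suc j"] by simp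
    show "diag_block A (mat 1 1 (\<lambda>_. \<zero>)) a $$ (k, l) = \<zero>"
      if kl: "k < 1 + p" "l < 1 + p" "k \<notin> Suc ` {..<p} \<or> l \<notin> Suc ` {..<p}" for k l
    proof -
      have "k < 1 \<or> l < 1"
        using r kl by (meson not_less)
      then show ?thesis
        using diag_block_index[OF z p(4) kl(1,2)] by auto
    qed
  qed
  then show ?thesis
    by (rule V_rel_sym)
qed

text \<open>Here the two matrices coincide, so associativity of the monoid involves no path.\<close>

lemma diag_block_assoc:
  assumes "a \<in> V_set \<Omega> A" "b \<in> V_set \<Omega> A" "c \<in> V_set \<Omega> A"
  shows "diag_block A (diag_block A a b) c = diag_block A a (diag_block A b c)"
proof -
  obtain p where a: "a \<in> carrier (mat_algebra p A)"
    using assms V_setE by metis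
  obtain q where b: "b \<in> carrier (mat_algebra q A)"
    using assms V_setE by metis
  obtain r where c: "c \<in> carrier (mat_algebra r A)"
    using assms V_setE by metis
  note ab = diag_block_closed[OF a b] and bc = diag_block_closed[OF b c]
  show ?thesis
  proof (rule mat_algebra_eqI[of _ "p + q + r"])
    fix i j assume ij: "i < p + q + r" "j < p + q + r"
    then have ij': "i < p + (q + r)" "j < p + (q + r)"
      by auto
    show "diag_block A (diag_block A a b) c $$ (i, j) = diag_block A a (diag_block A b c) $$ (i, j)"
      unfolding diag_block_index[OF ab c ij] diag_block_index[OF a bc ij']
      using ij by (cases "i < p"; cases "j < p"; cases "i < p + q"; cases "j < p + q")
        (auto simp: diag_block_index[OF a b] diag_block_index[OF b c] less_diff_conv2 le_diff_conv2
          not_less add.commute)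
  next
    show "diag_block A (diag_block A a b) c \<in> carrier (mat_algebra (p + q + r) A)"
      by (rule diag_block_closed[OF ab c])
    show "diag_block A a (diag_block A b c) \<in> carrier (mat_algebra (p + q + r) A)"
      using diag_block_closed[OF a bc] by (simp add: add.assoc)
  qed
qed

section \<open>The monoid of classes\<close>

definition V_class :: "'a mat \<Rightarrow> 'a mat set"
  where "V_class a = V_rel \<Omega> A `` {a}"

lemma V_class_eq_iff:
  "\<lbrakk>a \<in> V_set \<Omega> A; b \<in> V_set \<Omega> A\<rbrakk> \<Longrightarrow> V_class a = V_class b \<longleftrightarrow> (a, b) \<in> V_rel \<Omega> A"
  unfolding V_class_def by (rule eq_equiv_class_iff[OF equiv_V_rel])

lemma V_carrier: "carrier (V_monoid \<Omega> A) = V_class ` V_set \<Omega> A"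
  by (auto simp: V_monoid_def quotient_def V_class_def)

lemma V_one: "\<one>\<^bsub>V_monoid \<Omega> A\<^esub> = V_class (mat 1 1 (\<lambda>_. \<zero>))"
  by (simp add: V_monoid_def V_class_def)

text \<open>Block sums respect the relation, so the union over all representatives collapses to a
  single class.\<close>

lemma V_mult:
  assumes "a \<in> V_set \<Omega> A" "b \<in> V_set \<Omega> A"
  shows "V_class a \<otimes>\<^bsub>V_monoid \<Omega> A\<^esub> V_class b = V_class (diag_block A a b)"
proof -
  have "congruent2 (V_rel \<Omega> A) (V_rel \<Omega> A) (\<lambda>a b. V_rel \<Omega> A `` {diag_block A a b})"
  proof (rule congruent2I')
    fix a a' b b' assume "(a, a') \<in> V_rel \<Omega> A" "(b, b') \<in> V_rel \<Omega> A"
    then show "V_rel \<Omega> A `` {diag_block A a b} = V_rel \<Omega> A `` {diag_block A a' b'}"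
      by (intro equiv_class_eq[OF equiv_V_rel] diag_block_cong)
  qed
  from UN_equiv_class2[OF equiv_V_rel equiv_V_rel this assms] show ?thesis
    by (simp add: V_monoid_def V_class_def)
qed

lemma comm_monoid_V_monoid: "Group.comm_monoid (V_monoid \<Omega> A)"
proof (rule comm_monoidI)
  fix x y assume "x \<in> carrier (V_monoid \<Omega> A)" "y \<in> carrier (V_monoid \<Omega> A)"
  then obtain a b where ab: "a \<in> V_set \<Omega> A" "b \<in> V_set \<Omega> A" "x = V_class a" "y = V_class b"
    by (auto simp: V_carrier)
  show "x \<otimes>\<^bsub>V_monoid \<Omega> A\<^esub> y \<in> carrier (V_monoid \<Omega> A)"
    using ab by (simp add: V_mult V_carrier diag_block_V_set)
  show "x \<otimes>\<^bsub>V_monoid \<Omega> A\<^esub> y = y \<otimes>\<^bsub>V_monoid \<Omega> A\<^esub> x"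
    using ab by (simp add: V_mult V_class_eq_iff diag_block_V_set diag_block_commute)
next
  show "\<one>\<^bsub>V_monoid \<Omega> A\<^esub> \<in> carrier (V_monoid \<Omega> A)"
    using zero_V_set by (simp add: V_one V_carrier)
next
  fix x assume "x \<in> carrier (V_monoid \<Omega> A)"
  then obtain a where "a \<in> V_set \<Omega> A" "x = V_class a"
    by (auto simp: V_carrier)
  then show "\<one>\<^bsub>V_monoid \<Omega> A\<^esub> \<otimes>\<^bsub>V_monoid \<Omega> A\<^esub> x = x"
    using zero_V_set
    by (simp add: V_one V_mult V_class_eq_iff diag_block_V_set diag_block_zero del: One_nat_def)
next
  fix x y z
  assume "x \<in> carrier (V_monoid \<Omega> A)" "y \<in> carrier (V_monoid \<Omega> A)" "z \<in> carrier (V_monoid \<Omega> A)"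
  then obtain a b c where "a \<in> V_set \<Omega> A" "b \<in> V_set \<Omega> A" "c \<in> V_set \<Omega> A"
    "x = V_class a" "y = V_class b" "z = V_class c"
    by (auto simp: V_carrier)
  then show "x \<otimes>\<^bsub>V_monoid \<Omega> A\<^esub> y \<otimes>\<^bsub>V_monoid \<Omega> A\<^esub> z
      = x \<otimes>\<^bsub>V_monoid \<Omega> A\<^esub> (y \<otimes>\<^bsub>V_monoid \<Omega> A\<^esub> z)"
    by (simp add: V_mult diag_block_V_set diag_block_assoc)
qed

end

section \<open>Grothendieck groups of commutative monoids\<close>

locale grothendieck = Group.comm_monoid G for G :: "'a monoid" (structure)
begin

lemma groth_rel_iff:
  "((x, y), (x', y')) \<in> groth_rel G \<longleftrightarrow>
     x \<in> carrier G \<and> y \<in> carrier G \<and> x' \<in> carrier G \<and> y' \<in> carrier G \<and>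
     (\<exists>z\<in>carrier G. x \<otimes> y' \<otimes> z = x' \<otimes> y \<otimes> z)"
  by (simp add: groth_rel_def)

lemma equiv_groth_rel: "equiv (carrier G \<times> carrier G) (groth_rel G)"
proof (rule equivI)
  show "groth_rel G \<subseteq> (carrier G \<times> carrier G) \<times> (carrier G \<times> carrier G)"
    by (auto simp: groth_rel_def)
  show "refl_on (carrier G \<times> carrier G) (groth_rel G)"
    by (auto simp: refl_on_def groth_rel_iff)
  show "sym (groth_rel G)"
    by (rule symI) (clarsimp simp: groth_rel_def, metis)
  show "trans (groth_rel G)"
  proof (rule transI, clarify)
    fix x y x' y' x'' y''
    assume 1: "((x, y), (x', y')) \<in> groth_rel G" and 2: "((x', y'), (x'', y'')) \<in> groth_rel G"
    then have C: "x \<in> carrier G" "y \<in> carrier G" "x' \<in> carrier G" "y' \<in> carrier G"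
      "x'' \<in> carrier G" "y'' \<in> carrier G"
      by (simp_all add: groth_rel_iff)
    obtain z w where z: "z \<in> carrier G" "x \<otimes> y' \<otimes> z = x' \<otimes> y \<otimes> z"
      and w: "w \<in> carrier G" "x' \<otimes> y'' \<otimes> w = x'' \<otimes> y' \<otimes> w"
      using 1 2 unfolding groth_rel_iff by blast
    have "x \<otimes> y'' \<otimes> (y' \<otimes> z \<otimes> w) = (x \<otimes> y' \<otimes> z) \<otimes> (y'' \<otimes> w)"
      using C z(1) w(1) by (simp add: m_ac)
    also have "\<dots> = (x' \<otimes> y \<otimes> z) \<otimes> (y'' \<otimes> w)"
      by (simp only: z(2))
    also have "\<dots> = (x' \<otimes> y'' \<otimes> w) \<otimes> (y \<otimes> z)"
      using C z(1) w(1) by (simp add: m_ac)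
    also have "\<dots> = (x'' \<otimes> y' \<otimes> w) \<otimes> (y \<otimes> z)"
      by (simp only: w(2))
    also have "\<dots> = x'' \<otimes> y \<otimes> (y' \<otimes> z \<otimes> w)"
      using C z(1) w(1) by (simp add: m_ac)
    finally have "x \<otimes> y'' \<otimes> (y' \<otimes> z \<otimes> w) = x'' \<otimes> y \<otimes> (y' \<otimes> z \<otimes> w)" .
    moreover have "y' \<otimes> z \<otimes> w \<in> carrier G"
      using C z(1) w(1) by simp
    ultimately show "((x, y), (x'', y'')) \<in> groth_rel G"
      using C unfolding groth_rel_iff by blast
  qed
qed

definition groth_class :: "'a \<Rightarrow> 'a \<Rightarrow> ('a \<times> 'a) set"
  where "groth_class x y = groth_rel G `` {(x, y)}"

lemma groth_class_eq_iff:
  assumes "x \<in> carrier G" "y \<in> carrier G" "x' \<in> carrier G" "y' \<in> carrier G"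
  shows "groth_class x y = groth_class x' y' \<longleftrightarrow> ((x, y), (x', y')) \<in> groth_rel G"
  unfolding groth_class_def using assms by (intro eq_equiv_class_iff[OF equiv_groth_rel]) auto

lemma grothendieck_carrier:
  "carrier (grothendieck_group G) = {groth_class x y | x y. x \<in> carrier G \<and> y \<in> carrier G}"
  by (auto simp: grothendieck_group_def quotient_def groth_class_def)

lemma groth_class_closed:
  "\<lbrakk>x \<in> carrier G; y \<in> carrier G\<rbrakk> \<Longrightarrow> groth_class x y \<in> carrier (grothendieck_group G)"
  unfolding grothendieck_carrier by blast

lemma grothendieck_carrierE:
  assumes "U \<in> carrier (grothendieck_group G)"
  obtains x y where "x \<in> carrier G" "y \<in> carrier G" "U = groth_class x y"
  using assms unfolding grothendieck_carrier by blast

lemma groth_rel_mult: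
  assumes 1: "((x, y), (x', y')) \<in> groth_rel G" and 2: "((u, v), (u', v')) \<in> groth_rel G"
  shows "((x \<otimes> u, y \<otimes> v), (x' \<otimes> u', y' \<otimes> v')) \<in> groth_rel G"
proof -
  have C: "x \<in> carrier G" "y \<in> carrier G" "x' \<in> carrier G" "y' \<in> carrier G"
    "u \<in> carrier G" "v \<in> carrier G" "u' \<in> carrier G" "v' \<in> carrier G"
    using 1 2 by (simp_all add: groth_rel_iff)
  obtain z w where z: "z \<in> carrier G" "x \<otimes> y' \<otimes> z = x' \<otimes> y \<otimes> z"
    and w: "w \<in> carrier G" "u \<otimes> v' \<otimes> w = u' \<otimes> v \<otimes> w"
    using 1 2 unfolding groth_rel_iff by blast
  have "(x \<otimes> u) \<otimes> (y' \<otimes> v') \<otimes> (z \<otimes> w) = (x \<otimes> y' \<otimes> z) \<otimes> (u \<otimes> v' \<otimes> w)"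
    using C z(1) w(1) by (simp add: m_ac)
  also have "\<dots> = (x' \<otimes> y \<otimes> z) \<otimes> (u' \<otimes> v \<otimes> w)"
    by (simp only: z(2) w(2))
  also have "\<dots> = (x' \<otimes> u') \<otimes> (y \<otimes> v) \<otimes> (z \<otimes> w)"
    using C z(1) w(1) by (simp add: m_ac)
  finally have "(x \<otimes> u) \<otimes> (y' \<otimes> v') \<otimes> (z \<otimes> w) = (x' \<otimes> u') \<otimes> (y \<otimes> v) \<otimes> (z \<otimes> w)" .
  moreover have "z \<otimes> w \<in> carrier G"
    using z(1) w(1) by simp
  ultimately show ?thesis
    using C unfolding groth_rel_iff by blast
qed

lemma grothendieck_mult:
  assumes "x \<in> carrier G" "y \<in> carrier G" "u \<in> carrier G" "v \<in> carrier G"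
  shows "groth_class x y \<otimes>\<^bsub>grothendieck_group G\<^esub> groth_class u v = groth_class (x \<otimes> u) (y \<otimes> v)"
proof -
  have "congruent2 (groth_rel G) (groth_rel G)
      (\<lambda>(x, y) (x', y'). groth_rel G `` {(x \<otimes> x', y \<otimes> y')})"
    by (rule congruent2I', clarify) (rule equiv_class_eq[OF equiv_groth_rel], erule (1) groth_rel_mult)
  from UN_equiv_class2[OF equiv_groth_rel equiv_groth_rel this, of "(x, y)" "(u, v)"] assms
  show ?thesis
    by (simp add: grothendieck_group_def groth_class_def split_def)
qed

end

lemma grothendieck_map_iso:
  assumes M: "Group.comm_monoid M" and N: "Group.comm_monoid N" and f: "f \<in> iso M N"
  shows "grothendieck_map N f \<in> iso (grothendieck_group M) (grothendieck_group N)"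
proof -
  interpret M: grothendieck M by (rule grothendieck.intro[OF M])
  interpret N: grothendieck N by (rule grothendieck.intro[OF N])
  have fc: "f x \<in> carrier N" if "x \<in> carrier M" for x
    using f that by (auto simp: iso_def hom_def)
  have fm: "f (x \<otimes>\<^bsub>M\<^esub> y) = f x \<otimes>\<^bsub>N\<^esub> f y" if "x \<in> carrier M" "y \<in> carrier M" for x y
    using f that by (auto simp: iso_def hom_def)
  have inj: "inj_on f (carrier M)" and surj: "f ` carrier M = carrier N"
    using f by (auto simp: iso_def bij_betw_def)
  \<comment> \<open>Surjectivity writes each stabilising element of \<open>N\<close> as some
    \<open>f z\<close>, and injectivity then strips \<open>f\<close> from the equation.\<close>
  have rel: "((f x, f y), (f x', f y')) \<in> groth_rel N \<longleftrightarrow> ((x, y), (x', y')) \<in> groth_rel M"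
    if C: "x \<in> carrier M" "y \<in> carrier M" "x' \<in> carrier M" "y' \<in> carrier M" for x y x' y'
  proof -
    have "f x \<otimes>\<^bsub>N\<^esub> f y' \<otimes>\<^bsub>N\<^esub> f z = f x' \<otimes>\<^bsub>N\<^esub> f y \<otimes>\<^bsub>N\<^esub> f z
        \<longleftrightarrow> x \<otimes>\<^bsub>M\<^esub> y' \<otimes>\<^bsub>M\<^esub> z = x' \<otimes>\<^bsub>M\<^esub> y \<otimes>\<^bsub>M\<^esub> z" if "z \<in> carrier M" for z
      using C that inj_on_eq_iff[OF inj, of "x \<otimes>\<^bsub>M\<^esub> y' \<otimes>\<^bsub>M\<^esub> z" "x' \<otimes>\<^bsub>M\<^esub> y \<otimes>\<^bsub>M\<^esub> z"]
      by (simp add: fm)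
    then show ?thesis
      using C fc unfolding M.groth_rel_iff N.groth_rel_iff surj[symmetric] by auto
  qed
  have map: "grothendieck_map N f (M.groth_class x y) = N.groth_class (f x) (f y)"
    if C: "x \<in> carrier M" "y \<in> carrier M" for x y
  proof -
    have "(\<lambda>(x, y). groth_rel N `` {(f x, f y)}) respects groth_rel M"
    proof (rule congruentI, clarify)
      fix x y x' y' assume *: "((x, y), (x', y')) \<in> groth_rel M"
      then show "groth_rel N `` {(f x, f y)} = groth_rel N `` {(f x', f y')}"
        using rel by (intro equiv_class_eq[OF N.equiv_groth_rel]) (simp add: M.groth_rel_iff)
    qed
    from UN_equiv_class[OF M.equiv_groth_rel this, of "(x, y)"] C show ?thesis
      by (simp add: grothendieck_map_def M.groth_class_def N.groth_class_def)
  qed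
  show ?thesis
  proof (rule isoI)
    show "grothendieck_map N f \<in> hom (grothendieck_group M) (grothendieck_group N)"
    proof (rule homI)
      fix U assume "U \<in> carrier (grothendieck_group M)"
      then obtain x y where x: "x \<in> carrier M" "y \<in> carrier M" "U = M.groth_class x y"
        by (rule M.grothendieck_carrierE)
      then show "grothendieck_map N f U \<in> carrier (grothendieck_group N)"
        by (simp add: map fc N.groth_class_closed)
      fix V assume "V \<in> carrier (grothendieck_group M)"
      then obtain u v where u: "u \<in> carrier M" "v \<in> carrier M" "V = M.groth_class u v"
        by (rule M.grothendieck_carrierE)
      show "grothendieck_map N f (U \<otimes>\<^bsub>grothendieck_group M\<^esub> V)
          = grothendieck_map N f U \<otimes>\<^bsub>grothendieck_group N\<^esub> grothendieck_map N f V"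
        using x u by (simp add: map fc fm M.grothendieck_mult N.grothendieck_mult)
    qed
    show "bij_betw (grothendieck_map N f) (carrier (grothendieck_group M)) (carrier (grothendieck_group N))"
    proof (rule bij_betw_imageI)
      show "inj_on (grothendieck_map N f) (carrier (grothendieck_group M))"
      proof (rule inj_onI)
        fix U V assume U: "U \<in> carrier (grothendieck_group M)" and V: "V \<in> carrier (grothendieck_group M)"
          and eq: "grothendieck_map N f U = grothendieck_map N f V"
        obtain x y where x: "x \<in> carrier M" "y \<in> carrier M" "U = M.groth_class x y"
          using U by (rule M.grothendieck_carrierE)
        obtain u v where u: "u \<in> carrier M" "v \<in> carrier M" "V = M.groth_class u v"
          using V by (rule M.grothendieck_carrierE)
        have "((f x, f y), (f u, f v)) \<in> groth_rel N"
          using eq x u by (simp add: map fc N.groth_class_eq_iff)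
        then have "((x, y), (u, v)) \<in> groth_rel M"
          using rel x u by simp
        then show "U = V"
          using x u by (simp only: M.groth_class_eq_iff)
      qed
      show "grothendieck_map N f ` carrier (grothendieck_group M) = carrier (grothendieck_group N)"
      proof
        show "grothendieck_map N f ` carrier (grothendieck_group M) \<subseteq> carrier (grothendieck_group N)"
          using fc by (auto elim!: M.grothendieck_carrierE simp: map N.groth_class_closed)
        show "carrier (grothendieck_group N) \<subseteq> grothendieck_map N f ` carrier (grothendieck_group M)"
        proof
          fix W assume "W \<in> carrier (grothendieck_group N)"
          then obtain x' y' where W: "x' \<in> carrier N" "y' \<in> carrier N" "W = N.groth_class x' y'"
            by (rule N.grothendieck_carrierE)
          obtain x y where x: "x \<in> carrier M" "x' = f x" and y: "y \<in> carrier M" "y' = f y"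
            using W surj by blast
          have "W = grothendieck_map N f (M.groth_class x y)"
            using W x y by (simp add: map)
          then show "W \<in> grothendieck_map N f ` carrier (grothendieck_group M)"
            using M.groth_class_closed[OF x(1) y(1)] by blast
        qed
      qed
    qed
  qed
qed

section \<open>The induced map\<close>

context seminormed_morphism
begin

section \<open>Entrywise application of the morphism\<close>

lemma hom_finsum:
  assumes "finite S" "\<And>k. k \<in> S \<Longrightarrow> f k \<in> carrier A"
  shows "\<phi> (\<Oplus>\<^bsub>A\<^esub>k\<in>S. f k) = (\<Oplus>\<^bsub>B\<^esub>k\<in>S. \<phi> (f k))"
  using assms
proof (induction rule: finite_induct)
  case empty
  then show ?case
    by (simp add: hom_zero)
next
  case (insert x S)
  then have "f \<in> S \<rightarrow> carrier A" "f x \<in> carrier A" "(\<lambda>k. \<phi> (f k)) \<in> S \<rightarrow> carrier B" "\<phi> (f x) \<in> carrier B"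
    by (auto simp: hom(1))
  then show ?case
    using insert by (simp add: A.M.finsum_insert B.M.finsum_insert hom(3) A.M.finsum_closed)
qed

lemma map_mat_closed:
  "M \<in> carrier (mat_algebra n A) \<Longrightarrow> map_mat \<phi> M \<in> carrier (mat_algebra n B)"
  by (simp add: A.carrier_mat_algebra B.carrier_mat_algebra hom(1))

lemma map_mat_mult:
  assumes M: "M \<in> carrier (mat_algebra n A)" and N: "N \<in> carrier (mat_algebra n A)"
  shows "map_mat \<phi> (M \<otimes>\<^bsub>mat_algebra n A\<^esub> N) = map_mat \<phi> M \<otimes>\<^bsub>mat_algebra n B\<^esub> map_mat \<phi> N"
proof (rule B.mat_algebra_eqI[of _ n])
  fix i j assume ij: "i < n" "j < n"
  note C = A.mat_carrierD(3)[OF M] A.mat_carrierD(3)[OF N]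
  note D = A.mat_carrierD(1,2)[OF M] A.mat_carrierD(1,2)[OF N]
    A.mat_carrierD(1,2)[OF A.mat_algebra_mult_closed[OF M N]]
  have "\<phi> (\<Oplus>\<^bsub>A\<^esub>k\<in>{..<n}. M $$ (i, k) \<otimes>\<^bsub>A\<^esub> N $$ (k, j))
      = (\<Oplus>\<^bsub>B\<^esub>k\<in>{..<n}. \<phi> (M $$ (i, k) \<otimes>\<^bsub>A\<^esub> N $$ (k, j)))"
    using C ij by (intro hom_finsum) auto
  also have "\<dots> = (\<Oplus>\<^bsub>B\<^esub>k\<in>{..<n}. map_mat \<phi> M $$ (i, k) \<otimes>\<^bsub>B\<^esub> map_mat \<phi> N $$ (k, j))"
    using C D ij by (intro B.M.finsum_cong') (auto simp: hom)
  finally show "map_mat \<phi> (M \<otimes>\<^bsub>mat_algebra n A\<^esub> N) $$ (i, j)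
      = (map_mat \<phi> M \<otimes>\<^bsub>mat_algebra n B\<^esub> map_mat \<phi> N) $$ (i, j)"
    using ij D by (simp add: A.mat_algebra_index(1) B.mat_algebra_index(1))
qed (intro map_mat_closed A.mat_algebra_mult_closed B.mat_algebra_mult_closed M N)+

lemma map_mat_morphism: "frechet_morphism (mat_algebra n A) (mat_algebra n B) (map_mat \<phi>)"
proof -
  have D: "dim_row M = n" "dim_col M = n" if "M \<in> carrier (mat_algebra n A)" for M
    using A.mat_carrierD[OF that] by auto
  have "map_mat \<phi> \<in> Ring.ring_hom (mat_algebra n A) (mat_algebra n B)"
  proof (rule ring_hom_memI)
    fix M N assume M: "M \<in> carrier (mat_algebra n A)" and N: "N \<in> carrier (mat_algebra n A)"
    show "map_mat \<phi> (M \<oplus>\<^bsub>mat_algebra n A\<^esub> N) = map_mat \<phi> M \<oplus>\<^bsub>mat_algebra n B\<^esub> map_mat \<phi> N"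
    proof (rule B.mat_algebra_eqI[of _ n])
      fix i j assume ij: "i < n" "j < n"
      then show "map_mat \<phi> (M \<oplus>\<^bsub>mat_algebra n A\<^esub> N) $$ (i, j) = (map_mat \<phi> M \<oplus>\<^bsub>mat_algebra n B\<^esub> map_mat \<phi> N) $$ (i, j)"
        using D[OF M] D[OF N] D[OF A.mat_algebra_closed(1)[OF M N]]
        by (simp add: A.mat_algebra_index(2) B.mat_algebra_index(2) hom(3)
            A.mat_carrierD(3)[OF M] A.mat_carrierD(3)[OF N])
    qed (intro map_mat_closed A.mat_algebra_closed B.mat_algebra_closed M N)+
  next
    show "map_mat \<phi> \<one>\<^bsub>mat_algebra n A\<^esub> = \<one>\<^bsub>mat_algebra n B\<^esub>"
    proof (rule B.mat_algebra_eqI[of _ n])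
      fix i j assume ij: "i < n" "j < n"
      then show "map_mat \<phi> \<one>\<^bsub>mat_algebra n A\<^esub> $$ (i, j) = \<one>\<^bsub>mat_algebra n B\<^esub> $$ (i, j)"
        using D[OF A.mat_algebra_closed(3)]
        by (simp add: A.mat_algebra_index(4) B.mat_algebra_index(4) hom(4) hom_zero)
    qed (intro map_mat_closed A.mat_algebra_closed B.mat_algebra_closed)+
  qed (auto intro: map_mat_closed map_mat_mult)
  moreover have "map_mat \<phi> (c \<odot>\<^bsub>mat_algebra n A\<^esub> M) = c \<odot>\<^bsub>mat_algebra n B\<^esub> map_mat \<phi> M"
    if M: "M \<in> carrier (mat_algebra n A)" for c M
  proof (rule B.mat_algebra_eqI[of _ n])
    fix i j assume ij: "i < n" "j < n"
    then show "map_mat \<phi> (c \<odot>\<^bsub>mat_algebra n A\<^esub> M) $$ (i, j) = (c \<odot>\<^bsub>mat_algebra n B\<^esub> map_mat \<phi> M) $$ (i, j)"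
      using D[OF M] D[OF A.mat_algebra_closed(2)[OF M]]
      by (simp add: A.mat_algebra_index(3) B.mat_algebra_index(3) hom(5) A.mat_carrierD(3)[OF M])
  qed (intro map_mat_closed A.mat_algebra_closed B.mat_algebra_closed M)+
  moreover have "continuous_map (frechet_topology (mat_algebra n A)) (frechet_topology (mat_algebra n B)) (map_mat \<phi>)"
    unfolding B.continuous_map_mat_iff
  proof (intro conjI allI impI)
    have T: "topspace (frechet_topology (mat_algebra n A)) = carrier (mat_algebra n A)"
      by (rule seminormed_algebra.topspace_frechet[OF A.mat_algebra_seminormed])
    show "map_mat \<phi> \<in> topspace (frechet_topology (mat_algebra n A)) \<rightarrow> carrier (mat_algebra n B)"
      unfolding T by (intro funcsetI map_mat_closed)
    fix i j assume ij: "i < n" "j < n"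
    have "continuous_map (frechet_topology (mat_algebra n A)) (frechet_topology B) (\<phi> \<circ> (\<lambda>M. M $$ (i, j)))"
      using A.continuous_map_mat_index[OF ij] hom(6) by (rule continuous_map_compose)
    then show "continuous_map (frechet_topology (mat_algebra n A)) (frechet_topology B) (\<lambda>M. map_mat \<phi> M $$ (i, j))"
      by (rule continuous_map_eq) (simp add: T D ij)
  qed
  ultimately show ?thesis
    unfolding frechet_morphism_def by blast
qed

text \<open>The entries of a matrix can be approximated independently, so density at every size
  follows from density of \<phi>.\<close>

lemma map_mat_dense:
  assumes dense: "dense_morphism A B \<phi>" and n: "1 \<le> n"
  shows "dense_morphism (mat_algebra n A) (mat_algebra n B) (map_mat \<phi>)"
proof -
  interpret Bn: seminormed_algebra "mat_algebra n B"
    by (rule B.mat_algebra_seminormed)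
  have "map_mat \<phi> ` carrier (mat_algebra n A) \<inter> W \<noteq> {}"
    if W: "openin (frechet_topology (mat_algebra n B)) W" "W \<noteq> {}" for W
  proof -
    obtain N where N: "N \<in> W"
      using W by blast
    obtain K r where r: "0 < r" "Bn.nball K N r \<subseteq> W"
      using W(1) N unfolding Bn.openin_frechet_iff by meson
    have Nc: "N \<in> carrier (mat_algebra n B)"
      using openin_subset[OF W(1)] N by auto
    \<comment> \<open>Each of the \<open>n * n\<close> entries gets an equal share of the radius; as
      there is at least one entry, the strict bounds add up to a strict bound.\<close>
    define \<delta> where "\<delta> = r / (of_nat n * of_nat n)"
    have \<delta>: "0 < \<delta>"
      using r n by (simp add: \<delta>_def)
    have "\<exists>x. x \<in> carrier A \<and> \<phi> x \<in> B.nball K (N $$ (i, j)) \<delta>" if ij: "i < n" "j < n" for i j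
    proof -
      have "N $$ (i, j) \<in> carrier B"
        using B.mat_carrierD(3)[OF Nc ij] .
      then have "openin (frechet_topology B) (B.nball K (N $$ (i, j)) \<delta>)" "B.nball K (N $$ (i, j)) \<delta> \<noteq> {}"
        using B.openin_nball B.centre_in_nball \<delta> by blast+
      then have "\<phi> ` carrier A \<inter> B.nball K (N $$ (i, j)) \<delta> \<noteq> {}"
        using dense dense_intersects_open[of "frechet_topology B" "\<phi> ` carrier A"]
        by (simp add: dense_morphism_def dense_in_def)
      then show ?thesis
        by blast
    qed
    then obtain x where x: "\<And>i j. \<lbrakk>i < n; j < n\<rbrakk> \<Longrightarrow> x i j \<in> carrier A"
      "\<And>i j. \<lbrakk>i < n; j < n\<rbrakk> \<Longrightarrow> \<phi> (x i j) \<in> B.nball K (N $$ (i, j)) \<delta>"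
      by metis
    define M where "M = mat n n (\<lambda>(i, j). x i j)"
    have M: "M \<in> carrier (mat_algebra n A)"
      using x(1) by (simp add: M_def A.carrier_mat_algebra)
    have "seminorm (mat_algebra n B) k (map_mat \<phi> M \<ominus>\<^bsub>mat_algebra n B\<^esub> N) < r" if k: "k \<le> K" for k
    proof -
      have "seminorm B k ((map_mat \<phi> M \<ominus>\<^bsub>mat_algebra n B\<^esub> N) $$ (i, j)) < \<delta>" if ij: "i < n" "j < n" for i j
        using x(2)[OF ij] k ij unfolding B.mat_algebra_diff_index[OF map_mat_closed[OF M] Nc ij]
        by (simp add: M_def B.nball_def)
      then have "(\<Sum>i<n. \<Sum>j<n. seminorm B k ((map_mat \<phi> M \<ominus>\<^bsub>mat_algebra n B\<^esub> N) $$ (i, j))) < (\<Sum>i<n. \<Sum>j<n. \<delta>)"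
        using n by (intro sum_strict_mono) (auto simp: lessThan_empty_iff)
      also have "\<dots> = r"
        using n by (simp add: \<delta>_def)
      finally show ?thesis
        by (simp add: B.mat_algebra_seminorm)
    qed
    then have "map_mat \<phi> M \<in> W"
      using r(2) map_mat_closed[OF M] by (auto simp: Bn.nball_def)
    then show ?thesis
      using M by blast
  qed
  then show ?thesis
    using dense_intersects_open[of "frechet_topology (mat_algebra n B)" "map_mat \<phi> ` carrier (mat_algebra n A)"]
    by (simp add: dense_morphism_def dense_in_def)
qed

lemma map_mat_diag_block:
  assumes a: "a \<in> carrier (mat_algebra p A)" and b: "b \<in> carrier (mat_algebra q A)"
  shows "map_mat \<phi> (diag_block A a b) = diag_block B (map_mat \<phi> a) (map_mat \<phi> b)"
proof (rule B.mat_algebra_eqI[of _ "p + q"])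
  fix i j assume ij: "i < p + q" "j < p + q"
  then show "map_mat \<phi> (diag_block A a b) $$ (i, j) = diag_block B (map_mat \<phi> a) (map_mat \<phi> b) $$ (i, j)"
    using A.mat_carrierD(1,2)[OF a] A.mat_carrierD(1,2)[OF b]
    by (auto simp: B.diag_block_index[OF map_mat_closed[OF a] map_mat_closed[OF b]]
        A.diag_block_index[OF a b] A.diag_block_dims hom_zero)
qed (intro map_mat_closed A.diag_block_closed B.diag_block_closed a b)+

lemma map_mat_pad_zero:
  assumes a: "a \<in> carrier (mat_algebra p A)" and "p \<le> n"
  shows "map_mat \<phi> (pad_zero A n a) = pad_zero B n (map_mat \<phi> a)"
proof -
  have "map_mat \<phi> \<zero>\<^bsub>mat_algebra (n - p) A\<^esub> = \<zero>\<^bsub>mat_algebra (n - p) B\<^esub>"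
    by (rule eq_matI) (auto simp: mat_algebra_def hom_zero)
  then show ?thesis
    using A.mat_carrierD(1)[OF a] map_mat_diag_block[OF a A.mat_algebra_closed(4)[of "n - p"]]
    by (simp add: A.pad_zero_eq B.pad_zero_eq)
qed

end

section \<open>The isomorphism of K-groups\<close>

theorem proposition7p9:
  fixes A :: "'a frechet_alg" and B :: "'b frechet_alg"
    and \<phi> :: "'a \<Rightarrow> 'b" and \<Omega> :: "complex set"
  assumes "open \<Omega>" and "0 \<in> \<Omega>"
    and "good_frechet_algebra A" and "good_frechet_algebra B"
    and "frechet_morphism A B \<phi>"
    and "dense_morphism A B \<phi>"
    and "completely_relatively_spectral A B \<phi>"
  shows "K_map \<Omega> B \<phi> \<in> iso (K_group \<Omega> A) (K_group \<Omega> B)"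
proof -
  interpret GA: good_frechet_algebra A by fact
  interpret GB: good_frechet_algebra B by fact
  interpret A: spectral_algebra A \<Omega>
    by unfold_locales (rule assms(2))
  interpret B: spectral_algebra B \<Omega>
    by unfold_locales (rule assms(2))
  interpret \<phi>: seminormed_morphism A B \<phi>
    by unfold_locales (rule assms(5))
  \<comment> \<open>The core supplied by this interpretation depends on \<open>n\<close>; each
    comparison of paths below is made at one size.\<close>
  have mats: "dense_spectral_morphism (mat_algebra n A) (mat_algebra n B) (map_mat \<phi>) \<Omega>" if n: "1 \<le> n" for n
  proof (intro dense_spectral_morphism.intro seminormed_morphism.intro dense_spectral_morphism_axioms.intro
      seminormed_morphism_axioms.intro)
    show An: "seminormed_algebra (mat_algebra n A)" and Bn: "seminormed_algebra (mat_algebra n B)"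
      by (rule GA.mat_algebra_seminormed GB.mat_algebra_seminormed)+
    show "openin (frechet_topology (mat_algebra n A)) (spectral_part \<Omega> (mat_algebra n A))"
      by (rule seminormed_algebra.openin_spectral_part[OF An assms(1) GA.openin_Units_mat])
    show "openin (frechet_topology (mat_algebra n B)) (spectral_part \<Omega> (mat_algebra n B))"
      by (rule seminormed_algebra.openin_spectral_part[OF Bn assms(1) GB.openin_Units_mat])
    show "frechet_morphism (mat_algebra n A) (mat_algebra n B) (map_mat \<phi>)"
      by (rule \<phi>.map_mat_morphism)
    show "dense_morphism (mat_algebra n A) (mat_algebra n B) (map_mat \<phi>)"
      by (rule \<phi>.map_mat_dense[OF assms(6) n])
    show "relatively_spectral (mat_algebra n A) (mat_algebra n B) (map_mat \<phi>)"
      using assms(7) n by (simp add: completely_relatively_spectral_def)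
  qed
  have V_set: "map_mat \<phi> a \<in> V_set \<Omega> B" if a: "a \<in> V_set \<Omega> A" for a
  proof -
    obtain p where p: "1 \<le> p" "a \<in> spectral_part \<Omega> (mat_algebra p A)"
      using a by (rule A.V_setE)
    interpret p: dense_spectral_morphism "mat_algebra p A" "mat_algebra p B" "map_mat \<phi>" \<Omega>
      by (rule mats[OF p(1)])
    show ?thesis
      using p by (intro B.V_setI[OF p(1)] p.hom_spectral_part)
  qed
  have V_rel: "(map_mat \<phi> a, map_mat \<phi> b) \<in> V_rel \<Omega> B \<longleftrightarrow> (a, b) \<in> V_rel \<Omega> A"
    if a: "a \<in> V_set \<Omega> A" and b: "b \<in> V_set \<Omega> A" for a b
  proof -
    obtain p where p: "1 \<le> p" "dim_row a = p" "a \<in> spectral_part \<Omega> (mat_algebra p A)" "a \<in> carrier (mat_algebra p A)"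
      using a by (rule A.V_setE)
    obtain q where q: "1 \<le> q" "dim_row b = q" "b \<in> spectral_part \<Omega> (mat_algebra q A)" "b \<in> carrier (mat_algebra q A)"
      using b by (rule A.V_setE)
    \<comment> \<open>The padded matrices need not lie in the core of size \<open>n\<close>;
      \<open>spectral_path_inj\<close> covers the whole spectral part, so it applies to
      them.\<close>
    have "spectral_path \<Omega> (mat_algebra n B) (pad_zero B n (map_mat \<phi> a)) (pad_zero B n (map_mat \<phi> b))
        \<longleftrightarrow> spectral_path \<Omega> (mat_algebra n A) (pad_zero A n a) (pad_zero A n b)"
      if n: "p \<le> n" "q \<le> n" for n
    proof -
      have "1 \<le> n"
        using n p by simp
      then interpret n: dense_spectral_morphism "mat_algebra n A" "mat_algebra n B" "map_mat \<phi>" \<Omega>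
        by (rule mats)
      have "spectral_path \<Omega> (mat_algebra n B) (map_mat \<phi> (pad_zero A n a)) (map_mat \<phi> (pad_zero A n b))
          \<longleftrightarrow> spectral_path \<Omega> (mat_algebra n A) (pad_zero A n a) (pad_zero A n b)"
        using n.spectral_path_inj[OF GA.pad_zero_spectral_part[OF assms(2) n(1) p(3)]
            GA.pad_zero_spectral_part[OF assms(2) n(2) q(3)]] n.hom_spectral_path by blast
      then show ?thesis
        by (simp only: \<phi>.map_mat_pad_zero[OF p(4) n(1)] \<phi>.map_mat_pad_zero[OF q(4) n(2)])
    qed
    then show ?thesis
      using V_set a b p(2) q(2) unfolding A.V_rel_iff B.V_rel_iff by auto
  qed
  \<comment> \<open>A preimage is found at the size of \<open>b\<close> itself, so no padding is
    involved.\<close>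
  have V_surj: "\<exists>a\<in>V_set \<Omega> A. (map_mat \<phi> a, b) \<in> V_rel \<Omega> B" if b: "b \<in> V_set \<Omega> B" for b
  proof -
    obtain p where p: "1 \<le> p" "b \<in> spectral_part \<Omega> (mat_algebra p B)"
      using b by (rule B.V_setE)
    interpret p: dense_spectral_morphism "mat_algebra p A" "mat_algebra p B" "map_mat \<phi>" \<Omega>
      by (rule mats[OF p(1)])
    obtain a where "a \<in> spectral_part \<Omega> (mat_algebra p A)" "spectral_path \<Omega> (mat_algebra p B) (map_mat \<phi> a) b"
      using p.spectral_path_surj[OF p(2)] .
    then show ?thesis
      using A.V_setI[OF p(1)] B.spectral_path_V_rel[OF p(1)] by blast
  qed
  have V_map: "V_map \<Omega> B \<phi> (A.V_class a) = B.V_class (map_mat \<phi> a)" if a: "a \<in> V_set \<Omega> A" for a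
  proof -
    have "(\<lambda>a. V_rel \<Omega> B `` {map_mat \<phi> a}) respects V_rel \<Omega> A"
    proof (rule congruentI)
      fix a b assume ab: "(a, b) \<in> V_rel \<Omega> A"
      then have "(map_mat \<phi> a, map_mat \<phi> b) \<in> V_rel \<Omega> B"
        using V_rel by (simp add: A.V_rel_iff)
      then show "V_rel \<Omega> B `` {map_mat \<phi> a} = V_rel \<Omega> B `` {map_mat \<phi> b}"
        by (rule equiv_class_eq[OF B.equiv_V_rel])
    qed
    from UN_equiv_class[OF A.equiv_V_rel this a] show ?thesis
      by (simp add: V_map_def A.V_class_def B.V_class_def)
  qed
  have "V_map \<Omega> B \<phi> \<in> iso (V_monoid \<Omega> A) (V_monoid \<Omega> B)"
  proof (rule isoI)
    show "V_map \<Omega> B \<phi> \<in> hom (V_monoid \<Omega> A) (V_monoid \<Omega> B)"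
    proof (rule homI)
      fix x assume "x \<in> carrier (V_monoid \<Omega> A)"
      then obtain a where a: "a \<in> V_set \<Omega> A" "x = A.V_class a"
        by (auto simp: A.V_carrier)
      then show "V_map \<Omega> B \<phi> x \<in> carrier (V_monoid \<Omega> B)"
        by (simp add: V_map B.V_carrier V_set)
      fix y assume "y \<in> carrier (V_monoid \<Omega> A)"
      then obtain b where b: "b \<in> V_set \<Omega> A" "y = A.V_class b"
        by (auto simp: A.V_carrier)
      have "map_mat \<phi> (diag_block A a b) = diag_block B (map_mat \<phi> a) (map_mat \<phi> b)"
        using a(1) b(1) \<phi>.map_mat_diag_block by (metis A.V_setE)
      then show "V_map \<Omega> B \<phi> (x \<otimes>\<^bsub>V_monoid \<Omega> A\<^esub> y) = V_map \<Omega> B \<phi> x \<otimes>\<^bsub>V_monoid \<Omega> B\<^esub> V_map \<Omega> B \<phi> y"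
        using a b by (simp add: A.V_mult B.V_mult V_map V_set A.diag_block_V_set)
    qed
    show "bij_betw (V_map \<Omega> B \<phi>) (carrier (V_monoid \<Omega> A)) (carrier (V_monoid \<Omega> B))"
    proof (rule bij_betw_imageI)
      show "inj_on (V_map \<Omega> B \<phi>) (carrier (V_monoid \<Omega> A))"
      proof (rule inj_onI)
        fix x y assume "x \<in> carrier (V_monoid \<Omega> A)" "y \<in> carrier (V_monoid \<Omega> A)"
          and eq: "V_map \<Omega> B \<phi> x = V_map \<Omega> B \<phi> y"
        then obtain a b where a: "a \<in> V_set \<Omega> A" "x = A.V_class a"
          and b: "b \<in> V_set \<Omega> A" "y = A.V_class b"
          by (auto simp: A.V_carrier)
        then have "(map_mat \<phi> a, map_mat \<phi> b) \<in> V_rel \<Omega> B"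
          using eq by (simp add: V_map B.V_class_eq_iff V_set)
        then show "x = y"
          using a b by (simp add: V_rel A.V_class_eq_iff)
      qed
      show "V_map \<Omega> B \<phi> ` carrier (V_monoid \<Omega> A) = carrier (V_monoid \<Omega> B)"
      proof
        show "V_map \<Omega> B \<phi> ` carrier (V_monoid \<Omega> A) \<subseteq> carrier (V_monoid \<Omega> B)"
          by (auto simp: A.V_carrier B.V_carrier V_map V_set)
        show "carrier (V_monoid \<Omega> B) \<subseteq> V_map \<Omega> B \<phi> ` carrier (V_monoid \<Omega> A)"
        proof
          fix y assume "y \<in> carrier (V_monoid \<Omega> B)"
          then obtain b where b: "b \<in> V_set \<Omega> B" "y = B.V_class b"
            by (auto simp: B.V_carrier)
          then obtain a where a: "a \<in> V_set \<Omega> A" "(map_mat \<phi> a, b) \<in> V_rel \<Omega> B"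
            using V_surj by blast
          then have "y = V_map \<Omega> B \<phi> (A.V_class a)"
            using b B.V_rel_sym by (simp add: V_map V_set B.V_class_eq_iff)
          then show "y \<in> V_map \<Omega> B \<phi> ` carrier (V_monoid \<Omega> A)"
            using a by (auto simp: A.V_carrier)
        qed
      qed
    qed
  qed
  then show ?thesis
    unfolding K_map_def K_group_def
    by (intro grothendieck_map_iso A.comm_monoid_V_monoid B.comm_monoid_V_monoid)
qed

end
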